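(* Let $\mathcal{F}:\mathcal{R}\to\mathbf{Top}^*$ be a resonance functor such that $\mathcal{F}(1^l)$ is contractible for $l\ge2$. Let $\lambda=(\lambda_1,\dots,\lambda_n)$, $\lambda_1\le\dots\le\lambda_n$, be a sequential partition such that $I(\lambda)$ exists. Then: (1) If $mm(\lambda)\ge2$, then $\mathcal{F}(\lambda)$ is contractible. (2) If $mm(\lambda)=1$, then $\mathcal{F}(\lambda)\simeq\mathcal{F}(Q(T,\nu\downarrow T))\wedge\mathcal{F}(1)$, and there is the inclusion triple $\mathcal{F}(\mu)\stackrel{i}{\hookrightarrow}\mathcal{F}(\lambda_1,\dots,\lambda_{n-1})\to\mathcal{F}(Q(T,\nu\downarrow T))$, where $\mu=(\lambda_{j_1},\dots,\lambda_{j_t})$ with $\{j_1,\dots,j_t\}=[n]\setminus I(\lambda)$, $T=\{x\in\{-1,0,1\}^{n-mm(\lambda)}:\sum_{i=1}^{n-mm(\lambda)}x_i\lambda_i=0\}$, and $\nu\in P(n-mm(\lambda))$ is the partition whose only nonsingleton block is given by $I(\lambda)$. If moreover $\lambda$ is strongly sequential, then the map $i$ is homotopic to a trivial map (mapping everything to a point), hence the triple splits and $$\mathcal{F}(\lambda)\simeq(\mathcal{F}(1)\wedge\mathcal{F}(\lambda_1,\dots,\lambda_{n-1}))\vee\mathrm{susp}(\mathcal{F}(1)\wedge\mathcal{F}(\mu)).$$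
   Context: Sequential partitions. A number partition $\lambda=(\lambda_1,\dots,\lambda_n)$, $\lambda_1\le\dots\le\lambda_n$ (positive integers), is sequential if whenever $\sum_{i\in I}\lambda_i=\sum_{j\in J}\lambda_j$ for $I,J\subseteq[n]$ and $q\in I$ with $q=\max(I\cup J)$, there is $\widetilde J\subseteq J$ with $\lambda_q=\sum_{j\in\widetilde J}\lambda_j$. Put $mm(\lambda)=|\{i\in[n]:\lambda_i=\lambda_n\}|$. $I(\lambda)\subseteq[n]$ is the lexicographically maximal set with $|I(\lambda)|\ge2$ and $\lambda_n=\sum_{i\in I(\lambda)}\lambda_i$ (it need not exist). Lexicographic order: for $A=\{a_1\leq\dots\leq a_k\}$, $B=\{b_1\leq\dots\leq b_m\}\subseteq[n]$, $A$ is larger than $B$ if $A\supseteq B$ or there is $q<\min(k,m)$ with $a_k=b_m,\dots,a_{k-q+1}=b_{m-q+1}$ and $a_{k-q}>b_{m-q}$. A sequential $\lambda$, with $q=\max I(\lambda)$, is strongly sequential if there is $J\subseteq I(\lambda)\setminus\{q\}$ with $\lambda_q=\sum_{i\in J}\lambda_i$ ($|J|\ge2$ is not required). Cuts. For $A\subseteq\{-1,0,1\}^n$ let $\mathrm{span}(A)$ denote the intersection of $\{-1,0,1\}^n$ with the linear span of $A$ in $\mathbb{R}^n$. An $n$-cut is a subset $S\subseteq\{-1,0,1\}^n$ with $\mathrm{span}(S)=S$ such that every nonzero $x\in S$ has at least one coordinate equal to $1$ and at least one equal to $-1$. $\mathcal{R}_n$ is the set of $n$-cuts. For $x\in\{-1,0,1\}^n$,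 $\mathrm{Plus}(x)=\{i:x_i=1\}$, $\mathrm{Minus}(x)=\{i:x_i=-1\}$. $\mathcal{S}_n$ acts on $\mathcal{R}_n$ by permuting coordinates. Partitions. $P(A)$ (resp. $OP(A)$) is the set of unordered (resp. ordered) set partitions of $A$; $P(n)=P([n])$, $OP(n)=OP([n])$; $\mathrm{un}:OP(n)\to P(n)$ forgets the order. For an ordered set partition $\pi=(\pi_1,\dots,\pi_k)$ of $[m]$ and $\nu=(\nu_1,\dots,\nu_m)$ of $[n]$, $\pi\circ\nu=(\mu_1,\dots,\mu_k)$ with $\mu_i=\bigcup_{j\in\pi_i}\nu_j$. For $S\in\mathcal{R}_n$ and $\pi=(\pi_1,\dots,\pi_m)\in OP(n)$, $\pi S\in\mathcal{R}_m$ is the set of $(t_1,\dots,t_m)\in\{-1,0,1\}^m$ such that the vector $s$ with $s_i=t_j$ for $i\in\pi_j$ lies in $S$. For $\pi\in P(n)$, $S^\pi$ is the set of $s\in S$ such that whenever $i\ne j$ lie in the same block of $\pi$, $s_i=s_j\ne0$. Resonance category $\mathcal{R}$: objects are all $n$-cuts, $n\ge1$; morphisms $S\to T$ ($S\in\mathcal{R}_m$, $T\in\mathcal{R}_n$) are triples $(S,T,\pi)$ with $\pi$ an ordered set partition of $[n]$ into $m$ blocks such that $S\subseteq\pi T$; the composite of $(S,T,\pi):S\to T$ and $(T,Q,\nu):T\to Q$ is $(S,Q,\pi\circ\nu)$. The morphism $(\pi T,T,\pi)$ is written $\pi T\stackrel{\pi}{\hookrightarrow}T$. Relative cuts. Let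 $A(n)$ be the set of collections of nonempty multisubsets of $[n]$. For $S\in\mathcal{R}_n$ and $\mathcal{A}\in A(n)$, $\mathcal{A}\Downarrow S\subseteq A(n)$ is the smallest set with: (1) $\mathcal{A}\in\mathcal{A}\Downarrow S$; (2) if $\{B_1,B_2,\dots,B_m\}\in\mathcal{A}\Downarrow S$ then $\{B_1\cup B_2,B_3,\dots,B_m\}\in\mathcal{A}\Downarrow S$; (3) if $\{B_1,\dots,B_m\}\in\mathcal{A}\Downarrow S$ and there is $x\in S$ with $\mathrm{Plus}(x)\subseteq B_1$ then $\{(B_1\setminus\mathrm{Plus}(x))\cup\mathrm{Minus}(x),B_2,\dots,B_m\}\in\mathcal{A}\Downarrow S$ (multiset operations). For $\pi\in P(n)$, $\pi\downarrow S=(\pi\Downarrow S)\cap P(n)$; for $\Pi\subseteq P(n)$, $\Pi\downarrow S=\bigcup_{\pi\in\Pi}\pi\downarrow S$, and $\Pi$ is $S$-closed if $\Pi\downarrow S=\Pi$. For $S$-closed $\Pi$ put $S\setminus\Pi=S\setminus\bigcup_{\pi\in\Pi}S^\pi$. A relative $n$-cut is a pair $(S,\Pi)$, $S\subseteq\{-1,0,1\}^n$, $\Pi\subseteq P(n)$, with $\Pi$ $(\mathrm{span}\,S)$-closed and $(\mathrm{span}\,S)\setminus\Pi=S$. $\mathcal{S}_n$ acts on relative $n$-cuts by $(S,\Pi)\mapsto(\sigma S,\Pi\sigma^{-1})$; the orbit of $(S,\Pi)$ is $[S,\Pi]$. For $S\in\mathcal{R}_n$ and $S$-closed $\Pi$,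 $Q(S,\Pi)=(S\setminus\Pi,\Pi)$; thus $(S,\Pi)=Q(\mathrm{span}\,S,\Pi)$. For a relative $n$-cut $(S,\Pi)$ and a relative $m$-cut $(T,\Lambda)$, $(S,\Pi)\times(T,\Lambda)=(S\times T,(\Pi\times P(m))\cup(P(n)\times\Lambda))$, where (identifying $[m]$ with $\{n+1,\dots,n+m\}$) $\Pi'\times\Lambda'$ is the set of partitions of $[n+m]$ whose restriction to $[n]$ is in $\Pi'$ and to $\{n+1,\dots,n+m\}$ is in $\Lambda'$. Resonance functor: for a functor $\mathcal{F}:\mathcal{R}\to\mathbf{Top}^*$ (pointed topological spaces) put $\mathcal{F}(Q(S,\Pi))=\mathcal{F}(S)/\bigcup_{\mathrm{un}(\pi)\in\Pi}\mathrm{Im}\,\mathcal{F}(\pi S\stackrel{\pi}{\hookrightarrow}S)$. $\mathcal{F}$ is a resonance functor if: (A1) for $S\in\mathcal{R}_n$, $\pi\in OP(n)$, $\mathcal{F}(\pi S\stackrel{\pi}{\hookrightarrow}S)$ is an inclusion map and $\mathcal{F}(S)/\mathrm{Im}\,\mathcal{F}(\pi S\stackrel{\pi}{\hookrightarrow}S)\simeq\mathcal{F}(Q(S,\mathrm{un}(\pi)\downarrow S))$; (A2) if $[Q(S,\Pi)]=[Q(T,\Lambda)]$ then $\mathcal{F}(Q(S,\Pi))\simeq\mathcal{F}(Q(T,\Lambda))$; (A3) $\mathcal{F}(S,\Pi)\wedge\mathcal{F}(T,\Lambda)\simeq\mathcal{F}((S,\Pi)\times(T,\Lambda))$ for relative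 cuts $(S,\Pi)$, $(T,\Lambda)$. An inclusion triple is $A\hookrightarrow X\to X/A$; here the inclusion $i$ is the one induced by the morphism $\tilde\nu T\stackrel{\tilde\nu}{\hookrightarrow}T$, with $\tilde\nu$ an ordering of $\nu$. Notation $\mathcal{F}(\lambda)$: for a number partition with parts $\lambda=(\lambda_1,\dots,\lambda_n)$ (in any order), $\mathcal{F}(\lambda)=\mathcal{F}(S_\lambda)$ with $S_\lambda=\{x\in\{-1,0,1\}^n:\sum_ix_i\lambda_i=0\}$, well defined up to homeomorphism. $(1^l)$ is the partition with $l$ parts equal to $1$. $\wedge$ is the smash product, $\vee$ the wedge and $\mathrm{susp}$ the suspension.
   Formalization: In (A1) and in "inclusion triple", "inclusion map" means an embedding with the pointed homotopy extension property (a cofibration); for bare topological embeddings part (1) fails, e.g. for λ=(1,1,2,2). *)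

theory Defs
  imports "HOL-Analysis.Analysis" "HOL-Library.Multiset" "HOL-Combinatorics.Permutations"
begin

section \<open>Pointed spaces\<close>

text \<open>The second component is the base point.\<close>

type_synonym 'a pspace = "'a topology \<times> 'a"

definition is_pspace :: "'a pspace \<Rightarrow> bool" where
  "is_pspace X \<longleftrightarrow> snd X \<in> topspace (fst X)"

definition pointed_map :: "'a pspace \<Rightarrow> 'b pspace \<Rightarrow> ('a \<Rightarrow> 'b) \<Rightarrow> bool" where
  "pointed_map X Y f \<longleftrightarrow> continuous_map (fst X) (fst Y) f \<and> f (snd X) = snd Y"

definition pointed_homeo :: "'a pspace \<Rightarrow> 'b pspace \<Rightarrow> ('a \<Rightarrow> 'b) \<Rightarrow> bool" where
  "pointed_homeo X Y f \<longleftrightarrow> homeomorphic_map (fst X) (fst Y) f \<and> f (snd X) = snd Y"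

definition pointed_homotopic :: "'a pspace \<Rightarrow> 'b pspace \<Rightarrow> ('a \<Rightarrow> 'b) \<Rightarrow> ('a \<Rightarrow> 'b) \<Rightarrow> bool" where
  "pointed_homotopic X Y = homotopic_with (\<lambda>h. h (snd X) = snd Y) (fst X) (fst Y)"

definition pointed_equiv :: "'a pspace \<Rightarrow> 'b pspace \<Rightarrow> bool" (infix \<open>\<simeq>\<^sub>*\<close> 50) where
  "X \<simeq>\<^sub>* Y \<longleftrightarrow> (\<exists>f g. pointed_map X Y f \<and> pointed_map Y X g \<and>
      pointed_homotopic X X (g \<circ> f) id \<and> pointed_homotopic Y Y (f \<circ> g) id)"

definition pointed_contractible :: "'a pspace \<Rightarrow> bool" where
  "pointed_contractible X \<longleftrightarrow> pointed_homotopic X X id (\<lambda>_. snd X)"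

definition quotient_topology :: "'a topology \<Rightarrow> ('a \<Rightarrow> 'b) \<Rightarrow> 'b topology" where
  "quotient_topology X f =
     topology (\<lambda>U. U \<subseteq> f ` topspace X \<and> openin X {x \<in> topspace X. f x \<in> U})"

lemma openin_quotient_topology:
  "openin (quotient_topology X f) U \<longleftrightarrow>
     U \<subseteq> f ` topspace X \<and> openin X {x \<in> topspace X. f x \<in> U}"
proof -
  have "istopology (\<lambda>U. U \<subseteq> f ` topspace X \<and> openin X {x \<in> topspace X. f x \<in> U})"
    unfolding istopology_def
  proof (intro conjI allI impI)
    fix S T
    assume "S \<subseteq> f ` topspace X \<and> openin X {x \<in> topspace X. f x \<in> S}"
      and "T \<subseteq> f ` topspace X \<and> openin X {x \<in> topspace X. f x \<in> T}"
    moreover have "{x \<in> topspace X. f x \<in> S \<inter> T} =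
        {x \<in> topspace X. f x \<in> S} \<inter> {x \<in> topspace X. f x \<in> T}" by auto
    ultimately show "S \<inter> T \<subseteq> f ` topspace X" "openin X {x \<in> topspace X. f x \<in> S \<inter> T}"
      by (auto simp del: Int_iff)
  next
    fix K
    assume K: "\<forall>U\<in>K. U \<subseteq> f ` topspace X \<and> openin X {x \<in> topspace X. f x \<in> U}"
    have "{x \<in> topspace X. f x \<in> \<Union>K} = (\<Union>U\<in>K. {x \<in> topspace X. f x \<in> U})" by auto
    then show "openin X {x \<in> topspace X. f x \<in> \<Union>K}" using K by auto
    show "\<Union>K \<subseteq> f ` topspace X" using K by blast
  qed
  then show ?thesis
    by (simp add: quotient_topology_def topology_inverse')
qed

lemma topspace_quotient_topology [simp]: "topspace (quotient_topology X f) = f ` topspace X"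
proof -
  have "{x \<in> topspace X. f x \<in> f ` topspace X} = topspace X" by auto
  then have "openin (quotient_topology X f) (f ` topspace X)"
    by (simp add: openin_quotient_topology)
  moreover have "\<And>U. openin (quotient_topology X f) U \<Longrightarrow> U \<subseteq> f ` topspace X"
    by (simp add: openin_quotient_topology)
  ultimately show ?thesis
    by (metis openin_subset openin_topspace subset_antisym)
qed

lemma quotient_map_quotient_topology: "quotient_map X (quotient_topology X f) f"
  by (simp add: quotient_map_def openin_quotient_topology)

text \<open>The quotient \<open>X / A\<close>, with the class of \<open>A\<close> represented by the base point.
  It is meant for sets \<open>A\<close> that contain the base point or are empty; in the latter case
  it is \<open>X\<close> itself.\<close>

definition pquot :: "'a pspace \<Rightarrow> 'a set \<Rightarrow> 'a pspace" where
  "pquot X A = (quotient_topology (fst X) (\<lambda>x. if x \<in> A then snd X else x), snd X)"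

definition wedge_set :: "'a pspace \<Rightarrow> 'b pspace \<Rightarrow> ('a \<times> 'b) set" where
  "wedge_set X Y = topspace (fst X) \<times> {snd Y} \<union> {snd X} \<times> topspace (fst Y)"

definition pwedge :: "'a pspace \<Rightarrow> 'b pspace \<Rightarrow> ('a \<times> 'b) pspace" (infixr \<open>\<or>\<^sub>*\<close> 65) where
  "X \<or>\<^sub>* Y = (subtopology (prod_topology (fst X) (fst Y)) (wedge_set X Y), (snd X, snd Y))"

definition smash :: "'a pspace \<Rightarrow> 'b pspace \<Rightarrow> ('a \<times> 'b) pspace" (infixr \<open>\<and>\<^sub>*\<close> 70) where
  "X \<and>\<^sub>* Y = pquot (prod_topology (fst X) (fst Y), (snd X, snd Y)) (wedge_set X Y)"

text \<open>The suspension in pointed spaces is the reduced one: the segment over the base point is collapsed too.\<close>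

definition psusp :: "'a pspace \<Rightarrow> ('a \<times> real) pspace" where
  "psusp X = pquot (prod_topology (fst X) (top_of_set {0..1}), (snd X, 0))
     (topspace (fst X) \<times> {0, 1} \<union> {snd X} \<times> {0..1})"

text \<open>Pointed homotopy extension property. Targets on the type \<open>'a \<times> real\<close> suffice, because
  the universal target, the reduced mapping cylinder of \<open>i\<close>, has a copy with points
  \<open>(x, 0)\<close> for \<open>x\<close> in \<open>X\<close> and \<open>(i a, t)\<close> for \<open>a\<close> in \<open>A\<close>, \<open>a\<close> not the base point, \<open>0 < t \<le> 1\<close>.\<close>

definition pointed_HEP :: "'a pspace \<Rightarrow> 'a pspace \<Rightarrow> ('a \<Rightarrow> 'a) \<Rightarrow> bool" where
  "pointed_HEP A X i \<longleftrightarrow> (\<forall>(Y :: ('a \<times> real) pspace) f h.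
     is_pspace Y \<and> pointed_map X Y f \<and>
     continuous_map (prod_topology (top_of_set {0..1}) (fst A)) (fst Y) h \<and>
     (\<forall>a\<in>topspace (fst A). h (0, a) = f (i a)) \<and> (\<forall>t\<in>{0..1}. h (t, snd A) = snd Y) \<longrightarrow>
     (\<exists>H. continuous_map (prod_topology (top_of_set {0..1 :: real}) (fst X)) (fst Y) H \<and>
        (\<forall>x\<in>topspace (fst X). H (0, x) = f x) \<and>
        (\<forall>t\<in>{0..1}. \<forall>a\<in>topspace (fst A). H (t, i a) = h (t, a))))"

text \<open>Inclusions are understood in the sense of homotopy theory, as embeddings that are
  cofibrations. Without the extension property, collapsing a contractible image need not preserve
  the homotopy type, nor is the quotient the mapping cone.\<close>

definition inclusion_map :: "'a pspace \<Rightarrow> 'a pspace \<Rightarrow> ('a \<Rightarrow> 'a) \<Rightarrow> bool" where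
  "inclusion_map A X i \<longleftrightarrow>
     pointed_map A X i \<and> embedding_map (fst A) (fst X) i \<and> pointed_HEP A X i"

text \<open>The sequence \<open>A \<rightarrow> X \<rightarrow> X / A\<close> starting with \<open>i\<close>, its third term given up to
  homotopy equivalence.\<close>

definition inclusion_triple :: "'a pspace \<Rightarrow> 'a pspace \<Rightarrow> 'b pspace \<Rightarrow> ('a \<Rightarrow> 'a) \<Rightarrow> bool" where
  "inclusion_triple A X Z i \<longleftrightarrow> inclusion_map A X i \<and> pquot X (i ` topspace (fst A)) \<simeq>\<^sub>* Z"


section \<open>Cuts and set partitions\<close>

text \<open>Elements of \<open>{-1,0,1}\<^sup>n\<close> are functions vanishing outside \<open>{1..n}\<close>. The dimension
  is therefore carried along explicitly, and an object of the resonance category is a pair \<open>(n, S)\<close>.\<close>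

type_synonym tvec = "nat \<Rightarrow> int"
type_synonym cut = "nat \<times> tvec set"

definition tvecs :: "nat \<Rightarrow> tvec set" where
  "tvecs n = {x. (\<forall>i\<in>{1..n}. x i \<in> {-1, 0, 1}) \<and> (\<forall>i. i \<notin> {1..n} \<longrightarrow> x i = 0)}"

definition lspan :: "nat \<Rightarrow> tvec set \<Rightarrow> tvec set" where
  "lspan n A = {x \<in> tvecs n. \<exists>B (c :: tvec \<Rightarrow> real). finite B \<and> B \<subseteq> A \<and>
      (\<forall>i\<in>{1..n}. of_int (x i) = (\<Sum>b\<in>B. c b * of_int (b i)))}"

definition Plus :: "tvec \<Rightarrow> nat set" where "Plus x = {i. x i = 1}"
definition Minus :: "tvec \<Rightarrow> nat set" where "Minus x = {i. x i = -1}"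

definition cuts :: "nat \<Rightarrow> tvec set set" where
  "cuts n = {S. S \<subseteq> tvecs n \<and> lspan n S = S \<and>
      (\<forall>x\<in>S. x \<noteq> (\<lambda>_. 0) \<longrightarrow> Plus x \<noteq> {} \<and> Minus x \<noteq> {})}"

definition parts :: "nat \<Rightarrow> nat set set set" where
  "parts n = {P. partition_on {1..n} P}"

text \<open>The \<open>j\<close>-th block of an ordered partition \<open>p\<close> is \<open>p ! (j - 1)\<close>; forgetting the order is \<open>set\<close>.\<close>

definition ord_parts :: "nat \<Rightarrow> nat set list set" where
  "ord_parts n = {p. distinct p \<and> set p \<in> parts n}"

definition comp_part :: "nat set list \<Rightarrow> nat set list \<Rightarrow> nat set list" where
  "comp_part p v = map (\<lambda>P. \<Union>j\<in>P. v ! (j - 1)) p"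

definition id_part :: "nat \<Rightarrow> nat set list" where
  "id_part n = map (\<lambda>i. {i}) [1..<Suc n]"

definition pull :: "nat set list \<Rightarrow> tvec set \<Rightarrow> tvec set" where
  "pull p S = {t \<in> tvecs (length p). \<exists>s\<in>S. \<forall>j\<in>{1..length p}. \<forall>i\<in>p ! (j - 1). s i = t j}"

definition pull_obj :: "nat set list \<Rightarrow> tvec set \<Rightarrow> cut" where
  "pull_obj p S = (length p, pull p S)"

definition res_obj :: "cut \<Rightarrow> bool" where
  "res_obj c \<longleftrightarrow> 1 \<le> fst c \<and> snd c \<in> cuts (fst c)"

definition res_mor :: "cut \<Rightarrow> cut \<Rightarrow> nat set list \<Rightarrow> bool" where
  "res_mor a b p \<longleftrightarrow> res_obj a \<and> res_obj b \<and>
     p \<in> ord_parts (fst b) \<and> length p = fst a \<and> snd a \<subseteq> pull p (snd b)"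


section \<open>Relative cuts\<close>

text \<open>Collections of multisubsets are multisets of multisets, and unions of multisets are
  sums of multiplicities.\<close>

inductive_set Down :: "nat multiset multiset \<Rightarrow> tvec set \<Rightarrow> nat multiset multiset set"
  for A :: "nat multiset multiset" and S :: "tvec set" where
  start: "A \<in> Down A S"
| merge: "add_mset B1 (add_mset B2 R) \<in> Down A S \<Longrightarrow> add_mset (B1 + B2) R \<in> Down A S"
| swap: "add_mset B R \<in> Down A S \<Longrightarrow> x \<in> S \<Longrightarrow> mset_set (Plus x) \<subseteq># B \<Longrightarrow>
     add_mset (B - mset_set (Plus x) + mset_set (Minus x)) R \<in> Down A S"

definition part_mset :: "nat set set \<Rightarrow> nat multiset multiset" where
  "part_mset P = image_mset mset_set (mset_set P)"

definition down :: "nat \<Rightarrow> nat set set \<Rightarrow> tvec set \<Rightarrow> nat set set set" where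
  "down n P S = {P' \<in> parts n. part_mset P' \<in> Down (part_mset P) S}"

definition down_closed :: "nat \<Rightarrow> tvec set \<Rightarrow> nat set set set \<Rightarrow> bool" where
  "down_closed n S PP \<longleftrightarrow> PP \<subseteq> parts n \<and> (\<Union>P\<in>PP. down n P S) = PP"

definition cut_at :: "tvec set \<Rightarrow> nat set set \<Rightarrow> tvec set" where
  "cut_at S P = {s \<in> S. \<forall>B\<in>P. \<forall>i\<in>B. \<forall>j\<in>B. i \<noteq> j \<longrightarrow> s i = s j \<and> s i \<noteq> 0}"

definition cut_diff :: "tvec set \<Rightarrow> nat set set set \<Rightarrow> tvec set" where
  "cut_diff S PP = S - (\<Union>P\<in>PP. cut_at S P)"

definition Q :: "tvec set \<Rightarrow> nat set set set \<Rightarrow> tvec set \<times> nat set set set" where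
  "Q S PP = (cut_diff S PP, PP)"

definition rel_cut :: "nat \<Rightarrow> tvec set \<Rightarrow> nat set set set \<Rightarrow> bool" where
  "rel_cut n S PP \<longleftrightarrow> S \<subseteq> tvecs n \<and> lspan n S \<in> cuts n \<and>
     down_closed n (lspan n S) PP \<and> cut_diff (lspan n S) PP = S"

definition perm_act :: "(nat \<Rightarrow> nat) \<Rightarrow> tvec set \<times> nat set set set \<Rightarrow> tvec set \<times> nat set set set" where
  "perm_act \<sigma> c = ((\<lambda>x. x \<circ> inv \<sigma>) ` fst c, (\<lambda>P. (\<lambda>B. \<sigma> ` B) ` P) ` snd c)"

definition cut_orbit :: "nat \<Rightarrow> tvec set \<times> nat set set set \<Rightarrow> (tvec set \<times> nat set set set) set" where
  "cut_orbit n c = {perm_act \<sigma> c |\<sigma>. \<sigma> permutes {1..n}}"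

definition cut_prod :: "nat \<Rightarrow> tvec set \<Rightarrow> nat \<Rightarrow> tvec set \<Rightarrow> tvec set" where
  "cut_prod n S m T = {x \<in> tvecs (n + m).
     (\<lambda>i. if i \<in> {1..n} then x i else 0) \<in> S \<and>
     (\<lambda>i. if i \<in> {1..m} then x (n + i) else 0) \<in> T}"

definition restrict_part :: "nat set set \<Rightarrow> nat set \<Rightarrow> nat set set" where
  "restrict_part P A = (\<lambda>B. B \<inter> A) ` P - {{}}"

definition part_prod ::
  "nat \<Rightarrow> nat set set set \<Rightarrow> nat \<Rightarrow> nat set set set \<Rightarrow> nat set set set" where
  "part_prod n PP m LL = {P \<in> parts (n + m). restrict_part P {1..n} \<in> PP \<and>
     (\<lambda>B. (\<lambda>i. i - n) ` B) ` restrict_part P {n+1..n+m} \<in> LL}"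


section \<open>Resonance functors\<close>

text \<open>A functor is given by its object map \<open>Fo\<close> and its morphism map \<open>Fm\<close>, where \<open>Fm a b p\<close>
  is the image of the morphism \<open>(a, b, p)\<close>. Since the category has countably many
  objects, all values can be placed on one type.\<close>

definition res_functor ::
  "(cut \<Rightarrow> 'a pspace) \<Rightarrow> (cut \<Rightarrow> cut \<Rightarrow> nat set list \<Rightarrow> 'a \<Rightarrow> 'a) \<Rightarrow> bool" where
  "res_functor Fo Fm \<longleftrightarrow>
     (\<forall>c. res_obj c \<longrightarrow> is_pspace (Fo c)) \<and>
     (\<forall>a b p. res_mor a b p \<longrightarrow> pointed_map (Fo a) (Fo b) (Fm a b p)) \<and>
     (\<forall>c. res_obj c \<longrightarrow> (\<forall>x\<in>topspace (fst (Fo c)). Fm c c (id_part (fst c)) x = x)) \<and>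
     (\<forall>a b c p v. res_mor a b p \<and> res_mor b c v \<longrightarrow>
        (\<forall>x\<in>topspace (fst (Fo a)). Fm a c (comp_part p v) x = Fm b c v (Fm a b p x)))"

definition mor_image ::
  "(cut \<Rightarrow> 'a pspace) \<Rightarrow> (cut \<Rightarrow> cut \<Rightarrow> nat set list \<Rightarrow> 'a \<Rightarrow> 'a) \<Rightarrow> nat \<Rightarrow> tvec set \<Rightarrow> nat set list \<Rightarrow> 'a set" where
  "mor_image Fo Fm n S p =
     Fm (pull_obj p S) (n, S) p ` topspace (fst (Fo (pull_obj p S)))"

text \<open>The value of the functor on \<open>Q S PP\<close>. It is a function of \<open>S\<close> and \<open>PP\<close>, since \<open>S\<close> need not be
  recoverable from the pair \<open>Q S PP\<close>.\<close>

definition FQ ::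
  "(cut \<Rightarrow> 'a pspace) \<Rightarrow> (cut \<Rightarrow> cut \<Rightarrow> nat set list \<Rightarrow> 'a \<Rightarrow> 'a) \<Rightarrow> nat \<Rightarrow> tvec set \<Rightarrow> nat set set set \<Rightarrow> 'a pspace" where
  "FQ Fo Fm n S PP = pquot (Fo (n, S)) (\<Union>p\<in>{p \<in> ord_parts n. set p \<in> PP}. mor_image Fo Fm n S p)"

definition Frel ::
  "(cut \<Rightarrow> 'a pspace) \<Rightarrow> (cut \<Rightarrow> cut \<Rightarrow> nat set list \<Rightarrow> 'a \<Rightarrow> 'a) \<Rightarrow> nat \<Rightarrow> tvec set \<Rightarrow> nat set set set \<Rightarrow> 'a pspace" where
  "Frel Fo Fm n S PP = FQ Fo Fm n (lspan n S) PP"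

definition resonance_functor ::
  "(cut \<Rightarrow> 'a pspace) \<Rightarrow> (cut \<Rightarrow> cut \<Rightarrow> nat set list \<Rightarrow> 'a \<Rightarrow> 'a) \<Rightarrow> bool" where
  "resonance_functor Fo Fm \<longleftrightarrow> res_functor Fo Fm \<and>
     (\<forall>n\<ge>1. \<forall>S\<in>cuts n. \<forall>p\<in>ord_parts n.
        inclusion_map (Fo (pull_obj p S)) (Fo (n, S)) (Fm (pull_obj p S) (n, S) p) \<and>
        pquot (Fo (n, S)) (mor_image Fo Fm n S p) \<simeq>\<^sub>* FQ Fo Fm n S (down n (set p) S)) \<and>
     (\<forall>n\<ge>1. \<forall>S\<in>cuts n. \<forall>T\<in>cuts n. \<forall>PP LL.
        down_closed n S PP \<and> down_closed n T LL \<and> cut_orbit n (Q S PP) = cut_orbit n (Q T LL) \<longrightarrow>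
        FQ Fo Fm n S PP \<simeq>\<^sub>* FQ Fo Fm n T LL) \<and>
     (\<forall>n\<ge>1. \<forall>m\<ge>1. \<forall>S T PP LL. rel_cut n S PP \<and> rel_cut m T LL \<longrightarrow>
        Frel Fo Fm n S PP \<and>\<^sub>* Frel Fo Fm m T LL \<simeq>\<^sub>*
        Frel Fo Fm (n + m) (cut_prod n S m T)
          (part_prod n PP m (parts m) \<union> part_prod n (parts n) m LL))"


section \<open>Sequential partitions\<close>

definition number_partition :: "nat \<Rightarrow> (nat \<Rightarrow> nat) \<Rightarrow> bool" where
  "number_partition n l \<longleftrightarrow> 1 \<le> n \<and> (\<forall>i\<in>{1..n}. 0 < l i) \<and> mono_on {1..n} l"

definition sequential :: "nat \<Rightarrow> (nat \<Rightarrow> nat) \<Rightarrow> bool" where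
  "sequential n l \<longleftrightarrow> (\<forall>I J q. I \<subseteq> {1..n} \<and> J \<subseteq> {1..n} \<and> sum l I = sum l J \<and>
     q \<in> I \<and> q = Max (I \<union> J) \<longrightarrow> (\<exists>J'\<subseteq>J. l q = sum l J'))"

definition mm :: "nat \<Rightarrow> (nat \<Rightarrow> nat) \<Rightarrow> nat" where
  "mm n l = card {i \<in> {1..n}. l i = l n}"

definition lex_larger :: "nat set \<Rightarrow> nat set \<Rightarrow> bool" where
  "lex_larger A B \<longleftrightarrow> B \<subseteq> A \<or>
     (let a = sorted_list_of_set A; b = sorted_list_of_set B; k = card A; m = card B in
       \<exists>q < min k m. (\<forall>r<q. a ! (k - 1 - r) = b ! (m - 1 - r)) \<and>
         b ! (m - 1 - q) < a ! (k - 1 - q))"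

definition summing_sets :: "nat \<Rightarrow> (nat \<Rightarrow> nat) \<Rightarrow> nat set set" where
  "summing_sets n l = {A. A \<subseteq> {1..n} \<and> 2 \<le> card A \<and> l n = sum l A}"

text \<open>\<open>is_Iset n l A\<close> says that \<open>I(l)\<close> exists and equals \<open>A\<close>.\<close>

definition is_Iset :: "nat \<Rightarrow> (nat \<Rightarrow> nat) \<Rightarrow> nat set \<Rightarrow> bool" where
  "is_Iset n l A \<longleftrightarrow> A \<in> summing_sets n l \<and> (\<forall>B\<in>summing_sets n l. lex_larger A B)"

definition strongly_sequential :: "nat \<Rightarrow> (nat \<Rightarrow> nat) \<Rightarrow> bool" where
  "strongly_sequential n l \<longleftrightarrow> sequential n l \<and>
     (\<exists>A. is_Iset n l A \<and> (\<exists>J \<subseteq> A - {Max A}. l (Max A) = sum l J))"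

definition weight_cut :: "nat \<Rightarrow> (nat \<Rightarrow> nat) \<Rightarrow> tvec set" where
  "weight_cut n l = {x \<in> tvecs n. (\<Sum>i=1..n. x i * int (l i)) = 0}"

definition Fpart :: "(cut \<Rightarrow> 'a pspace) \<Rightarrow> nat \<Rightarrow> (nat \<Rightarrow> nat) \<Rightarrow> 'a pspace" where
  "Fpart Fo n l = Fo (n, weight_cut n l)"

text \<open>The partition with parts \<open>l j\<close>, \<open>j \<in> J\<close>; it has \<open>card J\<close> parts.\<close>

definition subpartition :: "(nat \<Rightarrow> nat) \<Rightarrow> nat set \<Rightarrow> nat \<Rightarrow> nat" where
  "subpartition l J k = l (sorted_list_of_set J ! (k - 1))"

definition block_partition :: "nat \<Rightarrow> nat set \<Rightarrow> nat set set" where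
  "block_partition n B = insert B ((\<lambda>i. {i}) ` ({1..n} - B))"

end

theory Submission
  imports Defs
begin

text \<open>Let \<open>t\<close> be the largest part of \<open>\<lambda>\<close>, of multiplicity \<open>m\<close>. A relation in which the coordinates at
  \<open>t\<close> do not sum to zero contains, by sequentiality, the coordinates of a set \<open>J\<close> of smaller parts
  with sum \<open>t\<close>, and maximality of \<open>I(\<lambda>)\<close> makes the set partition with block \<open>J\<close> reachable from the
  one with block \<open>I(\<lambda>)\<close>. Hence \<open>Q(S, \<nu>\<down>S)\<close> is the product of \<open>Q(T, \<nu>\<down>T)\<close> with the cut of
  \<open>(1, \<dots>, 1)\<close>, and the axioms identify \<open>F(\<lambda>) / F(\<nu>S)\<close> with the smash product of \<open>F(Q(T, \<nu>\<down>T))\<close> and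
  \<open>F(1, \<dots>, 1)\<close>. The cut \<open>\<nu>S\<close> belongs to a sequential partition with \<open>m + 1\<close> parts \<open>t\<close> and fewer
  parts altogether, so by induction \<open>F(\<nu>S)\<close> is contractible and may be collapsed.

  If \<open>\<lambda>\<close> is strongly sequential, \<open>i\<close> factors through the value at the partition in which \<open>J\<close>
  is merged into a second copy of \<open>v = \<lambda>\<^sub>q\<close>. There no part larger than \<open>v\<close> is a sum involving
  \<open>v\<close>, and this is enough for contractibility by the same induction. The quotient by a
  null-homotopic cofibration splits by comparing mapping cones.

  Smash products of arbitrary spaces need not commute with suspensions. The last splitting is
  therefore not deduced from that of \<open>F(Q(T, \<nu>\<down>T))\<close>; instead the argument is repeated for
  \<open>T \<times> {0}\<close>, which is the cut of \<open>\<lambda>\<close> with its largest part replaced by one exceeding the sum of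
  all the others.\<close>

section \<open>Pointed homotopy theory\<close>

text \<open>The closure \<open>\<nu>\<down>S\<close> is generated by an open-ended rewriting of
  multisets. It becomes tractable because every cut in play is given by one linear equation with
  positive weights: membership then means that the old blocks can be distributed over the new ones
  with matching weights. The product structure is a statement about such distributions, in which the
  item of a largest part can be traded for other items of weight \<open>t\<close>. Sequentiality
  must survive merging. For a set with sum \<open>t\<close> merged into a copy of \<open>t\<close>,
  expanding that copy undoes the merge. The obstacle is merging \<open>J\<close> into a second
  \<open>v\<close>: a sum giving some \<open>p > v\<close> might use the new copy. Cancelling what
  such a sum shares with I(\<lambda>) and applying sequentiality to the rest shows that it shares
  nothing, because maximality of I(\<lambda>) keeps every \<open>p > v\<close> out of the sums equal
  to \<open>t\<close>. Only \<open>F(1, \<dots>, 1)\<close> with at least two ones is contractible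
  by assumption. With a single largest part the other smash factor must be contractible, so both
  copies of \<open>v\<close> have to survive deleting the largest parts and also collapsing; this is
  why the avoidance condition is carried through that induction.\<close>

abbreviation unit_top :: "real topology" where
  "unit_top \<equiv> top_of_set {0..1}"

lemma continuous_map_fstI: "continuous_map Z (prod_topology X Y) f \<Longrightarrow> continuous_map Z X (\<lambda>z. fst (f z))"
  by (simp add: continuous_map_pairwise o_def)

lemma continuous_map_sndI: "continuous_map Z (prod_topology X Y) f \<Longrightarrow> continuous_map Z Y (\<lambda>z. snd (f z))"
  by (simp add: continuous_map_pairwise o_def)

lemma continuous_map_comp: "continuous_map X Y h \<Longrightarrow> continuous_map Z X f \<Longrightarrow> continuous_map Z Y (\<lambda>z. h (f z))"
  using continuous_map_compose[of Z X f Y h] by (simp add: o_def)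

lemma continuous_map_idI: "continuous_map X X (\<lambda>z. z)"
  by simp

text \<open>The interval is locally compact Hausdorff, hence the product with it preserves quotient
  maps. Every descent of a homotopy to a quotient rests on this.\<close>

lemma quotient_map_unit_prod:
  assumes "quotient_map X Y f"
  shows "quotient_map (prod_topology unit_top X) (prod_topology unit_top Y) (\<lambda>z. (fst z, f (snd z)))"
proof -
  have "locally_compact_space unit_top"
    by (simp add: compact_imp_locally_compact_space compact_space_subtopology)
  then have "quotient_map (prod_topology unit_top X) (prod_topology unit_top Y) (\<lambda>(x, y). (x, f y))"
    by (intro quotient_map_prod_right disjI1 Hausdorff_space_subtopology assms) auto
  then show ?thesis
    by (simp add: case_prod_unfold)
qed

lemma pointed_homotopic_iff:
  assumes "is_pspace X"
  shows "pointed_homotopic X Y p q \<longleftrightarrow>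
    (\<exists>h. continuous_map (prod_topology unit_top (fst X)) (fst Y) h \<and>
      (\<forall>x\<in>topspace (fst X). h (0, x) = p x) \<and> (\<forall>x\<in>topspace (fst X). h (1, x) = q x) \<and>
      (\<forall>t\<in>{0..1}. h (t, snd X) = snd Y))"
  unfolding pointed_homotopic_def
  by (rule homotopic_with) (use assms in \<open>auto simp: is_pspace_def\<close>)

text \<open>The endpoint equations hold at all points, inside and outside the space, as in
  \<open>homotopic_with\<close>; simplification then raises no membership conditions.\<close>

lemma pointed_homotopicE:
  assumes "pointed_homotopic X Y p q"
  obtains h where "continuous_map (prod_topology unit_top (fst X)) (fst Y) h"
    and "\<And>x. h (0, x) = p x" and "\<And>x. h (1, x) = q x" and "\<And>t. 0 \<le> t \<Longrightarrow> t \<le> 1 \<Longrightarrow> h (t, snd X) = snd Y"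
  using assms unfolding pointed_homotopic_def homotopic_with_def by auto

lemma pointed_homotopic_eq:
  assumes "is_pspace X" and "pointed_map X Y p" and "\<And>x. x \<in> topspace (fst X) \<Longrightarrow> p x = q x"
  shows "pointed_homotopic X Y p q"
  unfolding pointed_homotopic_iff[OF assms(1)]
proof (intro exI conjI)
  show "continuous_map (prod_topology unit_top (fst X)) (fst Y) (\<lambda>z. p (snd z))"
    using assms(2) continuous_map_comp[OF _ continuous_map_snd] by (auto simp: pointed_map_def)
qed (use assms in \<open>auto simp: pointed_map_def is_pspace_def\<close>)

lemma pointed_homotopic_trans:
  "pointed_homotopic X Y f g \<Longrightarrow> pointed_homotopic X Y g h \<Longrightarrow> pointed_homotopic X Y f h"
  unfolding pointed_homotopic_def by (rule homotopic_with_trans)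

lemma pointed_homotopic_sym: "pointed_homotopic X Y f g \<Longrightarrow> pointed_homotopic X Y g f"
  unfolding pointed_homotopic_def by (rule homotopic_with_symD)

lemma pointed_homotopic_compose_left:
  "pointed_homotopic X Y f g \<Longrightarrow> pointed_map Y Z h \<Longrightarrow> pointed_homotopic X Z (h \<circ> f) (h \<circ> g)"
  unfolding pointed_homotopic_def pointed_map_def
  by (elim conjE, rule homotopic_with_compose_continuous_map_left, assumption, assumption) simp

lemma pointed_homotopic_compose_right:
  "pointed_homotopic Y Z f g \<Longrightarrow> pointed_map X Y h \<Longrightarrow> pointed_homotopic X Z (f \<circ> h) (g \<circ> h)"
  unfolding pointed_homotopic_def pointed_map_def
  by (elim conjE, rule homotopic_with_compose_continuous_map_right, assumption, assumption) simp

lemma pointed_map_compose: "pointed_map X Y f \<Longrightarrow> pointed_map Y Z g \<Longrightarrow> pointed_map X Z (g \<circ> f)"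
  unfolding pointed_map_def by (auto intro: continuous_map_compose)

lemma pointed_map_topspace: "pointed_map X Y f \<Longrightarrow> x \<in> topspace (fst X) \<Longrightarrow> f x \<in> topspace (fst Y)"
  unfolding pointed_map_def continuous_map_def by blast

lemma pointed_equiv_sym: "X \<simeq>\<^sub>* Y \<Longrightarrow> Y \<simeq>\<^sub>* X"
  unfolding pointed_equiv_def by blast

lemma pointed_equiv_refl: "X \<simeq>\<^sub>* X"
  unfolding pointed_equiv_def
  by (intro exI[of _ id] conjI) (auto simp: pointed_map_def pointed_homotopic_def)

lemma pointed_equiv_trans:
  assumes "X \<simeq>\<^sub>* Y" and "Y \<simeq>\<^sub>* Z"
  shows "X \<simeq>\<^sub>* Z"
proof -
  obtain f g where fg: "pointed_map X Y f" "pointed_map Y X g"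
    "pointed_homotopic X X (g \<circ> f) id" "pointed_homotopic Y Y (f \<circ> g) id"
    using assms(1) by (auto simp: pointed_equiv_def)
  obtain f' g' where fg': "pointed_map Y Z f'" "pointed_map Z Y g'"
    "pointed_homotopic Y Y (g' \<circ> f') id" "pointed_homotopic Z Z (f' \<circ> g') id"
    using assms(2) by (auto simp: pointed_equiv_def)
  have "pointed_homotopic X X (g \<circ> (g' \<circ> f' \<circ> f)) (g \<circ> (id \<circ> f))"
    by (rule pointed_homotopic_compose_left[OF pointed_homotopic_compose_right[OF fg'(3) fg(1)] fg(2)])
  then have 1: "pointed_homotopic X X ((g \<circ> g') \<circ> (f' \<circ> f)) id"
    using pointed_homotopic_trans[OF _ fg(3)] by (simp add: o_assoc)
  have "pointed_homotopic Z Z (f' \<circ> (f \<circ> g \<circ> g')) (f' \<circ> (id \<circ> g'))"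
    by (rule pointed_homotopic_compose_left[OF pointed_homotopic_compose_right[OF fg(4) fg'(2)] fg'(1)])
  then have 2: "pointed_homotopic Z Z ((f' \<circ> f) \<circ> (g \<circ> g')) id"
    using pointed_homotopic_trans[OF _ fg'(4)] by (simp add: o_assoc)
  show ?thesis
    unfolding pointed_equiv_def
    by (intro exI[of _ "f' \<circ> f"] exI[of _ "g \<circ> g'"] conjI pointed_map_compose[OF fg(1) fg'(1)]
        pointed_map_compose[OF fg'(2) fg(2)] 1 2)
qed

lemma pointed_homeoE:
  assumes "pointed_homeo X Y f" and "is_pspace X"
  obtains g where "pointed_map X Y f" "pointed_map Y X g"
    "\<And>x. x \<in> topspace (fst X) \<Longrightarrow> g (f x) = x" "\<And>y. y \<in> topspace (fst Y) \<Longrightarrow> f (g y) = y"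
proof -
  obtain g where "homeomorphic_maps (fst X) (fst Y) f g"
    using assms(1) by (auto simp: pointed_homeo_def homeomorphic_map_maps)
  with assms show thesis
    by (intro that[of g]) (auto simp: pointed_homeo_def homeomorphic_maps_def pointed_map_def is_pspace_def)
qed

lemma pointed_homeoI:
  assumes "pointed_map X Y f" "pointed_map Y X g"
    "\<And>x. x \<in> topspace (fst X) \<Longrightarrow> g (f x) = x" "\<And>y. y \<in> topspace (fst Y) \<Longrightarrow> f (g y) = y"
  shows "pointed_homeo X Y f"
  using assms unfolding pointed_homeo_def homeomorphic_map_maps homeomorphic_maps_def pointed_map_def by auto

lemma pointed_homeo_imp_equiv:
  assumes "pointed_homeo X Y f" and "is_pspace X" and "is_pspace Y"
  shows "X \<simeq>\<^sub>* Y"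
proof -
  obtain g where g: "pointed_map X Y f" "pointed_map Y X g"
    "\<And>x. x \<in> topspace (fst X) \<Longrightarrow> g (f x) = x" "\<And>y. y \<in> topspace (fst Y) \<Longrightarrow> f (g y) = y"
    using pointed_homeoE[OF assms(1,2)] by blast
  show ?thesis
    unfolding pointed_equiv_def
    by (intro exI[of _ f] exI[of _ g] conjI pointed_homotopic_eq assms pointed_map_compose[OF g(1,2)]
        pointed_map_compose[OF g(2,1)] g) (simp_all add: g)
qed

lemma pointed_contractible_equiv:
  assumes "X \<simeq>\<^sub>* Y" and "pointed_contractible Y"
  shows "pointed_contractible X"
proof -
  obtain f g where fg: "pointed_map X Y f" "pointed_map Y X g" "pointed_homotopic X X (g \<circ> f) id"
    using assms(1) by (auto simp: pointed_equiv_def)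
  have "pointed_homotopic X X (g \<circ> (id \<circ> f)) (g \<circ> ((\<lambda>_. snd Y) \<circ> f))"
    using assms(2) unfolding pointed_contractible_def
    by (rule pointed_homotopic_compose_left[OF pointed_homotopic_compose_right[OF _ fg(1)] fg(2)])
  moreover have "g \<circ> ((\<lambda>_. snd Y) \<circ> f) = (\<lambda>_. snd X)"
    using fg(2) by (auto simp: pointed_map_def)
  ultimately show ?thesis
    using pointed_homotopic_trans[OF pointed_homotopic_sym[OF fg(3)]]
    by (simp add: pointed_contractible_def)
qed

lemma pointed_homotopic_through_contractible:
  assumes "pointed_contractible Y" and "pointed_map X Y f" and "pointed_map Y Z g"
  shows "pointed_homotopic X Z (g \<circ> f) (\<lambda>_. snd Z)"
proof -
  have "pointed_homotopic X Z (g \<circ> (id \<circ> f)) (g \<circ> ((\<lambda>_. snd Y) \<circ> f))"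
    using assms(1) unfolding pointed_contractible_def
    by (rule pointed_homotopic_compose_left[OF pointed_homotopic_compose_right[OF _ assms(2)] assms(3)])
  moreover have "g \<circ> ((\<lambda>_. snd Y) \<circ> f) = (\<lambda>_. snd Z)"
    using assms(3) by (auto simp: pointed_map_def)
  ultimately show ?thesis by simp
qed


subsection \<open>Quotients\<close>

lemma snd_pquot [simp]: "snd (pquot X A) = snd X"
  by (simp add: pquot_def)

lemma topspace_pquot: "topspace (fst (pquot X A)) = (\<lambda>x. if x \<in> A then snd X else x) ` topspace (fst X)"
  by (simp add: pquot_def)

lemma topspace_pquot_subset: "is_pspace X \<Longrightarrow> topspace (fst (pquot X A)) \<subseteq> topspace (fst X)"
  by (auto simp: topspace_pquot is_pspace_def)

lemma is_pspace_pquot: "is_pspace X \<Longrightarrow> is_pspace (pquot X A)"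
  by (force simp: is_pspace_def topspace_pquot)

lemma quotient_map_pquot: "quotient_map (fst X) (fst (pquot X A)) (\<lambda>x. if x \<in> A then snd X else x)"
  by (simp add: pquot_def quotient_map_quotient_topology)

lemma pointed_map_pquot: "pointed_map X (pquot X A) (\<lambda>x. if x \<in> A then snd X else x)"
  by (simp add: pointed_map_def quotient_imp_continuous_map quotient_map_pquot)

lemma pquot_empty: "pquot X {} = X"
proof -
  have "quotient_topology (fst X) (\<lambda>x. x) = fst X"
  proof (rule topology_eq[THEN iffD2], intro allI)
    fix U
    have "{x \<in> topspace (fst X). x \<in> U} = U" if "U \<subseteq> topspace (fst X)"
      using that by blast
    then show "openin (quotient_topology (fst X) (\<lambda>x. x)) U = openin (fst X) U"
      using openin_subset[of "fst X" U] by (auto simp: openin_quotient_topology)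
  qed
  then show ?thesis by (simp add: pquot_def prod_eq_iff)
qed

text \<open>Points of \<open>pquot X A\<close> are represented by points of \<open>X\<close>, so that the same function serves as
  a map on \<open>X\<close> and as the induced map on the quotient.\<close>

lemma continuous_map_from_pquot:
  assumes "is_pspace X" "continuous_map (fst X) Z f" "\<And>x. x \<in> A \<Longrightarrow> x \<in> topspace (fst X) \<Longrightarrow> f x = f (snd X)"
  shows "continuous_map (fst (pquot X A)) Z f"
proof (rule continuous_compose_quotient_map[OF quotient_map_pquot[of X A]])
  show "continuous_map (fst X) Z (f \<circ> (\<lambda>x. if x \<in> A then snd X else x))"
    by (rule continuous_map_eq[OF assms(2)]) (use assms(3) in auto)
qed

lemma continuous_map_from_unit_pquot:
  assumes "is_pspace X" "continuous_map (prod_topology unit_top (fst X)) Z f"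
    and "\<And>t x. 0 \<le> t \<Longrightarrow> t \<le> 1 \<Longrightarrow> x \<in> A \<Longrightarrow> x \<in> topspace (fst X) \<Longrightarrow> f (t, x) = f (t, snd X)"
  shows "continuous_map (prod_topology unit_top (fst (pquot X A))) Z f"
proof (rule continuous_compose_quotient_map[OF quotient_map_unit_prod[OF quotient_map_pquot[of X A]]])
  show "continuous_map (prod_topology unit_top (fst X)) Z
     (f \<circ> (\<lambda>z. (fst z, if snd z \<in> A then snd X else snd z)))"
    by (rule continuous_map_eq[OF assms(2)]) (use assms(3) in auto)
qed

text \<open>A homotopy of pairs descends to the quotients. The second alternative for an end lets
  \<open>p\<close> or \<open>q\<close> be the base point where \<open>h\<close> merely lies in
  \<open>B\<close>, as at the end of a deformation of a space into the collapsed set.\<close>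

lemma pointed_homotopic_pquot:
  assumes X: "is_pspace X" "snd X \<in> A" and Y: "snd Y \<in> B"
    and h: "continuous_map (prod_topology unit_top (fst X)) (fst Y) h"
    and hA: "\<And>t x. 0 \<le> t \<Longrightarrow> t \<le> 1 \<Longrightarrow> x \<in> A \<Longrightarrow> x \<in> topspace (fst X) \<Longrightarrow> h (t, x) \<in> B"
    and p: "\<And>x. x \<in> topspace (fst X) \<Longrightarrow> h (0, x) = p x \<or> (h (0, x) \<in> B \<and> p x = snd Y)"
    and q: "\<And>x. x \<in> topspace (fst X) \<Longrightarrow> h (1, x) = q x \<or> (h (1, x) \<in> B \<and> q x = snd Y)"
  shows "pointed_homotopic (pquot X A) (pquot Y B)
    (\<lambda>x. if p x \<in> B then snd Y else p x) (\<lambda>x. if q x \<in> B then snd Y else q x)"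
  unfolding pointed_homotopic_iff[OF is_pspace_pquot[OF X(1)]]
proof (intro exI conjI ballI)
  let ?r = "\<lambda>x. if x \<in> B then snd Y else x"
  let ?H = "\<lambda>z. if h z \<in> B then snd Y else h z"
  have pX: "snd X \<in> topspace (fst X)" using X by (simp add: is_pspace_def)
  show "continuous_map (prod_topology unit_top (fst (pquot X A))) (fst (pquot Y B)) ?H"
  proof (rule continuous_map_from_unit_pquot[OF X(1)])
    show "continuous_map (prod_topology unit_top (fst X)) (fst (pquot Y B)) ?H"
      using continuous_map_comp[OF _ h, of "fst (pquot Y B)" ?r] pointed_map_pquot[of Y B]
      by (simp add: pointed_map_def)
  qed (use hA X pX in auto)
  show "?H (t, snd (pquot X A)) = snd (pquot Y B)" if "t \<in> {0..1}" for t
    using hA[of t "snd X"] X pX that by auto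
  fix x assume "x \<in> topspace (fst (pquot X A))"
  then have x: "x \<in> topspace (fst X)" using topspace_pquot_subset[OF X(1)] by auto
  show "?H (0, x) = ?r (p x)" using p[OF x] Y by auto
  show "?H (1, x) = ?r (q x)" using q[OF x] Y by auto
qed

lemma pointed_map_pquot_pquot:
  assumes X: "is_pspace X" "snd X \<in> A" and f: "continuous_map (fst X) (fst Y) f"
    and fA: "\<And>x. x \<in> A \<Longrightarrow> x \<in> topspace (fst X) \<Longrightarrow> f x \<in> B"
  shows "pointed_map (pquot X A) (pquot Y B) (\<lambda>x. if f x \<in> B then snd Y else f x)"
proof -
  let ?r = "\<lambda>x. if x \<in> B then snd Y else x"
  have pX: "snd X \<in> topspace (fst X)" using X by (simp add: is_pspace_def)
  have "continuous_map (fst (pquot X A)) (fst (pquot Y B)) (\<lambda>x. ?r (f x))"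
  proof (rule continuous_map_from_pquot[OF X(1)])
    show "continuous_map (fst X) (fst (pquot Y B)) (\<lambda>x. ?r (f x))"
      using continuous_map_comp[OF _ f, of "fst (pquot Y B)" ?r] pointed_map_pquot[of Y B]
      by (simp add: pointed_map_def)
  qed (use fA X pX in auto)
  then show ?thesis using fA X pX by (simp add: pointed_map_def)
qed

text \<open>The data are a homotopy equivalence of the pairs \<open>(X, A)\<close> and
  \<open>(Y, B)\<close>, and respecting the subsets is what makes everything pass to the quotients.
  Smash products and suspensions, being such quotients, inherit homotopy invariance from it.\<close>

lemma pquot_equiv:
  assumes X: "is_pspace X" "snd X \<in> A" and Y: "is_pspace Y" "snd Y \<in> B"
    and f: "continuous_map (fst X) (fst Y) f" "\<And>x. x \<in> A \<Longrightarrow> x \<in> topspace (fst X) \<Longrightarrow> f x \<in> B"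
    and g: "continuous_map (fst Y) (fst X) g" "\<And>x. x \<in> B \<Longrightarrow> x \<in> topspace (fst Y) \<Longrightarrow> g x \<in> A"
    and h: "continuous_map (prod_topology unit_top (fst X)) (fst X) h"
      "\<And>t x. 0 \<le> t \<Longrightarrow> t \<le> 1 \<Longrightarrow> x \<in> A \<Longrightarrow> x \<in> topspace (fst X) \<Longrightarrow> h (t, x) \<in> A"
      "\<And>x. x \<in> topspace (fst X) \<Longrightarrow> h (0, x) = g (f x)" "\<And>x. x \<in> topspace (fst X) \<Longrightarrow> h (1, x) = x"
    and k: "continuous_map (prod_topology unit_top (fst Y)) (fst Y) k"
      "\<And>t x. 0 \<le> t \<Longrightarrow> t \<le> 1 \<Longrightarrow> x \<in> B \<Longrightarrow> x \<in> topspace (fst Y) \<Longrightarrow> k (t, x) \<in> B"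
      "\<And>x. x \<in> topspace (fst Y) \<Longrightarrow> k (0, x) = f (g x)" "\<And>x. x \<in> topspace (fst Y) \<Longrightarrow> k (1, x) = x"
  shows "pquot X A \<simeq>\<^sub>* pquot Y B"
proof -
  \<comment> \<open>Quantified over fresh spaces of arbitrary types, so that it yields both
    composites, the second with the roles of the two pairs exchanged.\<close>
  have half: "pointed_homotopic (pquot X A) (pquot X A)
     ((\<lambda>x. if g x \<in> A then snd X else g x) \<circ> (\<lambda>x. if f x \<in> B then snd Y else f x)) id"
    if X: "is_pspace X" "snd X \<in> A" and Y: "is_pspace Y" "snd Y \<in> B"
    and f: "continuous_map (fst X) (fst Y) f" "\<And>x. x \<in> A \<Longrightarrow> x \<in> topspace (fst X) \<Longrightarrow> f x \<in> B"
    and g: "continuous_map (fst Y) (fst X) g" "\<And>x. x \<in> B \<Longrightarrow> x \<in> topspace (fst Y) \<Longrightarrow> g x \<in> A"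
    and h: "continuous_map (prod_topology unit_top (fst X)) (fst X) h"
      "\<And>t x. 0 \<le> t \<Longrightarrow> t \<le> 1 \<Longrightarrow> x \<in> A \<Longrightarrow> x \<in> topspace (fst X) \<Longrightarrow> h (t, x) \<in> A"
      "\<And>x. x \<in> topspace (fst X) \<Longrightarrow> h (0, x) = g (f x)" "\<And>x. x \<in> topspace (fst X) \<Longrightarrow> h (1, x) = x"
    for X :: "'c pspace" and Y :: "'d pspace" and A B f g h
  proof -
    let ?G = "\<lambda>x. if g x \<in> A then snd X else g x"
    let ?F = "\<lambda>x. if f x \<in> B then snd Y else f x"
    have gY: "g (snd Y) \<in> A" using g(2) Y by (auto simp: is_pspace_def)
    have 1: "pointed_homotopic (pquot X A) (pquot X A) (\<lambda>x. ?G (f x)) (\<lambda>x. if x \<in> A then snd X else x)"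
      by (rule pointed_homotopic_pquot[OF X X(2) h(1,2)]) (auto simp: h)
    have m: "pointed_map (pquot X A) (pquot X A) (?G \<circ> ?F)"
      by (intro pointed_map_compose[OF pointed_map_pquot_pquot pointed_map_pquot_pquot] X Y f g)
    \<comment> \<open>Collapsing in between makes no difference: a point sent into \<open>B\<close>
      by \<open>f\<close> is sent on into \<open>A\<close> by \<open>g\<close>, hence to the base
      point either way.\<close>
    have "pointed_homotopic (pquot X A) (pquot X A) (?G \<circ> ?F) (\<lambda>x. ?G (f x))"
    proof (rule pointed_homotopic_eq[OF is_pspace_pquot[OF X(1)] m])
      fix x assume "x \<in> topspace (fst (pquot X A))"
      then have "x \<in> topspace (fst X)" using topspace_pquot_subset[OF X(1)] by auto
      then have "f x \<in> topspace (fst Y)" using f(1) unfolding continuous_map_def by blast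
      then show "(?G \<circ> ?F) x = ?G (f x)" using gY g(2) by auto
    qed
    moreover have "pointed_homotopic (pquot X A) (pquot X A) (\<lambda>x. if x \<in> A then snd X else x) id"
    proof (rule pointed_homotopic_eq[OF is_pspace_pquot[OF X(1)]])
      show "pointed_map (pquot X A) (pquot X A) (\<lambda>x. if x \<in> A then snd X else x)"
        by (rule pointed_map_pquot_pquot[OF X, of X "\<lambda>x. x"]) auto
    qed (auto simp: topspace_pquot)
    ultimately show ?thesis using 1 pointed_homotopic_trans by blast
  qed
  show ?thesis
    unfolding pointed_equiv_def
    by (rule exI[where x = "\<lambda>x. if f x \<in> B then snd Y else f x"],
        rule exI[where x = "\<lambda>x. if g x \<in> A then snd X else g x"])
      (intro conjI pointed_map_pquot_pquot[OF X(1,2) f(1,2)] pointed_map_pquot_pquot[OF Y(1,2) g(1,2)]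
        half[OF X(1,2) Y(1,2) f(1,2) g(1,2) h(1,2,3,4)] half[OF Y(1,2) X(1,2) g(1,2) f(1,2) k(1,2,3,4)];
        assumption)
qed

lemma pquot_contractible:
  assumes X: "is_pspace X" "snd X \<in> A"
    and h: "continuous_map (prod_topology unit_top (fst X)) (fst X) h"
      "\<And>t x. 0 \<le> t \<Longrightarrow> t \<le> 1 \<Longrightarrow> x \<in> A \<Longrightarrow> x \<in> topspace (fst X) \<Longrightarrow> h (t, x) \<in> A"
      "\<And>x. x \<in> topspace (fst X) \<Longrightarrow> h (0, x) = x" "\<And>x. x \<in> topspace (fst X) \<Longrightarrow> h (1, x) \<in> A"
  shows "pointed_contractible (pquot X A)"
proof -
  have "pointed_homotopic (pquot X A) (pquot X A)
     (\<lambda>x. if x \<in> A then snd X else x) (\<lambda>x. if snd X \<in> A then snd X else snd X)"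
    by (rule pointed_homotopic_pquot[OF X X(2) h(1,2)]) (auto simp: h)
  moreover have "pointed_homotopic (pquot X A) (pquot X A) (\<lambda>x. if x \<in> A then snd X else x) id"
  proof (rule pointed_homotopic_eq[OF is_pspace_pquot[OF X(1)]])
    show "pointed_map (pquot X A) (pquot X A) (\<lambda>x. if x \<in> A then snd X else x)"
      by (rule pointed_map_pquot_pquot[OF X, of X "\<lambda>x. x"]) auto
  qed (auto simp: topspace_pquot)
  ultimately show ?thesis
    unfolding pointed_contractible_def using pointed_homotopic_trans[OF pointed_homotopic_sym] by simp
qed

lemma pointed_equivE:
  assumes "X \<simeq>\<^sub>* Y"
  obtains f g h k where "pointed_map X Y f" "pointed_map Y X g"
    "continuous_map (prod_topology unit_top (fst X)) (fst X) h"
    "\<And>x. h (0, x) = g (f x)" "\<And>x. h (1, x) = x" "\<And>t. 0 \<le> t \<Longrightarrow> t \<le> 1 \<Longrightarrow> h (t, snd X) = snd X"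
    "continuous_map (prod_topology unit_top (fst Y)) (fst Y) k"
    "\<And>y. k (0, y) = f (g y)" "\<And>y. k (1, y) = y" "\<And>t. 0 \<le> t \<Longrightarrow> t \<le> 1 \<Longrightarrow> k (t, snd Y) = snd Y"
proof -
  obtain f g where fg: "pointed_map X Y f" "pointed_map Y X g"
    "pointed_homotopic X X (g \<circ> f) id" "pointed_homotopic Y Y (f \<circ> g) id"
    using assms by (auto simp: pointed_equiv_def)
  obtain h where h: "continuous_map (prod_topology unit_top (fst X)) (fst X) h"
    "\<And>x. h (0, x) = g (f x)" "\<And>x. h (1, x) = x" "\<And>t. 0 \<le> t \<Longrightarrow> t \<le> 1 \<Longrightarrow> h (t, snd X) = snd X"
    using pointed_homotopicE[OF fg(3)] unfolding comp_apply id_apply by blast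
  obtain k where k: "continuous_map (prod_topology unit_top (fst Y)) (fst Y) k"
    "\<And>x. k (0, x) = f (g x)" "\<And>x. k (1, x) = x" "\<And>t. 0 \<le> t \<Longrightarrow> t \<le> 1 \<Longrightarrow> k (t, snd Y) = snd Y"
    using pointed_homotopicE[OF fg(4)] unfolding comp_apply id_apply by blast
  show thesis
    by (rule that[OF fg(1,2) h k])
qed

lemma continuous_map_fst_snd: "continuous_map (prod_topology T (prod_topology X Y)) X (\<lambda>z. fst (snd z))"
  by (rule continuous_map_fstI[OF continuous_map_snd])

lemma continuous_map_snd_snd: "continuous_map (prod_topology T (prod_topology X Y)) Y (\<lambda>z. snd (snd z))"
  by (rule continuous_map_sndI[OF continuous_map_snd])


lemma continuous_map_prod_homotopy:
  assumes "continuous_map (prod_topology unit_top X) X' h" "continuous_map (prod_topology unit_top Y) Y' k"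
  shows "continuous_map (prod_topology unit_top (prod_topology X Y)) (prod_topology X' Y')
     (\<lambda>z. (h (fst z, fst (snd z)), k (fst z, snd (snd z))))"
  by (intro continuous_map_pairedI continuous_map_comp[OF assms(1)] continuous_map_comp[OF assms(2)]
      continuous_map_fst continuous_map_fst_snd continuous_map_snd_snd)

lemma continuous_map_prod_map:
  assumes "continuous_map X X' f" "continuous_map Y Y' g"
  shows "continuous_map (prod_topology X Y) (prod_topology X' Y') (\<lambda>z. (f (fst z), g (snd z)))"
  by (intro continuous_map_pairedI continuous_map_comp[OF assms(1)] continuous_map_comp[OF assms(2)]
      continuous_map_fst continuous_map_snd)


subsection \<open>Wedges\<close>

lemma snd_pwedge [simp]: "snd (X \<or>\<^sub>* Y) = (snd X, snd Y)"
  by (simp add: pwedge_def)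

lemma topspace_pwedge: "is_pspace X \<Longrightarrow> is_pspace Y \<Longrightarrow> topspace (fst (X \<or>\<^sub>* Y)) = wedge_set X Y"
  by (auto simp: pwedge_def wedge_set_def is_pspace_def)

lemma is_pspace_pwedge: "is_pspace X \<Longrightarrow> is_pspace Y \<Longrightarrow> is_pspace (X \<or>\<^sub>* Y)"
  using topspace_pwedge[of X Y] unfolding is_pspace_def by (auto simp: wedge_set_def)

text \<open>The subspace topology on the wedge is the gluing topology, and this persists after taking
  products with any space.\<close>

lemma continuous_map_from_prod_pwedge:
  assumes X: "is_pspace X" and Y: "is_pspace Y"
    and f1: "continuous_map (prod_topology T (fst X)) Z (\<lambda>z. f (fst z, (snd z, snd Y)))"
    and f2: "continuous_map (prod_topology T (fst Y)) Z (\<lambda>z. f (fst z, (snd X, snd z)))"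
  shows "continuous_map (prod_topology T (fst (X \<or>\<^sub>* Y))) Z f"
  unfolding continuous_map_def
proof (intro conjI allI impI)
  let ?D = "topspace T \<times> wedge_set X Y"
  have D: "topspace (prod_topology T (fst (X \<or>\<^sub>* Y))) = ?D"
    using topspace_pwedge[OF X Y] by simp
  show "f \<in> topspace (prod_topology T (fst (X \<or>\<^sub>* Y))) \<rightarrow> topspace Z"
    using continuous_map_funspace[OF f1] continuous_map_funspace[OF f2]
    unfolding D wedge_set_def Pi_iff by fastforce
  fix U assume U: "openin Z U"
  define P1 where "P1 = {z \<in> topspace T \<times> topspace (fst X). f (fst z, (snd z, snd Y)) \<in> U}"
  define P2 where "P2 = {z \<in> topspace T \<times> topspace (fst Y). f (fst z, (snd X, snd z)) \<in> U}"
  have P1: "openin (prod_topology T (fst X)) P1" and P2: "openin (prod_topology T (fst Y)) P2"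
    using f1 f2 U unfolding continuous_map_def P1_def P2_def by auto
  have P1E: "\<exists>V A. openin T V \<and> openin (fst X) A \<and> \<tau> \<in> V \<and> x \<in> A \<and> V \<times> A \<subseteq> P1" if "(\<tau>, x) \<in> P1" for \<tau> x
    using P1 that unfolding openin_prod_topology_alt by blast
  have P2E: "\<exists>V B. openin T V \<and> openin (fst Y) B \<and> \<tau> \<in> V \<and> y \<in> B \<and> V \<times> B \<subseteq> P2" if "(\<tau>, y) \<in> P2" for \<tau> y
    using P2 that unfolding openin_prod_topology_alt by blast
  have pX: "snd X \<in> topspace (fst X)" and pY: "snd Y \<in> topspace (fst Y)"
    using X Y by (auto simp: is_pspace_def)
  let ?W = "{z \<in> ?D. f z \<in> U}"
  have key: "\<exists>V A B. openin T V \<and> openin (fst X) A \<and> openin (fst Y) B \<and> \<tau> \<in> V \<and> x \<in> A \<and> y \<in> B \<and>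
       V \<times> ((A \<times> B) \<inter> wedge_set X Y) \<subseteq> ?W" if W: "(\<tau>, (x, y)) \<in> ?W" for \<tau> x y
  proof -
    consider (base) "(\<tau>, snd X) \<in> P1" "(\<tau>, snd Y) \<in> P2" "x = snd X" "y = snd Y"
      | (left) "y = snd Y" "(\<tau>, x) \<in> P1" | (right) "x = snd X" "(\<tau>, y) \<in> P2"
      using W by (auto simp: wedge_set_def P1_def P2_def)
    then show ?thesis
    proof cases
      case left
      obtain V A where VA: "openin T V" "openin (fst X) A" "\<tau> \<in> V" "x \<in> A" "V \<times> A \<subseteq> P1"
        using P1E[OF left(2)] by blast
      show ?thesis
      proof (cases "snd X \<in> A")
        case True
        then have "(\<tau>, snd X) \<in> P1" using VA by auto
        then have "(\<tau>, snd Y) \<in> P2" using pY by (auto simp: P1_def P2_def)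
        then obtain V' B where VB: "openin T V'" "openin (fst Y) B" "\<tau> \<in> V'" "snd Y \<in> B" "V' \<times> B \<subseteq> P2"
          using P2E[of \<tau> "snd Y"] by blast
        show ?thesis
          by (rule exI[of _ "V \<inter> V'"], rule exI[of _ A], rule exI[of _ B])
            (use VA VB left in \<open>auto simp: wedge_set_def P1_def P2_def\<close>)
      next
        \<comment> \<open>\<open>A\<close> misses the base point, so \<open>A\<close> times the
          whole of \<open>Y\<close> meets the wedge only in \<open>A\<close> times the base
          point.\<close>
        case False
        show ?thesis
          by (rule exI[of _ V], rule exI[of _ A], rule exI[of _ "topspace (fst Y)"])
            (use VA left False pY in \<open>auto simp: wedge_set_def P1_def\<close>)
      qed
    next
      case right
      obtain V B where VB: "openin T V" "openin (fst Y) B" "\<tau> \<in> V" "y \<in> B" "V \<times> B \<subseteq> P2"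
        using P2E[OF right(2)] by blast
      show ?thesis
      proof (cases "snd Y \<in> B")
        case True
        then have "(\<tau>, snd Y) \<in> P2" using VB by auto
        then have "(\<tau>, snd X) \<in> P1" using pX by (auto simp: P1_def P2_def)
        then obtain V' A where VA: "openin T V'" "openin (fst X) A" "\<tau> \<in> V'" "snd X \<in> A" "V' \<times> A \<subseteq> P1"
          using P1E[of \<tau> "snd X"] by blast
        show ?thesis
          by (rule exI[of _ "V \<inter> V'"], rule exI[of _ A], rule exI[of _ B])
            (use VA VB right in \<open>auto simp: wedge_set_def P1_def P2_def\<close>)
      next
        case False
        show ?thesis
          by (rule exI[of _ V], rule exI[of _ "topspace (fst X)"], rule exI[of _ B])
            (use VB right False pX in \<open>auto simp: wedge_set_def P2_def\<close>)
      qed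
    next
      case base
      obtain V A where VA: "openin T V" "openin (fst X) A" "\<tau> \<in> V" "snd X \<in> A" "V \<times> A \<subseteq> P1"
        using P1E[OF base(1)] by blast
      obtain V' B where VB: "openin T V'" "openin (fst Y) B" "\<tau> \<in> V'" "snd Y \<in> B" "V' \<times> B \<subseteq> P2"
        using P2E[OF base(2)] by blast
      show ?thesis
        by (rule exI[of _ "V \<inter> V'"], rule exI[of _ A], rule exI[of _ B])
          (use VA VB base in \<open>auto simp: wedge_set_def P1_def P2_def\<close>)
    qed
  qed
  show "openin (prod_topology T (fst (X \<or>\<^sub>* Y))) {z \<in> topspace (prod_topology T (fst (X \<or>\<^sub>* Y))). f z \<in> U}"
    unfolding D openin_prod_topology_alt
  proof (intro allI impI)
    fix \<tau> w assume "(\<tau>, w) \<in> ?W"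
    moreover obtain x y where w: "w = (x, y)" by (cases w)
    ultimately have W: "(\<tau>, (x, y)) \<in> ?W" by simp
    obtain V A B where V: "openin T V" "openin (fst X) A" "openin (fst Y) B" "\<tau> \<in> V" "x \<in> A" "y \<in> B"
      "V \<times> ((A \<times> B) \<inter> wedge_set X Y) \<subseteq> ?W"
      using key[OF W] by blast
    have "openin (fst (X \<or>\<^sub>* Y)) ((A \<times> B) \<inter> wedge_set X Y)"
      using V unfolding pwedge_def openin_subtopology fst_conv
      by (intro exI[of _ "A \<times> B"]) (auto simp: openin_prod_Times_iff)
    moreover have "w \<in> (A \<times> B) \<inter> wedge_set X Y"
      using V W w by auto
    ultimately show "\<exists>U' V'. openin T U' \<and> openin (fst (X \<or>\<^sub>* Y)) V' \<and> \<tau> \<in> U' \<and> w \<in> V' \<and> U' \<times> V' \<subseteq> ?W"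
      using V by blast
  qed
qed

lemma continuous_map_inl: "is_pspace Y \<Longrightarrow> continuous_map (fst X) (fst (X \<or>\<^sub>* Y)) (\<lambda>x. (x, snd Y))"
  unfolding pwedge_def fst_conv
  by (rule continuous_map_into_subtopology, rule continuous_map_pairedI)
    (auto simp: wedge_set_def is_pspace_def)

lemma continuous_map_inr: "is_pspace X \<Longrightarrow> continuous_map (fst Y) (fst (X \<or>\<^sub>* Y)) (\<lambda>y. (snd X, y))"
  unfolding pwedge_def fst_conv
  by (rule continuous_map_into_subtopology, rule continuous_map_pairedI)
    (auto simp: wedge_set_def is_pspace_def)

lemma pwedge_equiv:
  assumes "X \<simeq>\<^sub>* X'" "Y \<simeq>\<^sub>* Y'" "is_pspace X" "is_pspace X'" "is_pspace Y" "is_pspace Y'"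
  shows "X \<or>\<^sub>* Y \<simeq>\<^sub>* X' \<or>\<^sub>* Y'"
proof -
  obtain f g h k where 1: "pointed_map X X' f" "pointed_map X' X g"
    "continuous_map (prod_topology unit_top (fst X)) (fst X) h"
    "\<And>x. h (0, x) = g (f x)" "\<And>x. h (1, x) = x" "\<And>t. 0 \<le> t \<Longrightarrow> t \<le> 1 \<Longrightarrow> h (t, snd X) = snd X"
    "continuous_map (prod_topology unit_top (fst X')) (fst X') k"
    "\<And>y. k (0, y) = f (g y)" "\<And>y. k (1, y) = y" "\<And>t. 0 \<le> t \<Longrightarrow> t \<le> 1 \<Longrightarrow> k (t, snd X') = snd X'"
    using pointed_equivE[OF assms(1)] by blast
  obtain f' g' h' k' where 2: "pointed_map Y Y' f'" "pointed_map Y' Y g'"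
    "continuous_map (prod_topology unit_top (fst Y)) (fst Y) h'"
    "\<And>x. h' (0, x) = g' (f' x)" "\<And>x. h' (1, x) = x" "\<And>t. 0 \<le> t \<Longrightarrow> t \<le> 1 \<Longrightarrow> h' (t, snd Y) = snd Y"
    "continuous_map (prod_topology unit_top (fst Y')) (fst Y') k'"
    "\<And>y. k' (0, y) = f' (g' y)" "\<And>y. k' (1, y) = y" "\<And>t. 0 \<le> t \<Longrightarrow> t \<le> 1 \<Longrightarrow> k' (t, snd Y') = snd Y'"
    using pointed_equivE[OF assms(2)] by blast
  have map: "pointed_map (A \<or>\<^sub>* B) (A' \<or>\<^sub>* B') (\<lambda>w. (p (fst w), q (snd w)))"
    if "pointed_map A A' p" "pointed_map B B' q"
    for A :: "'p pspace" and A' :: "'q pspace" and B :: "'r pspace" and B' :: "'s pspace" and p q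
    unfolding pointed_map_def pwedge_def fst_conv snd_conv
  proof (intro conjI continuous_map_into_subtopology continuous_map_from_subtopology)
    show "continuous_map (prod_topology (fst A) (fst B)) (prod_topology (fst A') (fst B')) (\<lambda>w. (p (fst w), q (snd w)))"
      using that by (intro continuous_map_prod_map) (auto simp: pointed_map_def)
    show "(\<lambda>w. (p (fst w), q (snd w))) \<in> topspace (subtopology (prod_topology (fst A) (fst B)) (wedge_set A B))
        \<rightarrow> wedge_set A' B'"
      using that pointed_map_topspace[OF that(1)] pointed_map_topspace[OF that(2)]
      by (auto simp: wedge_set_def pointed_map_def)
  qed (use that in \<open>simp add: pointed_map_def\<close>)
  have htp: "pointed_homotopic (A \<or>\<^sub>* B) (A \<or>\<^sub>* B)
     ((\<lambda>w. (p' (fst w), q' (snd w))) \<circ> (\<lambda>w. (p (fst w), q (snd w)))) id"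
    if A: "is_pspace A" "is_pspace B"
      and h: "continuous_map (prod_topology unit_top (fst A)) (fst A) h"
      "\<And>x. h (0, x) = p' (p x)" "\<And>x. h (1, x) = x" "\<And>t. 0 \<le> t \<Longrightarrow> t \<le> 1 \<Longrightarrow> h (t, snd A) = snd A"
      "continuous_map (prod_topology unit_top (fst B)) (fst B) h'"
      "\<And>x. h' (0, x) = q' (q x)" "\<And>x. h' (1, x) = x" "\<And>t. 0 \<le> t \<Longrightarrow> t \<le> 1 \<Longrightarrow> h' (t, snd B) = snd B"
    for A :: "'p pspace" and A' :: "'q pspace" and B :: "'r pspace" and B' :: "'s pspace"
      and p :: "'p \<Rightarrow> 'q" and p' and q :: "'r \<Rightarrow> 's" and q' h h'
    unfolding pointed_homotopic_iff[OF is_pspace_pwedge[OF A]]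
  proof (intro exI conjI ballI)
    let ?H = "\<lambda>z. (h (fst z, fst (snd z)), h' (fst z, snd (snd z)))"
    show "continuous_map (prod_topology unit_top (fst (A \<or>\<^sub>* B))) (fst (A \<or>\<^sub>* B)) ?H"
    proof (rule continuous_map_from_prod_pwedge[OF A])
      have "continuous_map (prod_topology unit_top (fst A)) (fst (A \<or>\<^sub>* B)) (\<lambda>z. (h z, snd B))"
        by (rule continuous_map_comp[OF continuous_map_inl[OF A(2)] h(1)])
      then show "continuous_map (prod_topology unit_top (fst A)) (fst (A \<or>\<^sub>* B)) (\<lambda>z. ?H (fst z, (snd z, snd B)))"
        by (rule continuous_map_eq) (auto simp: h)
      have "continuous_map (prod_topology unit_top (fst B)) (fst (A \<or>\<^sub>* B)) (\<lambda>z. (snd A, h' z))"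
        by (rule continuous_map_comp[OF continuous_map_inr[OF A(1)] h(5)])
      then show "continuous_map (prod_topology unit_top (fst B)) (fst (A \<or>\<^sub>* B)) (\<lambda>z. ?H (fst z, (snd A, snd z)))"
        by (rule continuous_map_eq) (auto simp: h)
    qed
  qed (auto simp: h)
  show ?thesis
    unfolding pointed_equiv_def
    by (rule exI, rule exI, intro conjI, rule map[OF 1(1) 2(1)], rule map[OF 1(2) 2(2)],
        (rule htp; fact), (rule htp; fact))
qed


subsection \<open>Smash products and suspensions\<close>

lemma snd_smash [simp]: "snd (X \<and>\<^sub>* Y) = (snd X, snd Y)"
  by (simp add: smash_def)

lemma is_pspace_prod: "is_pspace X \<Longrightarrow> is_pspace Y \<Longrightarrow> is_pspace (prod_topology (fst X) (fst Y), (snd X, snd Y))"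
  by (simp add: is_pspace_def)

lemma is_pspace_smash: "is_pspace X \<Longrightarrow> is_pspace Y \<Longrightarrow> is_pspace (X \<and>\<^sub>* Y)"
  unfolding smash_def by (intro is_pspace_pquot is_pspace_prod)

lemma smash_equiv:
  assumes "X \<simeq>\<^sub>* X'" "Y \<simeq>\<^sub>* Y'" "is_pspace X" "is_pspace X'" "is_pspace Y" "is_pspace Y'"
  shows "X \<and>\<^sub>* Y \<simeq>\<^sub>* X' \<and>\<^sub>* Y'"
proof -
  obtain f g h k where 1: "pointed_map X X' f" "pointed_map X' X g"
    "continuous_map (prod_topology unit_top (fst X)) (fst X) h"
    "\<And>x. h (0, x) = g (f x)" "\<And>x. h (1, x) = x" "\<And>t. 0 \<le> t \<Longrightarrow> t \<le> 1 \<Longrightarrow> h (t, snd X) = snd X"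
    "continuous_map (prod_topology unit_top (fst X')) (fst X') k"
    "\<And>y. k (0, y) = f (g y)" "\<And>y. k (1, y) = y" "\<And>t. 0 \<le> t \<Longrightarrow> t \<le> 1 \<Longrightarrow> k (t, snd X') = snd X'"
    using pointed_equivE[OF assms(1)] by blast
  obtain f' g' h' k' where 2: "pointed_map Y Y' f'" "pointed_map Y' Y g'"
    "continuous_map (prod_topology unit_top (fst Y)) (fst Y) h'"
    "\<And>x. h' (0, x) = g' (f' x)" "\<And>x. h' (1, x) = x" "\<And>t. 0 \<le> t \<Longrightarrow> t \<le> 1 \<Longrightarrow> h' (t, snd Y) = snd Y"
    "continuous_map (prod_topology unit_top (fst Y')) (fst Y') k'"
    "\<And>y. k' (0, y) = f' (g' y)" "\<And>y. k' (1, y) = y" "\<And>t. 0 \<le> t \<Longrightarrow> t \<le> 1 \<Longrightarrow> k' (t, snd Y') = snd Y'"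
    using pointed_equivE[OF assms(2)] by blast
  have m: "continuous_map (fst X) (fst X') f" "continuous_map (fst X') (fst X) g"
    "continuous_map (fst Y) (fst Y') f'" "continuous_map (fst Y') (fst Y) g'"
    "f (snd X) = snd X'" "g (snd X') = snd X" "f' (snd Y) = snd Y'" "g' (snd Y') = snd Y"
    using 1(1,2) 2(1,2) by (auto simp: pointed_map_def)
  have tops: "f x \<in> topspace (fst X')" if "x \<in> topspace (fst X)" for x
    using m(1) that unfolding continuous_map_def by blast
  have tops2: "g x \<in> topspace (fst X)" if "x \<in> topspace (fst X')" for x
    using m(2) that unfolding continuous_map_def by blast
  have tops3: "f' x \<in> topspace (fst Y')" if "x \<in> topspace (fst Y)" for x
    using m(3) that unfolding continuous_map_def by blast
  have tops4: "g' x \<in> topspace (fst Y)" if "x \<in> topspace (fst Y')" for x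
    using m(4) that unfolding continuous_map_def by blast
  have hX: "h (t, x) \<in> topspace (fst X)" if "0 \<le> t" "t \<le> 1" "x \<in> topspace (fst X)" for t x
    using 1(3) that unfolding continuous_map_def Pi_iff by simp
  have kX: "k (t, x) \<in> topspace (fst X')" if "0 \<le> t" "t \<le> 1" "x \<in> topspace (fst X')" for t x
    using 1(7) that unfolding continuous_map_def Pi_iff by simp
  have hY: "h' (t, x) \<in> topspace (fst Y)" if "0 \<le> t" "t \<le> 1" "x \<in> topspace (fst Y)" for t x
    using 2(3) that unfolding continuous_map_def Pi_iff by simp
  have kY: "k' (t, x) \<in> topspace (fst Y')" if "0 \<le> t" "t \<le> 1" "x \<in> topspace (fst Y')" for t x
    using 2(7) that unfolding continuous_map_def Pi_iff by simp
  note ps = assms(3-6)[unfolded is_pspace_def]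
  show ?thesis
    unfolding smash_def
    by (rule pquot_equiv[where f = "\<lambda>z. (f (fst z), f' (snd z))" and g = "\<lambda>z. (g (fst z), g' (snd z))"
          and h = "\<lambda>z. (h (fst z, fst (snd z)), h' (fst z, snd (snd z)))"
          and k = "\<lambda>z. (k (fst z, fst (snd z)), k' (fst z, snd (snd z)))"])
      (use ps in \<open>auto simp: is_pspace_def wedge_set_def 1 2 m tops tops2 tops3 tops4 hX hY kX kY
        intro!: continuous_map_prod_map[OF m(1,3), simplified] continuous_map_prod_map[OF m(2,4)]
          continuous_map_prod_homotopy[OF 1(3) 2(3)] continuous_map_prod_homotopy[OF 1(7) 2(7)]\<close>)
qed

text \<open>Contracting the first coordinate keeps the wedge inside itself and moves everything into
  it.\<close>

lemma smash_contractible: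
  assumes "pointed_contractible X" "is_pspace X" "is_pspace Y"
  shows "pointed_contractible (X \<and>\<^sub>* Y)"
proof -
  obtain h where h: "continuous_map (prod_topology unit_top (fst X)) (fst X) h"
    "\<And>x. h (0, x) = id x" "\<And>x. h (1, x) = snd X" "\<And>t. 0 \<le> t \<Longrightarrow> t \<le> 1 \<Longrightarrow> h (t, snd X) = snd X"
    using pointed_homotopicE[OF assms(1)[unfolded pointed_contractible_def]] by blast
  have hX: "h (t, x) \<in> topspace (fst X)" if "0 \<le> t" "t \<le> 1" "x \<in> topspace (fst X)" for t x
    using h(1) that unfolding continuous_map_def Pi_iff by simp
  show ?thesis
    unfolding smash_def
    by (rule pquot_contractible[where h = "\<lambda>z. (h (fst z, fst (snd z)), snd (snd z))"])
      (use assms(2,3) in \<open>auto simp: is_pspace_def wedge_set_def h hX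
        intro!: continuous_map_prod_homotopy[OF h(1) continuous_map_snd, simplified]\<close>)
qed

lemma continuous_map_swap: "continuous_map (prod_topology X Y) (prod_topology Y X) prod.swap"
  by (rule continuous_map_eq[OF continuous_map_pairedI[OF continuous_map_snd continuous_map_fst]]) auto

lemma smash_commute:
  assumes "is_pspace X" "is_pspace Y"
  shows "X \<and>\<^sub>* Y \<simeq>\<^sub>* Y \<and>\<^sub>* X"
  unfolding smash_def
  by (rule pquot_equiv[where f = prod.swap and g = prod.swap and h = snd and k = snd])
    (use assms in \<open>auto simp: is_pspace_def wedge_set_def intro: continuous_map_snd continuous_map_swap\<close>)

lemma smash_contractible_right:
  assumes "pointed_contractible Y" "is_pspace X" "is_pspace Y"
  shows "pointed_contractible (X \<and>\<^sub>* Y)"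
  using pointed_contractible_equiv[OF smash_commute smash_contractible] assms by blast

lemma snd_psusp [simp]: "snd (psusp X) = (snd X, 0)"
  by (simp add: psusp_def)

lemma is_pspace_cylinder: "is_pspace X \<Longrightarrow> is_pspace (prod_topology (fst X) unit_top, (snd X, 0))"
  by (simp add: is_pspace_def)

lemma is_pspace_psusp: "is_pspace X \<Longrightarrow> is_pspace (psusp X)"
  unfolding psusp_def by (intro is_pspace_pquot is_pspace_cylinder)

lemma psusp_equiv:
  assumes "X \<simeq>\<^sub>* X'" "is_pspace X" "is_pspace X'"
  shows "psusp X \<simeq>\<^sub>* psusp X'"
proof -
  obtain f g h k where 1: "pointed_map X X' f" "pointed_map X' X g"
    "continuous_map (prod_topology unit_top (fst X)) (fst X) h"
    "\<And>x. h (0, x) = g (f x)" "\<And>x. h (1, x) = x" "\<And>t. 0 \<le> t \<Longrightarrow> t \<le> 1 \<Longrightarrow> h (t, snd X) = snd X"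
    "continuous_map (prod_topology unit_top (fst X')) (fst X') k"
    "\<And>y. k (0, y) = f (g y)" "\<And>y. k (1, y) = y" "\<And>t. 0 \<le> t \<Longrightarrow> t \<le> 1 \<Longrightarrow> k (t, snd X') = snd X'"
    using pointed_equivE[OF assms(1)] by blast
  have m: "continuous_map (fst X) (fst X') f" "continuous_map (fst X') (fst X) g"
    "f (snd X) = snd X'" "g (snd X') = snd X"
    using 1(1,2) by (auto simp: pointed_map_def)
  have tops: "f x \<in> topspace (fst X')" if "x \<in> topspace (fst X)" for x
    using m(1) that unfolding continuous_map_def by blast
  have tops2: "g x \<in> topspace (fst X)" if "x \<in> topspace (fst X')" for x
    using m(2) that unfolding continuous_map_def by blast
  have hX: "h (t, x) \<in> topspace (fst X)" if "0 \<le> t" "t \<le> 1" "x \<in> topspace (fst X)" for t x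
    using 1(3) that unfolding continuous_map_def Pi_iff by simp
  have kX: "k (t, x) \<in> topspace (fst X')" if "0 \<le> t" "t \<le> 1" "x \<in> topspace (fst X')" for t x
    using 1(7) that unfolding continuous_map_def Pi_iff by simp
  have h: "continuous_map (prod_topology unit_top (prod_topology (fst X) unit_top)) (prod_topology (fst X) unit_top)
      (\<lambda>z. (h (fst z, fst (snd z)), snd (snd z)))"
    using continuous_map_prod_homotopy[OF 1(3) continuous_map_snd] by simp
  have k: "continuous_map (prod_topology unit_top (prod_topology (fst X') unit_top)) (prod_topology (fst X') unit_top)
      (\<lambda>z. (k (fst z, fst (snd z)), snd (snd z)))"
    using continuous_map_prod_homotopy[OF 1(7) continuous_map_snd] by simp
  show ?thesis
    unfolding psusp_def
    apply (rule pquot_equiv[where f = "\<lambda>z. (f (fst z), snd z)" and g = "\<lambda>z. (g (fst z), snd z)"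
          and h = "\<lambda>z. (h (fst z, fst (snd z)), snd (snd z))"
          and k = "\<lambda>z. (k (fst z, fst (snd z)), snd (snd z))"]; (unfold fst_conv snd_conv)?)
    apply (rule is_pspace_cylinder[OF assms(2)])
    subgoal using assms by (simp add: is_pspace_def)
    apply (rule is_pspace_cylinder[OF assms(3)])
    subgoal using assms by (simp add: is_pspace_def)
    apply (rule continuous_map_prod_map[OF m(1) continuous_map_idI])
    subgoal by (auto simp: tops m(3))
    apply (rule continuous_map_prod_map[OF m(2) continuous_map_idI])
    subgoal by (auto simp: tops2 m(4))
    apply (rule h)
    subgoal by (auto simp: hX 1(6))
    subgoal by (simp add: 1(4))
    subgoal by (simp add: 1(5))
    apply (rule k)
    subgoal by (auto simp: kX 1(10))
    subgoal by (simp add: 1(8))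
    subgoal by (simp add: 1(9))
    done
qed

subsection \<open>Cofibrations\<close>

lemma pointed_HEP_E:
  fixes A X :: "'a pspace" and Y :: "('a \<times> real) pspace"
  assumes "pointed_HEP A X i" "is_pspace Y" "pointed_map X Y f"
    and "continuous_map (prod_topology unit_top (fst A)) (fst Y) h"
    and "\<And>a. a \<in> topspace (fst A) \<Longrightarrow> h (0, a) = f (i a)" "\<And>t. 0 \<le> t \<Longrightarrow> t \<le> 1 \<Longrightarrow> h (t, snd A) = snd Y"
  obtains H where "continuous_map (prod_topology unit_top (fst X)) (fst Y) H"
    "\<And>x. x \<in> topspace (fst X) \<Longrightarrow> H (0, x) = f x"
    "\<And>t a. 0 \<le> t \<Longrightarrow> t \<le> 1 \<Longrightarrow> a \<in> topspace (fst A) \<Longrightarrow> H (t, i a) = h (t, a)"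
  using assms(1)[unfolded pointed_HEP_def, rule_format, of Y f h] assms(2-) by auto

text \<open>The extension property extends a contraction of \<open>A\<close> to a homotopy of
  \<open>X\<close> that starts at the identity and moves the image of \<open>A\<close> within
  itself. Its end map kills that image and so factors through the quotient; the factor is the
  homotopy inverse of the projection.\<close>

lemma collapse_contractible:
  fixes A X :: "'a pspace"
  assumes A: "is_pspace A" and X: "is_pspace X" and i: "inclusion_map A X i" and c: "pointed_contractible A"
  shows "X \<simeq>\<^sub>* pquot X (i ` topspace (fst A))"
proof -
  let ?B = "i ` topspace (fst A)"
  let ?r = "\<lambda>x. if x \<in> ?B then snd X else x"
  have pA: "snd A \<in> topspace (fst A)" using A by (simp add: is_pspace_def)
  have im: "pointed_map A X i" and HEP: "pointed_HEP A X i"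
    using i by (auto simp: inclusion_map_def)
  have ic: "continuous_map (fst A) (fst X) i" and ib: "i (snd A) = snd X"
    using im by (auto simp: pointed_map_def)
  obtain h where h: "continuous_map (prod_topology unit_top (fst A)) (fst A) h"
    "\<And>x. h (0, x) = id x" "\<And>x. h (1, x) = snd A" "\<And>t. 0 \<le> t \<Longrightarrow> t \<le> 1 \<Longrightarrow> h (t, snd A) = snd A"
    using pointed_homotopicE[OF c[unfolded pointed_contractible_def]] by blast
  \<comment> \<open>A cylinder on \<open>X\<close>, entered at height 0, because
    \<open>pointed_HEP\<close> is tested on targets of this type; \<open>fst\<close> brings the
    extension back to \<open>X\<close>.\<close>
  define Y :: "('a \<times> real) pspace" where "Y = (prod_topology (fst X) unit_top, (snd X, 0))"
  have Y: "is_pspace Y" unfolding Y_def by (rule is_pspace_cylinder[OF X])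
  have into: "continuous_map Z (fst Y) (\<lambda>z. (g z, 0))" if "continuous_map Z (fst X) g" for Z :: "'z topology" and g
    unfolding Y_def fst_conv by (rule continuous_map_pairedI[OF that]) auto
  have outof: "continuous_map (fst Y) (fst X) fst"
    unfolding Y_def fst_conv by (rule continuous_map_fst)
  have "pointed_map X Y (\<lambda>x. (x, 0))"
    using into[of "fst X" "\<lambda>x. x"] by (simp add: pointed_map_def Y_def)
  then obtain H where H: "continuous_map (prod_topology unit_top (fst X)) (fst Y) H"
    "\<And>x. x \<in> topspace (fst X) \<Longrightarrow> H (0, x) = (x, 0)"
    "\<And>t a. 0 \<le> t \<Longrightarrow> t \<le> 1 \<Longrightarrow> a \<in> topspace (fst A) \<Longrightarrow> H (t, i a) = (i (h (t, a)), 0)"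
    by (rule pointed_HEP_E[OF HEP Y, of _ "\<lambda>z. (i (h z), 0)"])
      (auto simp: h ib Y_def intro: into[unfolded Y_def fst_conv] continuous_map_comp[OF ic h(1)])
  define K where "K z = fst (H z)" for z
  have K: "continuous_map (prod_topology unit_top (fst X)) (fst X) K"
    "\<And>x. x \<in> topspace (fst X) \<Longrightarrow> K (0, x) = x"
    "\<And>t a. 0 \<le> t \<Longrightarrow> t \<le> 1 \<Longrightarrow> a \<in> topspace (fst A) \<Longrightarrow> K (t, i a) = i (h (t, a))"
    unfolding K_def using continuous_map_comp[OF outof H(1)] H(2,3) by auto
  have Kb: "K (t, snd X) = snd X" if "0 \<le> t" "t \<le> 1" for t
    using K(3)[OF that pA] h(4)[OF that] ib by simp
  have hA: "h (t, a) \<in> topspace (fst A)" if "0 \<le> t" "t \<le> 1" "a \<in> topspace (fst A)" for t a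
    using h(1) that unfolding continuous_map_def Pi_iff by simp
  have K1c: "continuous_map (fst X) (fst X) (\<lambda>x. K (1, x))"
    by (rule continuous_map_comp[OF K(1)], rule continuous_map_pairedI) auto
  have r: "pointed_map X (pquot X ?B) ?r" by (rule pointed_map_pquot)
  have g: "pointed_map (pquot X ?B) X (\<lambda>x. K (1, x))"
    unfolding pointed_map_def
    by (intro conjI continuous_map_from_pquot[OF X K1c]) (auto simp: K(3) h(3) ib Kb)
  have bB: "snd X \<in> ?B" using pA ib by force
  have 1: "pointed_homotopic X X ((\<lambda>x. K (1, x)) \<circ> ?r) id"
  proof (rule pointed_homotopic_sym, unfold pointed_homotopic_iff[OF X], intro exI[of _ K] conjI ballI)
    fix x assume x: "x \<in> topspace (fst X)"
    show "K (1, x) = ((\<lambda>x. K (1, x)) \<circ> ?r) x"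
      using Kb[of 1] by (auto simp: K(3) h(3) ib)
  qed (auto simp: K(1,2) Kb)
  have 2: "pointed_homotopic (pquot X ?B) (pquot X ?B) (\<lambda>x. if x \<in> ?B then snd X else x)
     (\<lambda>x. if K (1, x) \<in> ?B then snd X else K (1, x))"
    by (rule pointed_homotopic_pquot[OF X bB bB K(1)]) (auto simp: K(2,3) hA)
  have 3: "pointed_homotopic (pquot X ?B) (pquot X ?B) ?r id"
  proof (rule pointed_homotopic_eq[OF is_pspace_pquot[OF X]])
    show "pointed_map (pquot X ?B) (pquot X ?B) ?r"
      by (rule pointed_map_pquot_pquot[OF X bB, of X "\<lambda>x. x"]) auto
  qed (auto simp: topspace_pquot)
  have 4: "?r \<circ> (\<lambda>x. K (1, x)) = (\<lambda>x. if K (1, x) \<in> ?B then snd X else K (1, x))"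
    by auto
  have "pointed_homotopic (pquot X ?B) (pquot X ?B) (?r \<circ> (\<lambda>x. K (1, x))) id"
    unfolding 4 by (rule pointed_homotopic_trans[OF pointed_homotopic_sym[OF 2] 3])
  then show ?thesis
    using r g 1 unfolding pointed_equiv_def by blast
qed

text \<open>A presentation of \<open>C\<close> as the reduced mapping cone of \<open>b :: A \<rightarrow> X\<close>: \<open>j\<close> is the inclusion of
  \<open>X\<close>, \<open>k\<close> is the map from the cylinder of \<open>A\<close>, whose end \<open>0\<close> is glued to \<open>X\<close> along \<open>b\<close>.\<close>

definition cone_maps ::
  "'a pspace \<Rightarrow> 'b pspace \<Rightarrow> ('a \<Rightarrow> 'b) \<Rightarrow> 'c pspace \<Rightarrow> ('b \<Rightarrow> 'c) \<Rightarrow> ('a \<times> real \<Rightarrow> 'c) \<Rightarrow> bool" where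
  "cone_maps A X b C j k \<longleftrightarrow> is_pspace C \<and> pointed_map X C j \<and>
     continuous_map (prod_topology (fst A) unit_top) (fst C) k \<and>
     (\<forall>a\<in>topspace (fst A). k (a, 0) = j (b a) \<and> k (a, 1) = snd C) \<and> (\<forall>t\<in>{0..1}. k (snd A, t) = snd C) \<and>
     topspace (fst C) \<subseteq> j ` topspace (fst X) \<union> k ` (topspace (fst A) \<times> {0..1})"

text \<open>The universal property of the mapping cone, multiplied by the interval so that it
  produces homotopies as well as maps. The target \<open>Z\<close> is a parameter because targets of
  two different types occur.\<close>

definition cone_rec ::
  "'a pspace \<Rightarrow> 'b pspace \<Rightarrow> ('a \<Rightarrow> 'b) \<Rightarrow> 'c pspace \<Rightarrow> ('b \<Rightarrow> 'c) \<Rightarrow> ('a \<times> real \<Rightarrow> 'c) \<Rightarrow> 'z topology \<Rightarrow> bool" where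
  "cone_rec A X b C j k Z \<longleftrightarrow> (\<forall>f \<phi>.
     continuous_map (prod_topology unit_top (fst X)) Z f \<and>
     continuous_map (prod_topology unit_top (prod_topology (fst A) unit_top)) Z \<phi> \<and>
     (\<forall>\<tau>\<in>{0..1}. (\<forall>a\<in>topspace (fst A). \<phi> (\<tau>, (a, 0)) = f (\<tau>, b a) \<and> \<phi> (\<tau>, (a, 1)) = f (\<tau>, snd X)) \<and>
        (\<forall>t\<in>{0..1}. \<phi> (\<tau>, (snd A, t)) = f (\<tau>, snd X))) \<longrightarrow>
     (\<exists>F. continuous_map (prod_topology unit_top (fst C)) Z F \<and>
       (\<forall>\<tau>\<in>{0..1}. (\<forall>x\<in>topspace (fst X). F (\<tau>, j x) = f (\<tau>, x)) \<and>
          (\<forall>a\<in>topspace (fst A). \<forall>t\<in>{0..1}. F (\<tau>, k (a, t)) = \<phi> (\<tau>, (a, t))))))"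

lemma cone_recE:
  assumes "cone_rec A X b C j k Z"
    and "continuous_map (prod_topology unit_top (fst X)) Z f"
    and "continuous_map (prod_topology unit_top (prod_topology (fst A) unit_top)) Z \<phi>"
    and "\<And>\<tau> a. 0 \<le> \<tau> \<Longrightarrow> \<tau> \<le> 1 \<Longrightarrow> a \<in> topspace (fst A) \<Longrightarrow> \<phi> (\<tau>, (a, 0)) = f (\<tau>, b a)"
    and "\<And>\<tau> a. 0 \<le> \<tau> \<Longrightarrow> \<tau> \<le> 1 \<Longrightarrow> a \<in> topspace (fst A) \<Longrightarrow> \<phi> (\<tau>, (a, 1)) = f (\<tau>, snd X)"
    and "\<And>\<tau> t. 0 \<le> \<tau> \<Longrightarrow> \<tau> \<le> 1 \<Longrightarrow> 0 \<le> t \<Longrightarrow> t \<le> 1 \<Longrightarrow> \<phi> (\<tau>, (snd A, t)) = f (\<tau>, snd X)"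
  obtains F where "continuous_map (prod_topology unit_top (fst C)) Z F"
    "\<And>\<tau> x. 0 \<le> \<tau> \<Longrightarrow> \<tau> \<le> 1 \<Longrightarrow> x \<in> topspace (fst X) \<Longrightarrow> F (\<tau>, j x) = f (\<tau>, x)"
    "\<And>\<tau> a t. 0 \<le> \<tau> \<Longrightarrow> \<tau> \<le> 1 \<Longrightarrow> a \<in> topspace (fst A) \<Longrightarrow> 0 \<le> t \<Longrightarrow> t \<le> 1 \<Longrightarrow> F (\<tau>, k (a, t)) = \<phi> (\<tau>, (a, t))"
  using assms(1)[unfolded cone_rec_def, rule_format, of f \<phi>] assms(2-) by auto

lemma cone_recE1:
  assumes "cone_rec A X b C j k Z"
    and f: "continuous_map (fst X) Z f"
    and \<phi>: "continuous_map (prod_topology (fst A) unit_top) Z \<phi>"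
    and "\<And>a. a \<in> topspace (fst A) \<Longrightarrow> \<phi> (a, 0) = f (b a)"
    and "\<And>a. a \<in> topspace (fst A) \<Longrightarrow> \<phi> (a, 1) = f (snd X)"
    and "\<And>t. 0 \<le> t \<Longrightarrow> t \<le> 1 \<Longrightarrow> \<phi> (snd A, t) = f (snd X)"
  obtains F where "continuous_map (fst C) Z F"
    "\<And>x. x \<in> topspace (fst X) \<Longrightarrow> F (j x) = f x"
    "\<And>a t. a \<in> topspace (fst A) \<Longrightarrow> 0 \<le> t \<Longrightarrow> t \<le> 1 \<Longrightarrow> F (k (a, t)) = \<phi> (a, t)"
proof -
  have f': "continuous_map (prod_topology unit_top (fst X)) Z (\<lambda>z. f (snd z))"
    by (rule continuous_map_comp[OF f continuous_map_snd])
  have \<phi>': "continuous_map (prod_topology unit_top (prod_topology (fst A) unit_top)) Z (\<lambda>z. \<phi> (snd z))"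
    by (rule continuous_map_comp[OF \<phi> continuous_map_snd])
  obtain F where F: "continuous_map (prod_topology unit_top (fst C)) Z F"
    "\<And>\<tau> x. 0 \<le> \<tau> \<Longrightarrow> \<tau> \<le> 1 \<Longrightarrow> x \<in> topspace (fst X) \<Longrightarrow> F (\<tau>, j x) = f x"
    "\<And>\<tau> a t. 0 \<le> \<tau> \<Longrightarrow> \<tau> \<le> 1 \<Longrightarrow> a \<in> topspace (fst A) \<Longrightarrow> 0 \<le> t \<Longrightarrow> t \<le> 1 \<Longrightarrow> F (\<tau>, k (a, t)) = \<phi> (a, t)"
    by (rule cone_recE[OF assms(1) f' \<phi>']) (use assms(4-) in auto)
  have "continuous_map (fst C) Z (\<lambda>c. F (0, c))"
    by (rule continuous_map_comp[OF F(1)], rule continuous_map_pairedI) auto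
  then show thesis
    by (rule that) (auto simp: F)
qed

text \<open>The parameter runs over \<open>-1..1\<close>. The negative half follows the homotopy
  inside \<open>X\<close>, timed to end where the cone line starts; the positive half is that cone
  line.\<close>

definition cone_path :: "('b \<Rightarrow> 'c) \<Rightarrow> ('a \<times> real \<Rightarrow> 'c) \<Rightarrow> (real \<times> 'a \<Rightarrow> 'b) \<Rightarrow> 'a \<Rightarrow> real \<Rightarrow> 'c" where
  "cone_path j k h a \<sigma> = (if \<sigma> \<le> 0 then j (h (1 + \<sigma>, a)) else k (a, \<sigma>))"

lemma continuous_map_cone_path:
  assumes C: "cone_maps A X b C j k"
    and h: "continuous_map (prod_topology unit_top (fst A)) (fst X) h"
    and h1: "\<And>a. a \<in> topspace (fst A) \<Longrightarrow> h (1, a) = b a"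
    and p: "continuous_map Z (fst A) p" and q: "continuous_map Z euclideanreal q"
    and q1: "\<And>z. z \<in> topspace Z \<Longrightarrow> -1 \<le> q z \<and> q z \<le> 1"
  shows "continuous_map Z (fst C) (\<lambda>z. cone_path j k h (p z) (q z))"
proof -
  have j: "continuous_map (fst X) (fst C) j" and k: "continuous_map (prod_topology (fst A) unit_top) (fst C) k"
    and k0: "\<And>a. a \<in> topspace (fst A) \<Longrightarrow> k (a, 0) = j (b a)"
    using C by (auto simp: cone_maps_def pointed_map_def)
  have pA: "p z \<in> topspace (fst A)" if "z \<in> topspace Z" for z
    using p that unfolding continuous_map_def by blast
  show ?thesis
    unfolding cone_path_def
  proof (rule continuous_map_cases_le[OF q])
    show "continuous_map Z euclideanreal (\<lambda>z. 0)" by simp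
    let ?Z1 = "subtopology Z {z \<in> topspace Z. q z \<le> 0}"
    have "continuous_map ?Z1 unit_top (\<lambda>z. 1 + q z)"
      by (rule continuous_map_into_subtopology)
        (use q1 in \<open>force intro!: continuous_intros continuous_map_from_subtopology q\<close>)+
    then show "continuous_map ?Z1 (fst C) (\<lambda>z. j (h (1 + q z, p z)))"
      by (intro continuous_map_comp[OF j] continuous_map_comp[OF h] continuous_map_pairedI
          continuous_map_from_subtopology[OF p])
    let ?Z2 = "subtopology Z {z \<in> topspace Z. 0 \<le> q z}"
    have "continuous_map ?Z2 unit_top q"
      by (rule continuous_map_into_subtopology)
        (use q1 in \<open>force intro!: continuous_map_from_subtopology q\<close>)+
    then show "continuous_map ?Z2 (fst C) (\<lambda>z. k (p z, q z))"
      by (intro continuous_map_comp[OF k] continuous_map_pairedI continuous_map_from_subtopology[OF p])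
    show "j (h (1 + q z, p z)) = k (p z, q z)" if "z \<in> topspace Z" "q z = 0" for z
      using that pA[OF that(1)] h1 k0 by simp
  qed
qed

text \<open>A homotopy between the attaching maps induces a map of the cones: the first half of each
  cone line is spent on the track of the homotopy, the second half on the cone line of
  \<open>D\<close>. This is the reparametrization \<open>2 * t - 1\<close>.\<close>

lemma cone_transfer:
  assumes A: "is_pspace A" and C: "cone_maps A X b C j k" and D: "cone_maps A X b' D j' k'"
    and h: "continuous_map (prod_topology unit_top (fst A)) (fst X) h"
      "\<And>a. a \<in> topspace (fst A) \<Longrightarrow> h (0, a) = b a" "\<And>a. a \<in> topspace (fst A) \<Longrightarrow> h (1, a) = b' a"
      "\<And>t. 0 \<le> t \<Longrightarrow> t \<le> 1 \<Longrightarrow> h (t, snd A) = snd X"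
    and rec: "cone_rec A X b C j k (fst D)"
  obtains F where "pointed_map C D F"
    "\<And>x. x \<in> topspace (fst X) \<Longrightarrow> F (j x) = j' x"
    "\<And>a t. a \<in> topspace (fst A) \<Longrightarrow> 0 \<le> t \<Longrightarrow> t \<le> 1 \<Longrightarrow> F (k (a, t)) = cone_path j' k' h a (2 * t - 1)"
proof -
  have D': "is_pspace D" "pointed_map X D j'" "\<And>a. a \<in> topspace (fst A) \<Longrightarrow> k' (a, 1) = snd D"
    "\<And>t. 0 \<le> t \<Longrightarrow> t \<le> 1 \<Longrightarrow> k' (snd A, t) = snd D"
    using D by (auto simp: cone_maps_def)
  have j': "continuous_map (fst X) (fst D) j'" "j' (snd X) = snd D"
    using D' by (auto simp: pointed_map_def)
  have \<phi>: "continuous_map (prod_topology (fst A) unit_top) (fst D) (\<lambda>z. cone_path j' k' h (fst z) (2 * snd z - 1))"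
  proof (rule continuous_map_cone_path[OF D h(1,3) continuous_map_fst])
    show "continuous_map (prod_topology (fst A) unit_top) euclideanreal (\<lambda>z. 2 * snd z - 1)"
      by (intro continuous_intros continuous_map_into_fulltopology[OF continuous_map_snd])
  qed auto
  obtain F where F: "continuous_map (fst C) (fst D) F"
    "\<And>x. x \<in> topspace (fst X) \<Longrightarrow> F (j x) = j' x"
    "\<And>a t. a \<in> topspace (fst A) \<Longrightarrow> 0 \<le> t \<Longrightarrow> t \<le> 1 \<Longrightarrow> F (k (a, t)) = cone_path j' k' h (fst (a, t)) (2 * snd (a, t) - 1)"
    by (rule cone_recE1[OF rec j'(1) \<phi>]) (auto simp: cone_path_def h D' j')
  have "F (snd C) = snd D"
  proof -
    have "snd A \<in> topspace (fst A)" using A by (simp add: is_pspace_def)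
    then have "F (k (snd A, 1)) = k' (snd A, 1)" by (simp add: F(3) cone_path_def)
    then show ?thesis using C D'(4) by (simp add: cone_maps_def)
  qed
  then show thesis using that[of F] F by (simp add: pointed_map_def)
qed

text \<open>On a cone line the composite runs along \<open>h\<close>, back along \<open>h\<close>, and then down the cone; this
  is the path with parameter \<open>max (-2t) (4t - 3)\<close> on the concatenation of \<open>h\<close> and the cone line, and
  it is contracted linearly.\<close>

lemma cone_transfer_half:
  assumes A: "is_pspace A" and C: "cone_maps A X b C j k"
    and h: "continuous_map (prod_topology unit_top (fst A)) (fst X) h"
      "\<And>a. a \<in> topspace (fst A) \<Longrightarrow> h (0, a) = b a"
      "\<And>t. 0 \<le> t \<Longrightarrow> t \<le> 1 \<Longrightarrow> h (t, snd A) = snd X"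
    and rec: "cone_rec A X b C j k (fst C)"
    and F: "\<And>x. x \<in> topspace (fst X) \<Longrightarrow> F (j x) = j' x"
      "\<And>a t. a \<in> topspace (fst A) \<Longrightarrow> 0 \<le> t \<Longrightarrow> t \<le> 1 \<Longrightarrow> F (k (a, t)) = cone_path j' k' h a (2 * t - 1)"
    and G: "\<And>x. x \<in> topspace (fst X) \<Longrightarrow> G (j' x) = j x"
      "\<And>a t. a \<in> topspace (fst A) \<Longrightarrow> 0 \<le> t \<Longrightarrow> t \<le> 1 \<Longrightarrow>
         G (k' (a, t)) = cone_path j k (\<lambda>z. h (1 - fst z, snd z)) a (2 * t - 1)"
  shows "pointed_homotopic C C (G \<circ> F) id"
proof -
  let ?h = "\<lambda>z. h (1 - fst z, snd z)"
  have C': "is_pspace C" "pointed_map X C j" "\<And>a. a \<in> topspace (fst A) \<Longrightarrow> k (a, 1) = snd C"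
    "\<And>a. a \<in> topspace (fst A) \<Longrightarrow> k (a, 0) = j (b a)"
    "\<And>t. 0 \<le> t \<Longrightarrow> t \<le> 1 \<Longrightarrow> k (snd A, t) = snd C"
    using C by (auto simp: cone_maps_def)
  have j: "continuous_map (fst X) (fst C) j" "j (snd X) = snd C"
    using C' by (auto simp: pointed_map_def)
  have pA: "snd A \<in> topspace (fst A)" using A by (simp add: is_pspace_def)
  have "continuous_map (prod_topology unit_top (fst A)) unit_top (\<lambda>z. 1 - fst z)"
    by (rule continuous_map_into_subtopology)
      (auto intro!: continuous_intros continuous_map_into_fulltopology[OF continuous_map_fst])
  then have h': "continuous_map (prod_topology unit_top (fst A)) (fst X) ?h"
    by (intro continuous_map_comp[OF h(1)] continuous_map_pairedI continuous_map_snd)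
  let ?\<theta> = "\<lambda>\<tau> t. (1 - \<tau>) * max (- 2 * t) (4 * t - 3) + \<tau> * (t :: real)"
  have \<theta>: "-1 \<le> ?\<theta> \<tau> t \<and> ?\<theta> \<tau> t \<le> 1" if "0 \<le> \<tau>" "\<tau> \<le> 1" "0 \<le> t" "t \<le> 1" for \<tau> t
  proof -
    have "max (- 2 * t) (4 * t - 3) \<in> {-1..1}" "t \<in> {-1..1}" using that by auto
    then have "(1 - \<tau>) *\<^sub>R max (- 2 * t) (4 * t - 3) + \<tau> *\<^sub>R t \<in> {-1..1}"
      using that by (intro convexD[OF convex_real_interval(5)]) auto
    then show ?thesis by simp
  qed
  let ?\<phi> = "\<lambda>z. cone_path j k ?h (fst (snd z)) (?\<theta> (fst z) (snd (snd z)))"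
  have \<phi>: "continuous_map (prod_topology unit_top (prod_topology (fst A) unit_top)) (fst C) ?\<phi>"
    by (rule continuous_map_cone_path[OF C h' _ continuous_map_fst_snd])
      (use \<theta> in \<open>auto simp: h intro!: continuous_intros continuous_map_into_fulltopology[OF continuous_map_fst]
        continuous_map_into_fulltopology[OF continuous_map_snd_snd]\<close>)
  have f: "continuous_map (prod_topology unit_top (fst X)) (fst C) (\<lambda>z. j (snd z))"
    by (rule continuous_map_comp[OF j(1) continuous_map_snd])
  obtain H where H: "continuous_map (prod_topology unit_top (fst C)) (fst C) H"
    "\<And>\<tau> x. 0 \<le> \<tau> \<Longrightarrow> \<tau> \<le> 1 \<Longrightarrow> x \<in> topspace (fst X) \<Longrightarrow> H (\<tau>, j x) = j (snd (\<tau>, x))"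
    "\<And>\<tau> a t. 0 \<le> \<tau> \<Longrightarrow> \<tau> \<le> 1 \<Longrightarrow> a \<in> topspace (fst A) \<Longrightarrow> 0 \<le> t \<Longrightarrow> t \<le> 1 \<Longrightarrow> H (\<tau>, k (a, t)) = ?\<phi> (\<tau>, (a, t))"
  \<comment> \<open>\<open>?\<theta>\<close> takes the value 0 at \<open>t = 0\<close> and 1 at
    \<open>t = 1\<close> for every \<open>\<tau>\<close>, so the deformation respects the gluing to
    \<open>X\<close> and the tip of the cone.\<close>
  proof (rule cone_recE[OF rec f \<phi>])
    fix \<tau> t :: real and a
    assume \<tau>: "0 \<le> \<tau>" "\<tau> \<le> 1"
    show "?\<phi> (\<tau>, (a, 0)) = j (snd (\<tau>, b a))" if "a \<in> topspace (fst A)"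
      using that by (simp add: cone_path_def h)
    show "?\<phi> (\<tau>, (a, 1)) = j (snd (\<tau>, snd X))" if "a \<in> topspace (fst A)"
      using that by (simp add: cone_path_def C' j)
    show "?\<phi> (\<tau>, (snd A, t)) = j (snd (\<tau>, snd X))" if "0 \<le> t" "t \<le> 1"
      using \<theta>[OF \<tau> that] by (auto simp: cone_path_def h(3) C'(5) j(2))
  qed blast
  have kb: "k (snd A, 1) = snd C" using C' by simp
  show ?thesis
    unfolding pointed_homotopic_iff[OF C'(1)]
  proof (intro exI[of _ H] conjI ballI H(1))
    fix c assume c: "c \<in> topspace (fst C)"
    have "topspace (fst C) \<subseteq> j ` topspace (fst X) \<union> k ` (topspace (fst A) \<times> {0..1})"
      using C by (simp add: cone_maps_def)
    with c have "c \<in> j ` topspace (fst X) \<union> k ` (topspace (fst A) \<times> {0..1})" by blast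
    then consider (base) x where "x \<in> topspace (fst X)" "c = j x"
      | (cone) a t where "a \<in> topspace (fst A)" "0 \<le> t" "t \<le> 1" "c = k (a, t)"
      by auto
    note cs = this
    show "H (0, c) = (G \<circ> F) c"
    proof (cases rule: cs)
      case base
      then show ?thesis by (simp add: H(2) F(1) G(1))
    next
      case (cone a t)
      have hX: "h (2 * t, a) \<in> topspace (fst X)" if "t \<le> 1 / 2"
        using h(1) that cone unfolding continuous_map_def Pi_iff by simp
      show ?thesis
      proof (cases "t \<le> 1 / 2")
        case True
        then have "max (- 2 * t) (4 * t - 3) = - 2 * t" by simp
        then show ?thesis using cone True hX by (simp add: H(3) F(2) G(1) cone_path_def)
      next
        case False
        then have "max (- 2 * t) (4 * t - 3) = 4 * t - 3" by simp
        then show ?thesis using cone False by (simp add: H(3) F(2) G(2) cone_path_def)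
      qed
    qed
    show "H (1, c) = id c"
    proof (cases rule: cs)
      case base
      then show ?thesis by (simp add: H(2))
    next
      case (cone a t)
      then show ?thesis using h(2) C'(4) by (auto simp: H(3) cone_path_def)
    qed
  next
    fix \<tau> :: real assume "\<tau> \<in> {0..1}"
    then show "H (\<tau>, snd C) = snd C"
      using H(3)[of \<tau> "snd A" 1] pA by (simp add: kb) (simp add: cone_path_def kb)
  qed
qed

lemma cone_equiv:
  assumes A: "is_pspace A" and C: "cone_maps A X b C j k" and D: "cone_maps A X b' D j' k'"
    and h: "continuous_map (prod_topology unit_top (fst A)) (fst X) h"
      "\<And>a. a \<in> topspace (fst A) \<Longrightarrow> h (0, a) = b a" "\<And>a. a \<in> topspace (fst A) \<Longrightarrow> h (1, a) = b' a"
      "\<And>t. 0 \<le> t \<Longrightarrow> t \<le> 1 \<Longrightarrow> h (t, snd A) = snd X"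
    and rec: "cone_rec A X b C j k (fst C)" "cone_rec A X b C j k (fst D)"
      "cone_rec A X b' D j' k' (fst C)" "cone_rec A X b' D j' k' (fst D)"
  shows "C \<simeq>\<^sub>* D"
proof -
  let ?h = "\<lambda>z. h (1 - fst z, snd z)"
  have "continuous_map (prod_topology unit_top (fst A)) unit_top (\<lambda>z. 1 - fst z)"
    by (rule continuous_map_into_subtopology)
      (auto intro!: continuous_intros continuous_map_into_fulltopology[OF continuous_map_fst])
  then have h': "continuous_map (prod_topology unit_top (fst A)) (fst X) ?h"
    by (intro continuous_map_comp[OF h(1)] continuous_map_pairedI continuous_map_snd)
  obtain F where F: "pointed_map C D F" "\<And>x. x \<in> topspace (fst X) \<Longrightarrow> F (j x) = j' x"
    "\<And>a t. a \<in> topspace (fst A) \<Longrightarrow> 0 \<le> t \<Longrightarrow> t \<le> 1 \<Longrightarrow> F (k (a, t)) = cone_path j' k' h a (2 * t - 1)"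
    using cone_transfer[OF A C D h rec(2)] by blast
  obtain G where G: "pointed_map D C G" "\<And>x. x \<in> topspace (fst X) \<Longrightarrow> G (j' x) = j x"
    "\<And>a t. a \<in> topspace (fst A) \<Longrightarrow> 0 \<le> t \<Longrightarrow> t \<le> 1 \<Longrightarrow> G (k' (a, t)) = cone_path j k ?h a (2 * t - 1)"
    by (rule cone_transfer[OF A D C h' _ _ _ rec(3)]) (auto simp: h)
  have "pointed_homotopic C C (G \<circ> F) id"
    by (rule cone_transfer_half[where h = h and b = b and j = j and k = k and j' = j' and k' = k', OF A C h(1,2,4) rec(1)])
      (auto simp: F(2,3) G(2,3))
  moreover have "pointed_homotopic D D (F \<circ> G) id"
    by (rule cone_transfer_half[where h = ?h and b = b' and j = j' and k = k' and j' = j and k' = k, OF A D h' _ _ rec(4)])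
      (auto simp: h F(2,3) G(2,3))
  ultimately show ?thesis
    using F(1) G(1) unfolding pointed_equiv_def by blast
qed

text \<open>The cone lines form a homotopy of \<open>A\<close> in \<open>C\<close>. Extended over
  \<open>X\<close> it gives \<open>G\<close>, which starts at \<open>j\<close> and ends at a map
  constant on the image of \<open>A\<close>, hence defined on the quotient. The inverse map
  collapses the cone. \<open>C\<close> lives on the type on which \<open>pointed_HEP\<close> is
  tested, so that it may serve as target of the extension.\<close>

lemma cone_quotient_equiv:
  fixes A X :: "'a pspace" and C :: "('a \<times> real) pspace"
  assumes A: "is_pspace A" and X: "is_pspace X" and i: "inclusion_map A X i"
    and C: "cone_maps A X i C j k"
    and rec: "cone_rec A X i C j k (fst C)" "cone_rec A X i C j k (fst (pquot X (i ` topspace (fst A))))"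
  shows "pquot X (i ` topspace (fst A)) \<simeq>\<^sub>* C"
proof -
  let ?B = "i ` topspace (fst A)"
  let ?r = "\<lambda>x. if x \<in> ?B then snd X else x"
  let ?Q = "pquot X ?B"
  have pA: "snd A \<in> topspace (fst A)" and pX: "snd X \<in> topspace (fst X)"
    using A X by (auto simp: is_pspace_def)
  have im: "pointed_map A X i" and HEP: "pointed_HEP A X i"
    using i by (auto simp: inclusion_map_def)
  have ib: "i (snd A) = snd X"
    using im by (auto simp: pointed_map_def)
  have C': "is_pspace C" "pointed_map X C j" "\<And>a. a \<in> topspace (fst A) \<Longrightarrow> k (a, 1) = snd C"
    "\<And>a. a \<in> topspace (fst A) \<Longrightarrow> k (a, 0) = j (i a)"
    "\<And>t. 0 \<le> t \<Longrightarrow> t \<le> 1 \<Longrightarrow> k (snd A, t) = snd C"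
    "continuous_map (prod_topology (fst A) unit_top) (fst C) k"
    "topspace (fst C) \<subseteq> j ` topspace (fst X) \<union> k ` (topspace (fst A) \<times> {0..1})"
    using C by (auto simp: cone_maps_def)
  have jb: "j (snd X) = snd C" using C' by (auto simp: pointed_map_def)
  have kc: "continuous_map (prod_topology unit_top (fst A)) (fst C) (\<lambda>z. k (snd z, fst z))"
    by (intro continuous_map_comp[OF C'(6)] continuous_map_pairedI continuous_map_fst continuous_map_snd)
  obtain G where G: "continuous_map (prod_topology unit_top (fst X)) (fst C) G"
    "\<And>x. x \<in> topspace (fst X) \<Longrightarrow> G (0, x) = j x"
    "\<And>t a. 0 \<le> t \<Longrightarrow> t \<le> 1 \<Longrightarrow> a \<in> topspace (fst A) \<Longrightarrow> G (t, i a) = k (snd (t, a), fst (t, a))"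
    by (rule pointed_HEP_E[OF HEP C'(1,2) kc]) (auto simp: C')
  have Gb: "G (t, snd X) = snd C" if "0 \<le> t" "t \<le> 1" for t
    using G(3)[OF that pA] C'(5)[OF that] ib by simp
  have G1: "G (1, i a) = snd C" if "a \<in> topspace (fst A)" for a
    using G(3)[of 1 a] C'(3)[OF that] that by simp
  have G1c: "continuous_map (fst X) (fst C) (\<lambda>x. G (1, x))"
    by (rule continuous_map_comp[OF G(1)], rule continuous_map_pairedI) auto
  have \<phi>: "pointed_map ?Q C (\<lambda>x. G (1, x))"
    unfolding pointed_map_def
    by (intro conjI continuous_map_from_pquot[OF X G1c]) (auto simp: G1 Gb)
  have rc: "continuous_map (fst X) (fst ?Q) ?r"
    using pointed_map_pquot[of X ?B] by (simp add: pointed_map_def)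
  have pQ: "is_pspace ?Q" by (rule is_pspace_pquot[OF X])
  have cc: "continuous_map (prod_topology (fst A) unit_top) (fst ?Q) (\<lambda>_. snd X)"
    using pQ by (simp add: is_pspace_def)
  obtain \<psi> where \<psi>: "continuous_map (fst C) (fst ?Q) \<psi>" "\<And>x. x \<in> topspace (fst X) \<Longrightarrow> \<psi> (j x) = ?r x"
    "\<And>a t. a \<in> topspace (fst A) \<Longrightarrow> 0 \<le> t \<Longrightarrow> t \<le> 1 \<Longrightarrow> \<psi> (k (a, t)) = snd X"
    by (rule cone_recE1[OF rec(2) rc cc]) auto
  have \<psi>b: "\<psi> (snd C) = snd X" using \<psi>(2)[OF pX] jb by auto
  have \<psi>m: "pointed_map C ?Q \<psi>" using \<psi>(1) \<psi>b by (simp add: pointed_map_def)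
  have \<psi>G: "\<psi> (G (t, i a)) = snd X" if "0 \<le> t" "t \<le> 1" "a \<in> topspace (fst A)" for t a
    using that by (simp add: G(3) \<psi>(3))
  have "pointed_homotopic ?Q ?Q id (\<psi> \<circ> (\<lambda>x. G (1, x)))"
    unfolding pointed_homotopic_iff[OF pQ]
  proof (intro exI[of _ "\<lambda>z. \<psi> (G z)"] conjI ballI)
    show "continuous_map (prod_topology unit_top (fst ?Q)) (fst ?Q) (\<lambda>z. \<psi> (G z))"
      by (rule continuous_map_from_unit_pquot[OF X continuous_map_comp[OF \<psi>(1) G(1)]])
        (auto simp: \<psi>G Gb \<psi>b)
    fix x assume x: "x \<in> topspace (fst ?Q)"
    then have "x \<in> topspace (fst X)" using topspace_pquot_subset[OF X] by auto
    then show "\<psi> (G (0, x)) = id x" using x by (auto simp: G(2) \<psi>(2) topspace_pquot)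
  qed (auto simp: Gb \<psi>b)
  then have 1: "pointed_homotopic ?Q ?Q (\<psi> \<circ> (\<lambda>x. G (1, x))) id" by (rule pointed_homotopic_sym)
  \<comment> \<open>Slides the point at height \<open>t\<close> linearly to the tip as
    \<open>\<tau>\<close> runs from 0 to 1. At \<open>t = 0\<close> the height is
    \<open>\<tau>\<close>, which matches \<open>G\<close> on the image of \<open>A\<close>.\<close>
  let ?s = "\<lambda>z. fst z + snd (snd z) * (1 - fst z) :: real"
  have s: "0 \<le> \<tau> + t * (1 - \<tau>) \<and> \<tau> + t * (1 - \<tau>) \<le> 1" if "0 \<le> \<tau>" "\<tau> \<le> 1" "0 \<le> t" "t \<le> 1" for \<tau> t :: real
  proof -
    have "0 \<le> (1 - t) * (1 - \<tau>)" "0 \<le> t * (1 - \<tau>)" using that by simp_all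
    then show ?thesis using that by (simp add: algebra_simps)
  qed
  have sc: "continuous_map (prod_topology unit_top (prod_topology (fst A) unit_top)) unit_top ?s"
    by (rule continuous_map_into_subtopology)
      (use s in \<open>auto intro!: continuous_intros continuous_map_into_fulltopology[OF continuous_map_fst]
        continuous_map_into_fulltopology[OF continuous_map_snd_snd]\<close>)
  have \<phi>c: "continuous_map (prod_topology unit_top (prod_topology (fst A) unit_top)) (fst C)
      (\<lambda>z. k (fst (snd z), ?s z))"
    by (intro continuous_map_comp[OF C'(6)] continuous_map_pairedI continuous_map_fst_snd sc)
  obtain H where H: "continuous_map (prod_topology unit_top (fst C)) (fst C) H"
    "\<And>\<tau> x. 0 \<le> \<tau> \<Longrightarrow> \<tau> \<le> 1 \<Longrightarrow> x \<in> topspace (fst X) \<Longrightarrow> H (\<tau>, j x) = G (\<tau>, x)"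
    "\<And>\<tau> a t. 0 \<le> \<tau> \<Longrightarrow> \<tau> \<le> 1 \<Longrightarrow> a \<in> topspace (fst A) \<Longrightarrow> 0 \<le> t \<Longrightarrow> t \<le> 1 \<Longrightarrow>
       H (\<tau>, k (a, t)) = (\<lambda>z. k (fst (snd z), ?s z)) (\<tau>, (a, t))"
  proof (rule cone_recE[OF rec(1) G(1) \<phi>c])
    fix \<tau> t :: real and a
    assume \<tau>: "0 \<le> \<tau>" "\<tau> \<le> 1"
    show "k (fst (snd (\<tau>, a, 0)), ?s (\<tau>, a, 0)) = G (\<tau>, i a)" if "a \<in> topspace (fst A)"
      using that \<tau> by (simp add: G)
    show "k (fst (snd (\<tau>, a, 1)), ?s (\<tau>, a, 1)) = G (\<tau>, snd X)" if "a \<in> topspace (fst A)"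
      using that \<tau> by (simp add: Gb C')
    show "k (fst (snd (\<tau>, snd A, t)), ?s (\<tau>, snd A, t)) = G (\<tau>, snd X)" if "0 \<le> t" "t \<le> 1"
      using s[OF \<tau> that] \<tau> by (simp add: Gb C')
  qed blast
  have "pointed_homotopic C C id ((\<lambda>x. G (1, x)) \<circ> \<psi>)"
    unfolding pointed_homotopic_iff[OF C'(1)]
  proof (intro exI[of _ H] conjI ballI H(1))
    fix c assume c: "c \<in> topspace (fst C)"
    with C'(7) have "c \<in> j ` topspace (fst X) \<union> k ` (topspace (fst A) \<times> {0..1})" by blast
    then consider (base) x where "x \<in> topspace (fst X)" "c = j x"
      | (cone) a t where "a \<in> topspace (fst A)" "0 \<le> t" "t \<le> 1" "c = k (a, t)"
      by auto
    note cs = this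
    show "H (0, c) = id c"
      by (cases rule: cs) (auto simp: H(2,3) G(2))
    show "H (1, c) = ((\<lambda>x. G (1, x)) \<circ> \<psi>) c"
    proof (cases rule: cs)
      case (base x)
      then show ?thesis using Gb[of 1] by (auto simp: H(2) \<psi>(2) G1)
    next
      case (cone a t)
      then show ?thesis using Gb[of 1] by (simp add: H(3) \<psi>(3) C')
    qed
  next
    fix \<tau> :: real assume "\<tau> \<in> {0..1}"
    then show "H (\<tau>, snd C) = snd C" using H(2)[OF _ _ pX] Gb jb by auto
  qed
  then have "pointed_homotopic C C ((\<lambda>x. G (1, x)) \<circ> \<psi>) id" by (rule pointed_homotopic_sym)
  then show ?thesis using \<phi> \<psi>m 1 unfolding pointed_equiv_def by blast
qed

section \<open>Two mapping cones: of a constant map and of an injective map\<close>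

definition susp_point :: "'a pspace \<Rightarrow> 'a \<times> real \<Rightarrow> 'a \<times> real" where
  "susp_point A z = (if z \<in> topspace (fst A) \<times> {0, 1} \<union> {snd A} \<times> {0..1} then (snd A, 0) else z)"

lemma quotient_map_susp_point:
  "quotient_map (prod_topology (fst A) unit_top) (fst (psusp A)) (susp_point A)"
  using quotient_map_pquot[of "(prod_topology (fst A) unit_top, (snd A, 0))"
      "topspace (fst A) \<times> {0, 1} \<union> {snd A} \<times> {0..1}"]
  by (simp add: psusp_def susp_point_def[abs_def] cong: if_cong)

text \<open>In the cone of the constant map both ends of the cylinder go to the base point, so the
  cylinder closes up to a suspension attached to \<open>X\<close> at one point.\<close>

lemma cone_maps_susp:
  assumes A: "is_pspace A" and X: "is_pspace X"
  shows "cone_maps A X (\<lambda>_. snd X) (X \<or>\<^sub>* psusp A) (\<lambda>x. (x, (snd A, 0))) (\<lambda>z. (snd X, susp_point A z))"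
proof -
  have S: "is_pspace (psusp A)" by (rule is_pspace_psusp[OF A])
  have pA: "snd A \<in> topspace (fst A)" using A by (simp add: is_pspace_def)
  have s: "continuous_map (prod_topology (fst A) unit_top) (fst (psusp A)) (susp_point A)"
    by (rule quotient_imp_continuous_map[OF quotient_map_susp_point])
  have "topspace (fst (X \<or>\<^sub>* psusp A)) \<subseteq> (\<lambda>x. (x, (snd A, 0))) ` topspace (fst X) \<union>
      (\<lambda>z. (snd X, susp_point A z)) ` (topspace (fst A) \<times> {0..1})"
    using quotient_imp_surjective_map[OF quotient_map_susp_point, of A]
    by (auto simp: topspace_pwedge[OF X S] wedge_set_def)
  moreover have "susp_point A (a, t) = (snd A, 0)" if "a = snd A \<and> 0 \<le> t \<and> t \<le> 1 \<or> a \<in> topspace (fst A) \<and> (t = 0 \<or> t = 1)" for a t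
    using that pA by (auto simp: susp_point_def)
  ultimately show ?thesis
    unfolding cone_maps_def pointed_map_def
    using is_pspace_pwedge[OF X S] continuous_map_inl[OF S, of X] continuous_map_comp[OF continuous_map_inr[OF X] s]
    by simp
qed

lemma cone_rec_susp:
  assumes A: "is_pspace A" and X: "is_pspace X"
  shows "cone_rec A X (\<lambda>_. snd X) (X \<or>\<^sub>* psusp A) (\<lambda>x. (x, (snd A, 0))) (\<lambda>z. (snd X, susp_point A z)) Z"
  unfolding cone_rec_def
proof (intro allI impI, elim conjE)
  fix f \<phi>
  assume f: "continuous_map (prod_topology unit_top (fst X)) Z f"
    and \<phi>: "continuous_map (prod_topology unit_top (prod_topology (fst A) unit_top)) Z \<phi>"
    and eq: "\<forall>\<tau>\<in>{0..1}. (\<forall>a\<in>topspace (fst A). \<phi> (\<tau>, (a, 0)) = f (\<tau>, snd X) \<and> \<phi> (\<tau>, (a, 1)) = f (\<tau>, snd X)) \<and>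
        (\<forall>t\<in>{0..1}. \<phi> (\<tau>, (snd A, t)) = f (\<tau>, snd X))"
  have S: "is_pspace (psusp A)" by (rule is_pspace_psusp[OF A])
  have pA: "snd A \<in> topspace (fst A)" using A by (simp add: is_pspace_def)
  let ?F = "\<lambda>z. if snd (snd z) = (snd A, 0) then f (fst z, fst (snd z)) else \<phi> (fst z, snd (snd z))"
  have \<phi>s: "\<phi> (\<tau>, susp_point A (a, t)) = \<phi> (\<tau>, (a, t))"
    if "0 \<le> \<tau>" "\<tau> \<le> 1" "a \<in> topspace (fst A)" "0 \<le> t" "t \<le> 1" for \<tau> a t
    using that eq pA by (auto simp: susp_point_def)
  have "continuous_map (prod_topology unit_top (fst (psusp A))) Z \<phi>"
    unfolding psusp_def
  proof (rule continuous_map_from_unit_pquot[OF is_pspace_cylinder[OF A]])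
    show "continuous_map (prod_topology unit_top (fst (prod_topology (fst A) unit_top, snd A, 0))) Z \<phi>"
      using \<phi> by simp
  qed (use eq in auto)
  then have "continuous_map (prod_topology unit_top (fst (psusp A))) Z (\<lambda>z. ?F (fst z, (snd X, snd z)))"
    by (rule continuous_map_eq) (use eq in auto)
  moreover have "continuous_map (prod_topology unit_top (fst X)) Z (\<lambda>z. ?F (fst z, (snd z, snd (psusp A))))"
    using f by simp
  ultimately have F: "continuous_map (prod_topology unit_top (fst (X \<or>\<^sub>* psusp A))) Z ?F"
    by (intro continuous_map_from_prod_pwedge[OF X S])
  show "\<exists>F. continuous_map (prod_topology unit_top (fst (X \<or>\<^sub>* psusp A))) Z F \<and>
       (\<forall>\<tau>\<in>{0..1}. (\<forall>x\<in>topspace (fst X). F (\<tau>, x, snd A, 0) = f (\<tau>, x)) \<and>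
          (\<forall>a\<in>topspace (fst A). \<forall>t\<in>{0..1}. F (\<tau>, snd X, susp_point A (a, t)) = \<phi> (\<tau>, a, t)))"
  proof (intro exI[of _ ?F] conjI F ballI)
    fix \<tau> t :: real and a assume "\<tau> \<in> {0..1}" "a \<in> topspace (fst A)" "t \<in> {0..1}"
    then have "\<phi> (\<tau>, susp_point A (a, t)) = \<phi> (\<tau>, (a, t))" "\<phi> (\<tau>, (snd A, 0)) = f (\<tau>, snd X)"
      using \<phi>s eq by auto
    then show "?F (\<tau>, snd X, susp_point A (a, t)) = \<phi> (\<tau>, a, t)" by auto
  qed auto
qed

text \<open>The reduced mapping cone of \<open>i\<close>, with the copy of its points on which \<open>pointed_HEP\<close> is tested.\<close>

definition cone_point :: "'a pspace \<Rightarrow> 'a pspace \<Rightarrow> ('a \<Rightarrow> 'a) \<Rightarrow> 'a \<times> real \<Rightarrow> 'a \<times> real" where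
  "cone_point A X i z = (if fst z = snd A \<or> snd z = 1 then (snd X, 0) else (i (fst z), snd z))"

text \<open>A wedge takes the place of the disjoint union, since maps out of it are already under
  control. The cylinder is based at its end 1, which becomes the tip and thereby the base point of
  the cone.\<close>

definition cone_wedge :: "'a pspace \<Rightarrow> 'a pspace \<Rightarrow> ('a \<times> 'a \<times> real) pspace" where
  "cone_wedge A X = X \<or>\<^sub>* (prod_topology (fst A) unit_top, (snd A, 1))"

definition cone_glue :: "'a pspace \<Rightarrow> 'a pspace \<Rightarrow> ('a \<Rightarrow> 'a) \<Rightarrow> 'a \<times> 'a \<times> real \<Rightarrow> 'a \<times> real" where
  "cone_glue A X i w = (if snd w = (snd A, 1) then (fst w, 0) else cone_point A X i (snd w))"

definition mapping_cone :: "'a pspace \<Rightarrow> 'a pspace \<Rightarrow> ('a \<Rightarrow> 'a) \<Rightarrow> ('a \<times> real) pspace" where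
  "mapping_cone A X i = (quotient_topology (fst (cone_wedge A X)) (cone_glue A X i), (snd X, 0))"

lemma is_pspace_cylinder1: "is_pspace A \<Longrightarrow> is_pspace (prod_topology (fst A) unit_top, (snd A, 1))"
  by (simp add: is_pspace_def)

lemma topspace_cone_wedge:
  assumes "is_pspace A" "is_pspace X"
  shows "topspace (fst (cone_wedge A X)) = topspace (fst X) \<times> {(snd A, 1)} \<union> {snd X} \<times> (topspace (fst A) \<times> {0..1})"
  unfolding cone_wedge_def using topspace_pwedge[OF assms(2) is_pspace_cylinder1[OF assms(1)]]
  by (simp add: wedge_set_def)

lemma cone_maps_mapping_cone:
  assumes A: "is_pspace A" and X: "is_pspace X" and i: "pointed_map A X i"
  shows "cone_maps A X i (mapping_cone A X i) (\<lambda>x. (x, 0)) (cone_point A X i)"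
proof -
  let ?W = "cone_wedge A X" and ?C = "mapping_cone A X i"
  have pX: "snd X \<in> topspace (fst X)" using X by (simp add: is_pspace_def)
  have ib: "i (snd A) = snd X" using i by (simp add: pointed_map_def)
  have tW: "topspace (fst ?W) = topspace (fst X) \<times> {(snd A, 1)} \<union> {snd X} \<times> (topspace (fst A) \<times> {0..1})"
    by (rule topspace_cone_wedge[OF A X])
  have tC: "topspace (fst ?C) = cone_glue A X i ` topspace (fst ?W)"
    by (simp add: mapping_cone_def)
  have q: "continuous_map (fst ?W) (fst ?C) (cone_glue A X i)"
    unfolding mapping_cone_def fst_conv
    by (rule quotient_imp_continuous_map[OF quotient_map_quotient_topology])
  have jc: "continuous_map (fst X) (fst ?C) (\<lambda>x. (x, 0))"
  proof (rule continuous_map_eq)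
    show "continuous_map (fst X) (fst ?C) (\<lambda>x. cone_glue A X i (x, (snd A, 1)))"
      using continuous_map_comp[OF q, of "fst X" "\<lambda>x. (x, (snd A, 1))"]
        continuous_map_inl[OF is_pspace_cylinder1[OF A], of X] by (simp add: cone_wedge_def)
  qed (simp add: cone_glue_def)
  have kc: "continuous_map (prod_topology (fst A) unit_top) (fst ?C) (cone_point A X i)"
  proof (rule continuous_map_eq)
    show "continuous_map (prod_topology (fst A) unit_top) (fst ?C) (\<lambda>z. cone_glue A X i (snd X, z))"
      using continuous_map_comp[OF q, of "prod_topology (fst A) unit_top" "\<lambda>z. (snd X, z)"]
        continuous_map_inr[OF X, of "(prod_topology (fst A) unit_top, (snd A, 1))"] by (simp add: cone_wedge_def)
  qed (auto simp: cone_glue_def cone_point_def)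
  have "snd ?C \<in> topspace (fst ?C)"
  proof -
    have "(snd X, (snd A, 1)) \<in> topspace (fst ?W)" using pX by (simp add: tW)
    moreover have "cone_glue A X i (snd X, (snd A, 1)) = snd ?C" by (simp add: cone_glue_def mapping_cone_def)
    ultimately show ?thesis unfolding tC by (metis image_eqI)
  qed
  moreover have "topspace (fst ?C) \<subseteq> (\<lambda>x. (x, 0)) ` topspace (fst X) \<union> cone_point A X i ` (topspace (fst A) \<times> {0..1})"
    unfolding tC tW using pX by (auto simp: cone_glue_def image_iff)
  ultimately show ?thesis
    unfolding cone_maps_def pointed_map_def is_pspace_def
    using jc kc ib by (auto simp: cone_point_def mapping_cone_def)
qed

lemma cone_rec_mapping_cone:
  assumes A: "is_pspace A" and X: "is_pspace X" and i: "pointed_map A X i" and inj: "inj_on i (topspace (fst A))"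
  shows "cone_rec A X i (mapping_cone A X i) (\<lambda>x. (x, 0)) (cone_point A X i) Z"
  unfolding cone_rec_def
proof (intro allI impI, elim conjE)
  fix f \<phi>
  assume f: "continuous_map (prod_topology unit_top (fst X)) Z f"
    and \<phi>: "continuous_map (prod_topology unit_top (prod_topology (fst A) unit_top)) Z \<phi>"
    and eq: "\<forall>\<tau>\<in>{0..1}. (\<forall>a\<in>topspace (fst A). \<phi> (\<tau>, (a, 0)) = f (\<tau>, i a) \<and> \<phi> (\<tau>, (a, 1)) = f (\<tau>, snd X)) \<and>
        (\<forall>t\<in>{0..1}. \<phi> (\<tau>, (snd A, t)) = f (\<tau>, snd X))"
  let ?W = "cone_wedge A X" and ?C = "mapping_cone A X i"
  let ?inv = "inv_into (topspace (fst A)) i"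
  \<comment> \<open>Height 0 marks the points of \<open>X\<close>. At positive height the first
    coordinate is \<open>i a\<close>, and injectivity of \<open>i\<close> recovers \<open>a\<close>
    from it.\<close>
  let ?F = "\<lambda>z. if snd (snd z) = 0 then f (fst z, fst (snd z)) else \<phi> (fst z, (?inv (fst (snd z)), snd (snd z)))"
  have inv: "?inv (i a) = a" if "a \<in> topspace (fst A)" for a
    using inv_into_f_f[OF inj that] .
  have Fk: "?F (\<tau>, cone_point A X i (a, t)) = \<phi> (\<tau>, (a, t))"
    if "0 \<le> \<tau>" "\<tau> \<le> 1" "a \<in> topspace (fst A)" "0 \<le> t" "t \<le> 1" for \<tau> a t
    using that eq inv by (auto simp: cone_point_def)
  have q: "quotient_map (fst ?W) (fst ?C) (cone_glue A X i)"
    unfolding mapping_cone_def fst_conv by (rule quotient_map_quotient_topology)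
  have F: "continuous_map (prod_topology unit_top (fst ?C)) Z ?F"
  proof (rule continuous_compose_quotient_map[OF quotient_map_unit_prod[OF q]])
    show "continuous_map (prod_topology unit_top (fst ?W)) Z (?F \<circ> (\<lambda>z. (fst z, cone_glue A X i (snd z))))"
      unfolding cone_wedge_def
    proof (rule continuous_map_from_prod_pwedge[OF X is_pspace_cylinder1[OF A]])
      show "continuous_map (prod_topology unit_top (fst X)) Z
        (\<lambda>z. (?F \<circ> (\<lambda>z. (fst z, cone_glue A X i (snd z)))) (fst z, snd z, snd (prod_topology (fst A) unit_top, snd A, 1)))"
        by (rule continuous_map_eq[OF f]) (auto simp: cone_glue_def)
      show "continuous_map (prod_topology unit_top (fst (prod_topology (fst A) unit_top, snd A, 1))) Z
        (\<lambda>z. (?F \<circ> (\<lambda>z. (fst z, cone_glue A X i (snd z)))) (fst z, snd X, snd z))"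
        unfolding fst_conv
      proof (rule continuous_map_eq[OF \<phi>])
        fix z assume "z \<in> topspace (prod_topology unit_top (prod_topology (fst A) unit_top))"
        then obtain \<tau> a t where z: "z = (\<tau>, (a, t))" "0 \<le> \<tau>" "\<tau> \<le> 1" "a \<in> topspace (fst A)" "0 \<le> t" "t \<le> 1"
          by auto
        have "cone_glue A X i (snd X, (a, t)) = cone_point A X i (a, t)"
          by (auto simp: cone_glue_def cone_point_def)
        then show "\<phi> z = (?F \<circ> (\<lambda>z. (fst z, cone_glue A X i (snd z)))) (fst z, snd X, snd z)"
          using Fk[OF z(2-6)] unfolding z(1) by (simp only: comp_apply fst_conv snd_conv)
      qed
    qed
  qed
  show "\<exists>F. continuous_map (prod_topology unit_top (fst ?C)) Z F \<and>
       (\<forall>\<tau>\<in>{0..1}. (\<forall>x\<in>topspace (fst X). F (\<tau>, x, 0) = f (\<tau>, x)) \<and>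
          (\<forall>a\<in>topspace (fst A). \<forall>t\<in>{0..1}. F (\<tau>, cone_point A X i (a, t)) = \<phi> (\<tau>, a, t)))"
  proof (intro exI[of _ ?F] conjI F ballI)
    fix \<tau> t :: real and a assume "\<tau> \<in> {0..1}" "a \<in> topspace (fst A)" "t \<in> {0..1}"
    then show "?F (\<tau>, cone_point A X i (a, t)) = \<phi> (\<tau>, a, t)"
      using Fk by (simp only: atLeastAtMost_iff)
  qed auto
qed

text \<open>The quotient is the mapping cone of \<open>i\<close>, homotopic maps have equivalent
  mapping cones, and the cone of the constant map is the wedge with the suspension.\<close>

theorem pquot_null_homotopic:
  fixes A X :: "'a pspace"
  assumes A: "is_pspace A" and X: "is_pspace X" and i: "inclusion_map A X i"
    and null: "pointed_homotopic A X i (\<lambda>_. snd X)"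
  shows "pquot X (i ` topspace (fst A)) \<simeq>\<^sub>* X \<or>\<^sub>* psusp A"
proof -
  have im: "pointed_map A X i" using i by (simp add: inclusion_map_def)
  have inj: "inj_on i (topspace (fst A))"
    using i by (simp add: inclusion_map_def embedding_map_def homeomorphic_map_def)
  note C = cone_maps_mapping_cone[OF A X im] and Crec = cone_rec_mapping_cone[OF A X im inj]
  obtain h where h: "continuous_map (prod_topology unit_top (fst A)) (fst X) h"
    "\<And>x. h (0, x) = i x" "\<And>x. h (1, x) = snd X" "\<And>t. 0 \<le> t \<Longrightarrow> t \<le> 1 \<Longrightarrow> h (t, snd A) = snd X"
    using pointed_homotopicE[OF null] by blast
  have "mapping_cone A X i \<simeq>\<^sub>* X \<or>\<^sub>* psusp A"
    by (rule cone_equiv[OF A C cone_maps_susp[OF A X] h Crec Crec cone_rec_susp[OF A X] cone_rec_susp[OF A X]])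
  then show ?thesis
    using pointed_equiv_trans[OF cone_quotient_equiv[OF A X i C Crec Crec]] by blast
qed

section \<open>Cuts and set partitions\<close>

subsection \<open>Spans\<close>

lemma finite_tvecs: "finite (tvecs n)"
proof -
  have "finite {x :: nat \<Rightarrow> int. \<forall>i. (i \<in> {1..n} \<longrightarrow> x i \<in> {-1, 0, 1}) \<and> (i \<notin> {1..n} \<longrightarrow> x i = 0)}"
    by (rule finite_set_of_finite_funs) auto
  then show ?thesis
    by (rule rev_finite_subset) (auto simp: tvecs_def)
qed

text \<open>\<open>A\<close> is finite, so coefficients on all of \<open>A\<close> replace the
  choice of a finite subset; a fixed index set is what the later exchange of summations
  needs.\<close>

lemma lspan_eq:
  assumes "A \<subseteq> tvecs n"
  shows "lspan n A = {x \<in> tvecs n. \<exists>c :: tvec \<Rightarrow> real. \<forall>i\<in>{1..n}. of_int (x i) = (\<Sum>b\<in>A. c b * of_int (b i))}"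
proof -
  have fA: "finite A" using assms finite_tvecs finite_subset by blast
  have "\<exists>c :: tvec \<Rightarrow> real. \<forall>i\<in>{1..n}. of_int (x i) = (\<Sum>b\<in>A. c b * of_int (b i))"
    if "B \<subseteq> A" "\<forall>i\<in>{1..n}. of_int (x i) = (\<Sum>b\<in>B. c b * of_int (b i))" for x B and c :: "tvec \<Rightarrow> real"
  proof (intro exI[of _ "\<lambda>b. if b \<in> B then c b else 0"] ballI)
    fix i assume i: "i \<in> {1..n}"
    have "(\<Sum>b\<in>A. (if b \<in> B then c b else 0) * of_int (b i)) = (\<Sum>b\<in>B. c b * of_int (b i))"
      by (rule sum.mono_neutral_cong_right[OF fA that(1)]) auto
    then show "of_int (x i) = (\<Sum>b\<in>A. (if b \<in> B then c b else 0) * of_int (b i))"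
      using that(2) i by simp
  qed
  then show ?thesis
    unfolding lspan_def using fA by blast
qed

lemma subset_lspan:
  assumes "A \<subseteq> tvecs n"
  shows "A \<subseteq> lspan n A"
proof
  fix x assume x: "x \<in> A"
  then have "\<forall>i\<in>{1..n}. of_int (x i) = (\<Sum>b\<in>{x}. (1 :: real) * of_int (b i))" by simp
  then show "x \<in> lspan n A"
    unfolding lspan_def using x assms by (intro CollectI conjI exI[of _ "{x}"] exI[of _ "\<lambda>_. 1"]) auto
qed

lemma lspan_mono: "A \<subseteq> B \<Longrightarrow> lspan n A \<subseteq> lspan n B"
  unfolding lspan_def by fast

lemma lspan_subset_tvecs: "lspan n A \<subseteq> tvecs n"
  unfolding lspan_def by blast

lemma lspan_idem:
  assumes "A \<subseteq> tvecs n"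
  shows "lspan n (lspan n A) = lspan n A"
proof
  show "lspan n A \<subseteq> lspan n (lspan n A)" by (rule subset_lspan[OF lspan_subset_tvecs])
  show "lspan n (lspan n A) \<subseteq> lspan n A"
  proof
    fix x assume "x \<in> lspan n (lspan n A)"
    then obtain c :: "tvec \<Rightarrow> real" where x: "x \<in> tvecs n"
      and c: "\<forall>i\<in>{1..n}. of_int (x i) = (\<Sum>b\<in>lspan n A. c b * of_int (b i))"
      unfolding lspan_eq[OF lspan_subset_tvecs] by blast
    have "\<forall>b\<in>lspan n A. \<exists>d :: tvec \<Rightarrow> real. \<forall>i\<in>{1..n}. of_int (b i) = (\<Sum>a\<in>A. d a * of_int (a i))"
      unfolding lspan_eq[OF assms] by blast
    then obtain d :: "tvec \<Rightarrow> tvec \<Rightarrow> real"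
      where d: "\<And>b i. b \<in> lspan n A \<Longrightarrow> i \<in> {1..n} \<Longrightarrow> of_int (b i) = (\<Sum>a\<in>A. d b a * of_int (a i))"
      by metis
    define e where "e a = (\<Sum>b\<in>lspan n A. c b * d b a)" for a
    have "of_int (x i) = (\<Sum>a\<in>A. e a * of_int (a i))" if i: "i \<in> {1..n}" for i
    proof -
      have "of_int (x i) = (\<Sum>b\<in>lspan n A. \<Sum>a\<in>A. c b * d b a * of_int (a i))"
        using c i d by (simp add: sum_distrib_left mult.assoc)
      also have "\<dots> = (\<Sum>a\<in>A. \<Sum>b\<in>lspan n A. c b * d b a * of_int (a i))" by (rule sum.swap)
      finally show ?thesis by (simp add: sum_distrib_right e_def)
    qed
    then show "x \<in> lspan n A"
      unfolding lspan_eq[OF assms] using x by blast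
  qed
qed

text \<open>Every vector in the span of \<open>A\<close> already lies in \<open>S\<close>, from
  which it inherits a positive and a negative coordinate.\<close>

lemma lspan_cut:
  assumes "S \<in> cuts n" "A \<subseteq> S"
  shows "lspan n A \<in> cuts n" "lspan n A \<subseteq> S" "A \<subseteq> lspan n A"
proof -
  have S: "S \<subseteq> tvecs n" "lspan n S = S" "\<And>x. x \<in> S \<Longrightarrow> x \<noteq> (\<lambda>_. 0) \<Longrightarrow> Plus x \<noteq> {} \<and> Minus x \<noteq> {}"
    using assms(1) by (auto simp: cuts_def)
  have A: "A \<subseteq> tvecs n" using assms(2) S(1) by blast
  show sub: "lspan n A \<subseteq> S" using lspan_mono[OF assms(2), of n] S(2) by simp
  show "A \<subseteq> lspan n A" by (rule subset_lspan[OF A])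
  show "lspan n A \<in> cuts n"
    unfolding cuts_def using lspan_idem[OF A] lspan_subset_tvecs sub S(3) by blast
qed


subsection \<open>Cuts of weights\<close>

lemma weight_cut_tvecs: "weight_cut n w \<subseteq> tvecs n"
  by (auto simp: weight_cut_def)

lemma weight_cut_cong: "(\<And>i. i \<in> {1..n} \<Longrightarrow> w i = w' i) \<Longrightarrow> weight_cut n w = weight_cut n w'"
  unfolding weight_cut_def by (auto intro!: sum.cong elim!: back_subst[of "\<lambda>s. s = 0"])

lemma tvecs_cases: "x \<in> tvecs n \<Longrightarrow> x i = 1 \<or> x i = 0 \<or> x i = -1"
  unfolding tvecs_def by (cases "i \<in> {1..n}") auto

lemma Plus_subset:
  assumes "x \<in> tvecs n"
  shows "Plus x \<subseteq> {1..n}"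
proof
  fix i assume "i \<in> Plus x"
  then have "x i \<noteq> 0" by (simp add: Plus_def)
  with assms show "i \<in> {1..n}" unfolding tvecs_def by blast
qed

lemma Minus_subset:
  assumes "x \<in> tvecs n"
  shows "Minus x \<subseteq> {1..n}"
proof
  fix i assume "i \<in> Minus x"
  then have "x i \<noteq> 0" by (simp add: Minus_def)
  with assms show "i \<in> {1..n}" unfolding tvecs_def by blast
qed

lemma sum_tvec:
  assumes "x \<in> tvecs n" "A \<subseteq> {1..n}"
  shows "(\<Sum>i\<in>A. x i * int (w i)) = int (sum w (Plus x \<inter> A)) - int (sum w (Minus x \<inter> A))"
proof -
  have fA: "finite A" using assms(2) finite_subset by blast
  have "x i * int (w i) = (if i \<in> Plus x then int (w i) else 0) - (if i \<in> Minus x then int (w i) else 0)" for i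
    using tvecs_cases[OF assms(1), of i] by (auto simp: Plus_def Minus_def)
  then show ?thesis
    using fA by (simp add: sum_subtractf sum.If_cases Int_commute)
qed

lemma weight_cut_iff:
  "x \<in> weight_cut n w \<longleftrightarrow> x \<in> tvecs n \<and> sum w (Plus x) = sum w (Minus x)"
proof (cases "x \<in> tvecs n")
  case True
  then show ?thesis
    using sum_tvec[OF True, of "{1..n}" w] Plus_subset[OF True] Minus_subset[OF True]
    by (simp add: weight_cut_def Int_absorb2 del: of_nat_sum)
qed (simp add: weight_cut_def)

text \<open>The defining equation is linear, so it passes to spans; positive weights exclude nonzero
  solutions without a change of sign.\<close>

lemma weight_cut_in_cuts:
  assumes "\<And>i. i \<in> {1..n} \<Longrightarrow> 0 < w i"
  shows "weight_cut n w \<in> cuts n"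
proof -
  have "lspan n (weight_cut n w) \<subseteq> weight_cut n w"
  proof
    fix x assume "x \<in> lspan n (weight_cut n w)"
    then obtain c :: "tvec \<Rightarrow> real" where x: "x \<in> tvecs n"
      and c: "\<forall>i\<in>{1..n}. of_int (x i) = (\<Sum>b\<in>weight_cut n w. c b * of_int (b i))"
      unfolding lspan_eq[OF weight_cut_tvecs] by blast
    have "of_int (\<Sum>i=1..n. x i * int (w i)) = (\<Sum>i=1..n. of_int (x i) * real (w i))" by simp
    also have "\<dots> = (\<Sum>i=1..n. (\<Sum>b\<in>weight_cut n w. c b * of_int (b i)) * real (w i))"
      by (rule sum.cong) (use c in auto)
    also have "\<dots> = (\<Sum>i=1..n. \<Sum>b\<in>weight_cut n w. c b * (of_int (b i) * real (w i)))"
      by (simp add: sum_distrib_right mult.assoc)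
    also have "\<dots> = (\<Sum>b\<in>weight_cut n w. c b * (\<Sum>i=1..n. of_int (b i) * real (w i)))"
      by (subst sum.swap) (simp add: sum_distrib_left)
    also have "\<dots> = 0"
    proof (rule sum.neutral, rule ballI)
      fix b assume "b \<in> weight_cut n w"
      then have "real_of_int (\<Sum>i=1..n. b i * int (w i)) = 0" by (simp only: weight_cut_def mem_Collect_eq of_int_0)
      then show "c b * (\<Sum>i=1..n. of_int (b i) * real (w i)) = 0" by simp
    qed
    finally have "(\<Sum>i=1..n. x i * int (w i)) = 0" by (simp only: of_int_eq_0_iff)
    then show "x \<in> weight_cut n w" using x by (simp add: weight_cut_def)
  qed
  moreover have "Plus x \<noteq> {} \<and> Minus x \<noteq> {}" if "x \<in> weight_cut n w" "x \<noteq> (\<lambda>_. 0)" for x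
  proof -
    have x: "x \<in> tvecs n" "sum w (Plus x) = sum w (Minus x)" using that(1) by (auto simp: weight_cut_iff)
    have ne: "Plus x \<union> Minus x \<noteq> {}"
      using that(2) tvecs_cases[OF x(1)] by (auto simp: Plus_def Minus_def fun_eq_iff)
    have sub: "Plus x \<subseteq> {1..n}" "Minus x \<subseteq> {1..n}" using Plus_subset[OF x(1)] Minus_subset[OF x(1)] .
    have "0 < sum w A" if "A \<noteq> {}" "A \<subseteq> {1..n}" for A
      using that finite_subset[OF that(2)] assms by (intro sum_pos; blast)
    then show ?thesis using ne sub x(2) by (metis Un_empty_left Un_empty_right less_numeral_extra(3) sum.empty)
  qed
  ultimately show ?thesis
    unfolding cuts_def using weight_cut_tvecs subset_lspan[OF weight_cut_tvecs] by blast
qed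

lemma ord_parts_nth_disjoint:
  assumes "p \<in> ord_parts n" "i < length p" "j < length p" "i \<noteq> j"
  shows "p ! i \<inter> p ! j = {}"
  using assms unfolding ord_parts_def parts_def partition_on_def disjoint_def
  by (auto simp: nth_eq_iff_index_eq)

lemma ord_parts_cover:
  assumes "p \<in> ord_parts n"
  shows "(\<Union>j\<in>{1..length p}. p ! (j - 1)) = {1..n}"
proof -
  have "(\<lambda>j. p ! (j - 1)) ` {1..length p} = set p"
  proof -
    have "{1..length p} = Suc ` {..<length p}" by (simp add: image_Suc_lessThan)
    then show ?thesis by (auto simp: set_conv_nth image_image)
  qed
  then show ?thesis
    using assms unfolding ord_parts_def parts_def partition_on_def by auto
qed

text \<open>A vector that is constant on blocks sees only the block sums of the weights. Hence cuts
  given by weights are stable under pulling back, and merging coordinates amounts to adding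
  weights.\<close>

lemma pull_weight_cut:
  assumes p: "p \<in> ord_parts n"
  shows "pull p (weight_cut n w) = weight_cut (length p) (\<lambda>j. \<Sum>i\<in>p ! (j - 1). w i)"
proof -
  let ?J = "{1..length p}"
  have disj: "p ! (i - 1) \<inter> p ! (j - 1) = {}" if "i \<in> ?J" "j \<in> ?J" "i \<noteq> j" for i j
    using that by (intro ord_parts_nth_disjoint[OF p]) auto
  note cov = ord_parts_cover[OF p]
  have fin: "finite (p ! (j - 1))" if "j \<in> ?J" for j
    using cov that by (metis UN_upper finite_atLeastAtMost finite_subset)
  have key: "(\<Sum>i=1..n. s i * int (w i)) = (\<Sum>j=1..length p. t j * int (\<Sum>i\<in>p ! (j - 1). w i))"
    if "\<forall>j\<in>?J. \<forall>i\<in>p ! (j - 1). s i = t j" for s t :: "nat \<Rightarrow> int"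
  proof -
    have "(\<Sum>i=1..n. s i * int (w i)) = (\<Sum>j\<in>?J. \<Sum>i\<in>p ! (j - 1). s i * int (w i))"
      unfolding cov[symmetric] by (rule sum.UNION_disjoint) (use fin disj in auto)
    also have "\<dots> = (\<Sum>j=1..length p. t j * int (\<Sum>i\<in>p ! (j - 1). w i))"
      using that by (intro sum.cong refl) (simp add: sum_distrib_left)
    finally show ?thesis .
  qed
  show ?thesis
  proof (intro set_eqI iffI)
    fix t assume "t \<in> pull p (weight_cut n w)"
    then obtain s where s: "t \<in> tvecs (length p)" "s \<in> weight_cut n w" "\<forall>j\<in>?J. \<forall>i\<in>p ! (j - 1). s i = t j"
      unfolding pull_def by blast
    then show "t \<in> weight_cut (length p) (\<lambda>j. \<Sum>i\<in>p ! (j - 1). w i)"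
      using s(1,2) key[OF s(3)] by (simp add: weight_cut_def)
  next
    fix t assume t: "t \<in> weight_cut (length p) (\<lambda>j. \<Sum>i\<in>p ! (j - 1). w i)"
    then have tt: "t \<in> tvecs (length p)" by (simp add: weight_cut_def)
    define b where "b i = (THE j. j \<in> ?J \<and> i \<in> p ! (j - 1))" for i
    have b: "b i = j" if "j \<in> ?J" "i \<in> p ! (j - 1)" for i j
      unfolding b_def using that disj by (intro the_equality) auto
    define s where "s i = (if i \<in> {1..n} then t (b i) else 0)" for i
    have s: "\<forall>j\<in>?J. \<forall>i\<in>p ! (j - 1). s i = t j"
      using cov b by (auto simp: s_def)
    have "s \<in> tvecs n"
      using tvecs_cases[OF tt] by (auto simp: s_def tvecs_def)
    then have "s \<in> weight_cut n w"
      using t key[OF s] by (simp add: weight_cut_def)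
    then show "t \<in> pull p (weight_cut n w)"
      unfolding pull_def using tt s by blast
  qed
qed


subsection \<open>The closure of a set partition\<close>

lemma Down_trans: "C \<in> Down B S \<Longrightarrow> B \<in> Down A S \<Longrightarrow> C \<in> Down A S"
proof (induction rule: Down.induct)
  case merge
  then show ?case by (blast intro: Down.merge)
next
  case swap
  then show ?case by (blast intro: Down.swap)
qed

lemma Down_mono: "C \<in> Down A S \<Longrightarrow> S \<subseteq> S' \<Longrightarrow> C \<in> Down A S'"
proof (induction rule: Down.induct)
  case start
  show ?case by (rule Down.start)
next
  case merge
  then show ?case by (blast intro: Down.merge)
next
  case swap
  then show ?case by (blast intro: Down.swap)
qed

lemma down_refl: "P \<in> parts n \<Longrightarrow> P \<in> down n P S"
  by (simp add: down_def Down.start)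

lemma down_closed_down:
  assumes "P \<in> parts n"
  shows "down_closed n S (down n P S)"
  unfolding down_closed_def
proof (intro conjI subset_antisym)
  show "down n P S \<subseteq> parts n" by (auto simp: down_def)
  show "(\<Union>P'\<in>down n P S. down n P' S) \<subseteq> down n P S"
    by (auto simp: down_def intro: Down_trans)
  show "down n P S \<subseteq> (\<Union>P'\<in>down n P S. down n P' S)"
    by (auto intro!: down_refl simp: down_def Down.start)
qed

lemma down_closed_mono:
  assumes "down_closed n S' PP" "S \<subseteq> S'"
  shows "down_closed n S PP"
proof -
  have PP: "PP \<subseteq> parts n" "(\<Union>P\<in>PP. down n P S') = PP"
    using assms(1) by (auto simp: down_closed_def)
  have "down n P S \<subseteq> down n P S'" for P using assms(2) by (auto simp: down_def intro: Down_mono)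
  then have "(\<Union>P\<in>PP. down n P S) \<subseteq> PP" using PP(2) by (metis SUP_mono')
  moreover have "PP \<subseteq> (\<Union>P\<in>PP. down n P S)" using PP(1) down_refl by (meson UN_I subsetD subsetI)
  ultimately show ?thesis using PP(1) unfolding down_closed_def by blast
qed

text \<open>Removing vectors can shrink the span below \<open>S\<close>. The pair is nevertheless a
  relative cut, and replacing \<open>S\<close> by the smaller span does not change it; this mediates
  between the two ways of attaching a functor value to the pair.\<close>

lemma rel_cut_diff:
  assumes S: "S \<in> cuts n" and PP: "down_closed n S PP"
  shows "rel_cut n (cut_diff S PP) PP" and "lspan n (cut_diff S PP) \<in> cuts n"
    and "down_closed n (lspan n (cut_diff S PP)) PP"
    and "Q (lspan n (cut_diff S PP)) PP = Q S PP"
proof -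
  let ?A = "cut_diff S PP"
  have sub: "?A \<subseteq> S" by (auto simp: cut_diff_def)
  note l = lspan_cut[OF S sub]
  show 1: "lspan n ?A \<in> cuts n" by (rule l)
  show 2: "down_closed n (lspan n ?A) PP" by (rule down_closed_mono[OF PP l(2)])
  have 3: "cut_diff (lspan n ?A) PP = ?A"
    using l(2,3) unfolding cut_diff_def cut_at_def by blast
  then show "Q (lspan n ?A) PP = Q S PP" by (simp add: Q_def)
  show "rel_cut n ?A PP"
    unfolding rel_cut_def using 1 2 3 sub S by (auto simp: cuts_def)
qed

lemma parts_finite: "P \<in> parts n \<Longrightarrow> finite P"
  unfolding parts_def using finite_elements by auto

lemma parts_block: "P \<in> parts n \<Longrightarrow> B \<in> P \<Longrightarrow> B \<subseteq> {1..n} \<and> B \<noteq> {} \<and> finite B"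
  unfolding parts_def partition_on_def using finite_subset[OF _ finite_atLeastAtMost[of 1 n]] by auto

lemma Down_merge_many: "Ms \<noteq> {#} \<Longrightarrow> Ms + R \<in> Down A S \<Longrightarrow> add_mset (\<Sum>\<^sub># Ms) R \<in> Down A S"
proof (induction Ms arbitrary: R)
  case (add x Ms)
  show ?case
  proof (cases "Ms = {#}")
    case True
    then show ?thesis using add.prems by simp
  next
    case False
    have "Ms + add_mset x R \<in> Down A S" using add.prems by simp
    from add.IH[OF False this] show ?thesis
      using Down.merge[of x "\<Sum>\<^sub># Ms" R A S] by (simp add: add_mset_commute)
  qed
qed simp

lemma Down_swap_sets:
  assumes "X \<subseteq> {1..n}" "Y \<subseteq> {1..n}" "sum w X = sum w Y"
    and D: "add_mset (mset_set X) R \<in> Down A (weight_cut n w)"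
  shows "add_mset (mset_set Y) R \<in> Down A (weight_cut n w)"
proof -
  \<comment> \<open>The difference of the two indicator functions; elements common to
    \<open>X\<close> and \<open>Y\<close> stay where they are.\<close>
  define x :: tvec where "x i = (if i \<in> X - Y then 1 else if i \<in> Y - X then -1 else 0)" for i
  have fin: "finite X" "finite Y" using assms finite_subset by blast+
  have PM: "Plus x = X - Y" "Minus x = Y - X" by (auto simp: Plus_def Minus_def x_def)
  have "sum w X = sum w (X - Y) + sum w (X \<inter> Y)" "sum w Y = sum w (Y - X) + sum w (X \<inter> Y)"
    using fin by (metis Int_commute add.commute sum.Int_Diff)+
  then have "x \<in> weight_cut n w"
    using assms(1-3) unfolding weight_cut_iff PM by (auto simp: tvecs_def x_def)
  from Down.swap[OF D this] have "add_mset (mset_set X - mset_set (X - Y) + mset_set (Y - X)) R \<in> Down A (weight_cut n w)"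
    using fin by (simp add: PM subset_imp_msubset_mset_set)
  moreover have "mset_set X - mset_set (X - Y) = mset_set (X \<inter> Y)"
    using fin by (subst mset_set_Diff[symmetric]) (auto intro: arg_cong[where f = mset_set])
  moreover have "mset_set (X \<inter> Y) + mset_set (Y - X) = mset_set Y"
    using fin by (subst mset_set_Union[symmetric]) (auto intro: arg_cong[where f = mset_set])
  ultimately show ?thesis by simp
qed

lemma sum_mset_disjoint_blocks:
  assumes "finite F" "\<And>A. A \<in> F \<Longrightarrow> finite A" "disjoint F"
  shows "\<Sum>\<^sub># (image_mset mset_set (mset_set F)) = mset_set (\<Union>F)"
  using assms
proof (induction F)
  case (insert A F)
  have "A \<inter> B = {}" if "B \<in> F" for B
    using insert.prems(2) insert.hyps(2) that by (intro disjointD[of "insert A F"]) auto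
  then have "A \<inter> \<Union>F = {}" by auto
  moreover have "disjoint F" by (rule pairwise_subset[OF insert.prems(2)]) auto
  then have "\<Sum>\<^sub># (image_mset mset_set (mset_set F)) = mset_set (\<Union>F)"
    using insert.IH insert.prems(1) by simp
  moreover have "finite A" "finite (\<Union>F)" using insert.prems(1) insert.hyps(1) by auto
  ultimately show ?case
    using insert.hyps by (simp add: mset_set_Union)
qed simp

lemma image_fst_add_msetE:
  assumes "image_mset fst D = add_mset b N"
  obtains D' e where "D = add_mset (b, e) D'" "image_mset fst D' = N"
  using msed_map_invR[OF assms] by auto

text \<open>The multisets \<open>E\<close> attached to the blocks add up to
  \<open>mset_set F\<close>, which has no repetitions. So they are disjoint sets that exhaust
  \<open>F\<close>, and \<open>g\<close> sends each element to the block whose \<open>E\<close>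
  contains it.\<close>

lemma fiber_function_of_matching:
  assumes "finite P" "finite F" "image_mset fst D = image_mset mset_set (mset_set P)"
    and "\<Sum>\<^sub># (image_mset snd D) = mset_set F"
    and "\<And>B E. (B, E) \<in># D \<Longrightarrow> \<Sum>\<^sub># (image_mset w B) = \<Sum>\<^sub># (image_mset W E)"
  shows "\<exists>g. g ` F \<subseteq> P \<and> (\<forall>B\<in>P. (\<Sum>A | A \<in> F \<and> g A = B. W A) = sum w B)"
  using assms
proof (induction P arbitrary: D F rule: finite_induct)
  case empty
  then show ?case by (auto simp: mset_set_empty_iff)
next
  case (insert B P)
  have "image_mset fst D = add_mset (mset_set B) (image_mset mset_set (mset_set P))"
    using insert by simp
  then obtain D' E where D: "D = add_mset (mset_set B, E) D'" "image_mset fst D' = image_mset mset_set (mset_set P)"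
    by (rule image_fst_add_msetE)
  have EF: "mset_set F = E + \<Sum>\<^sub># (image_mset snd D')" using insert.prems(3) D by simp
  define G where "G = set_mset E"
  have cE: "count E A \<le> count (mset_set F) A" for A unfolding EF by simp
  have "count E A = count (mset_set G) A" for A
  proof (cases "A \<in># E")
    case True
    then have "0 < count E A" by simp
    moreover have "count (mset_set F) A \<le> 1" by (simp add: count_mset_set')
    ultimately have "count E A = 1" using cE[of A] by linarith
    then show ?thesis using True by (simp add: G_def)
  next
    case False
    then show ?thesis by (simp add: G_def not_in_iff)
  qed
  then have E: "E = mset_set G" by (rule multiset_eqI)
  have "set_mset E \<subseteq> set_mset (mset_set F)" unfolding EF by simp
  then have GF: "G \<subseteq> F" using insert.prems(1) by (simp add: G_def)
  have fG: "finite G" using GF insert.prems(1) finite_subset by blast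
  have "\<Sum>\<^sub># (image_mset snd D') = mset_set F - mset_set G" using EF E by simp
  also have "\<dots> = mset_set (F - G)" using GF insert.prems(1) by (simp add: mset_set_Diff)
  finally have D'F: "\<Sum>\<^sub># (image_mset snd D') = mset_set (F - G)" .
  have "finite (F - G)" using insert.prems(1) by simp
  from insert.IH[OF this D(2) D'F] obtain g where
    g: "g ` (F - G) \<subseteq> P" "\<forall>B\<in>P. (\<Sum>A | A \<in> F - G \<and> g A = B. W A) = sum w B"
    using insert.prems(4) D(1) by auto
  let ?g = "\<lambda>A. if A \<in> G then B else g A"
  have "{A \<in> F. ?g A = B} = G" using GF g(1) insert.hyps(2) by auto
  moreover have "sum W G = sum w B"
    using insert.prems(4)[of "mset_set B" E] D(1) E fG by (simp add: sum_unfold_sum_mset)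
  moreover have "{A \<in> F. ?g A = B'} = {A \<in> F - G. g A = B'}" if "B' \<in> P" for B'
    using that insert.hyps(2) by auto
  ultimately show ?case
    using g by (intro exI[of _ ?g]) auto
qed

text \<open>An invariant of the closure: each current multiset \<open>B\<close> carries the
  collection \<open>E\<close> of original blocks that went into it. Merging adds both components,
  and an exchange keeps the weight of \<open>B\<close> because the vector used has weight
  zero.\<close>

lemma Down_weight_matching:
  assumes "C \<in> Down (part_mset F) (weight_cut n w)" "F \<in> parts n"
  shows "\<exists>D. image_mset fst D = C \<and> \<Sum>\<^sub># (image_mset snd D) = mset_set F \<and>
    (\<forall>(B, E)\<in>#D. \<Sum>\<^sub># (image_mset w B) = \<Sum>\<^sub># (image_mset (sum w) E))"
  using assms(1)
proof (induction rule: Down.induct)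
  case start
  have fin: "finite F" by (rule parts_finite[OF assms(2)])
  have "\<Sum>\<^sub># (image_mset w (mset_set A)) = sum w A" for A by (simp add: sum_unfold_sum_mset)
  moreover have "\<Sum>\<^sub># (image_mset (\<lambda>A. {#A#}) (mset_set F)) = mset_set F"
    using fin by (induction F) auto
  ultimately show ?case
    by (intro exI[of _ "image_mset (\<lambda>A. (mset_set A, {#A#})) (mset_set F)"])
      (auto simp: part_mset_def image_mset.compositionality o_def)
next
  case (merge B1 B2 R)
  then obtain D where D: "image_mset fst D = add_mset B1 (add_mset B2 R)" "\<Sum>\<^sub># (image_mset snd D) = mset_set F"
    "\<forall>(B, E)\<in>#D. \<Sum>\<^sub># (image_mset w B) = \<Sum>\<^sub># (image_mset (sum w) E)" by blast
  obtain E1 D1 where D1: "D = add_mset (B1, E1) D1" "image_mset fst D1 = add_mset B2 R"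
    by (rule image_fst_add_msetE[OF D(1)])
  obtain E2 D2 where D2: "D1 = add_mset (B2, E2) D2" "image_mset fst D2 = R"
    by (rule image_fst_add_msetE[OF D1(2)])
  show ?case
    using D D1 D2 by (intro exI[of _ "add_mset (B1 + B2, E1 + E2) D2"]) (auto simp: add.assoc)
next
  case (swap B R x)
  then obtain D where D: "image_mset fst D = add_mset B R" "\<Sum>\<^sub># (image_mset snd D) = mset_set F"
    "\<forall>(B, E)\<in>#D. \<Sum>\<^sub># (image_mset w B) = \<Sum>\<^sub># (image_mset (sum w) E)" by blast
  obtain E D1 where D1: "D = add_mset (B, E) D1" "image_mset fst D1 = R"
    by (rule image_fst_add_msetE[OF D(1)])
  have "sum w (Plus x) = sum w (Minus x)" using swap.hyps(2) by (simp add: weight_cut_iff)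
  then have eq: "\<Sum>\<^sub># (image_mset w (mset_set (Plus x))) = \<Sum>\<^sub># (image_mset w (mset_set (Minus x)))"
    by (simp add: sum_unfold_sum_mset)
  obtain B' where B': "B = mset_set (Plus x) + B'" using swap.hyps(3) by (metis subset_mset.le_iff_add)
  show ?case
    using D D1 eq B' by (intro exI[of _ "add_mset (B - mset_set (Plus x) + mset_set (Minus x), E) D1"]) auto
qed

text \<open>Necessity is the preceding invariant. For sufficiency each block \<open>B\<close> of
  \<open>P\<close> is produced by merging the blocks assigned to it and exchanging their union for
  \<open>B\<close>, which has the same weight.\<close>

lemma down_weight_cut_iff:
  assumes F: "F \<in> parts n" and w: "\<And>i. i \<in> {1..n} \<Longrightarrow> 0 < w i"
  shows "P \<in> down n F (weight_cut n w) \<longleftrightarrow>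
    P \<in> parts n \<and> (\<exists>g. g ` F \<subseteq> P \<and> (\<forall>B\<in>P. (\<Sum>A | A \<in> F \<and> g A = B. sum w A) = sum w B))"
proof (intro iffI conjI; (elim conjE exE)?)
  assume P: "P \<in> down n F (weight_cut n w)"
  then show Pp: "P \<in> parts n" by (simp add: down_def)
  obtain D where D: "image_mset fst D = part_mset P" "\<Sum>\<^sub># (image_mset snd D) = mset_set F"
    "\<forall>(B, E)\<in>#D. \<Sum>\<^sub># (image_mset w B) = \<Sum>\<^sub># (image_mset (sum w) E)"
    using Down_weight_matching[of "part_mset P" F n w] P F by (auto simp: down_def)
  show "\<exists>g. g ` F \<subseteq> P \<and> (\<forall>B\<in>P. (\<Sum>A | A \<in> F \<and> g A = B. sum w A) = sum w B)"
    by (rule fiber_function_of_matching[OF parts_finite[OF Pp] parts_finite[OF F] D(1)[unfolded part_mset_def] D(2)])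
      (use D(3) in auto)
next
  fix g assume P: "P \<in> parts n" and g: "g ` F \<subseteq> P" "\<forall>B\<in>P. (\<Sum>A | A \<in> F \<and> g A = B. sum w A) = sum w B"
  have fF: "finite F" by (rule parts_finite[OF F])
  have dF: "disjoint F" using F by (simp add: parts_def partition_on_def)
  \<comment> \<open>\<open>\<B>\<close> collects the blocks of \<open>P\<close> formed so far; the
    blocks of \<open>F\<close> assigned elsewhere are still intact.\<close>
  have claim: "image_mset mset_set (mset_set \<B>) + image_mset mset_set (mset_set {A \<in> F. g A \<notin> \<B>})
      \<in> Down (part_mset F) (weight_cut n w)" if "finite \<B>" "\<B> \<subseteq> P" for \<B>
    using that
  proof (induction \<B>)
    case empty
    then show ?case by (simp add: part_mset_def[symmetric] Down.start)
  next
    case (insert B \<B>)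
    let ?f = "{A \<in> F. g A = B}" and ?R = "{A \<in> F. g A \<notin> insert B \<B>}"
    let ?M = "image_mset mset_set (mset_set \<B>)"
    have B: "B \<in> P" using insert by simp
    have "{A \<in> F. g A \<notin> \<B>} = ?f \<union> ?R" using insert.hyps(2) by auto
    then have "mset_set {A \<in> F. g A \<notin> \<B>} = mset_set ?f + mset_set ?R"
      using fF by (subst mset_set_Union[symmetric]) auto
    then have 1: "image_mset mset_set (mset_set ?f) + (?M + image_mset mset_set (mset_set ?R))
        \<in> Down (part_mset F) (weight_cut n w)"
      using insert.IH insert.prems by (simp add: union_ac)
    \<comment> \<open>A positive weight makes the fibre over \<open>B\<close> nonempty, and merging
      requires at least one multiset.\<close>
    have "0 < sum w B"
      using parts_block[OF P B] w by (intro sum_pos; blast)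
    then have "?f \<noteq> {}" using g(2) B by (metis (no_types, lifting) less_numeral_extra(3) sum.empty)
    then have "image_mset mset_set (mset_set ?f) \<noteq> {#}" using fF by (auto simp: mset_set_empty_iff)
    from Down_merge_many[OF this 1]
    have 2: "add_mset (mset_set (\<Union>?f)) (?M + image_mset mset_set (mset_set ?R)) \<in> Down (part_mset F) (weight_cut n w)"
      using fF dF parts_block[OF F] by (subst (asm) sum_mset_disjoint_blocks) (auto simp: disjoint_def)
    have "sum w (\<Union>?f) = (\<Sum>A\<in>?f. sum w A)"
      using sum.Union_disjoint[of ?f w] parts_block[OF F] dF by (auto simp: disjoint_def)
    then have eq: "sum w (\<Union>?f) = sum w B" using g(2) B by simp
    have "add_mset (mset_set B) (?M + image_mset mset_set (mset_set ?R)) \<in> Down (part_mset F) (weight_cut n w)"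
      by (rule Down_swap_sets[OF _ _ eq 2]) (use parts_block[OF F] parts_block[OF P B] in auto)
    then show ?case using insert.hyps by simp
  qed
  have "{A \<in> F. g A \<notin> P} = {}" using g(1) by auto
  then have "image_mset mset_set (mset_set P) \<in> Down (part_mset F) (weight_cut n w)"
    using claim[OF parts_finite[OF P]] by (simp only: mset_set.empty image_mset_empty) simp
  then show "P \<in> down n F (weight_cut n w)" using P by (simp add: down_def part_mset_def)
qed

subsection \<open>Partitions with one nonsingleton block\<close>

text \<open>The weight criterion for the closure, with the set \<open>V\<close> of counted
  coordinates detached from the ground set of \<open>P\<close>. Coordinates can then be dropped from
  \<open>V\<close> one at a time while \<open>P\<close> stays a partition of everything.\<close>

definition weight_merge :: "nat set \<Rightarrow> (nat \<Rightarrow> nat) \<Rightarrow> nat set set \<Rightarrow> nat set \<Rightarrow> (nat \<Rightarrow> nat) \<Rightarrow> bool" where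
  "weight_merge U \<omega> P V w \<longleftrightarrow>
     (\<exists>c. c ` U \<subseteq> P \<and> (\<forall>B\<in>P. (\<Sum>u | u \<in> U \<and> c u = B. \<omega> u) = sum w (B \<inter> V)))"

text \<open>The block \<open>I\<close> is represented by the item \<open>0\<close>, the other blocks by their elements.\<close>

definition block_items :: "nat \<Rightarrow> nat set \<Rightarrow> nat set" where
  "block_items n I = insert 0 ({1..n} - I)"

definition item_weight :: "(nat \<Rightarrow> nat) \<Rightarrow> nat set \<Rightarrow> nat \<Rightarrow> nat" where
  "item_weight w I u = (if u = 0 then sum w I else w u)"

lemma block_partition_in_parts:
  assumes "I \<noteq> {}" "I \<subseteq> {1..n}"
  shows "block_partition n I \<in> parts n"
  unfolding parts_def mem_Collect_eq
proof (rule partition_onI)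
  show "\<Union>(block_partition n I) = {1..n}" using assms(2) by (auto simp: block_partition_def)
  show "disjnt p q" if "p \<in> block_partition n I" "q \<in> block_partition n I" "p \<noteq> q" for p q
    using that by (auto simp: block_partition_def disjnt_def)
  show "{} \<notin> block_partition n I" using assms(1) by (auto simp: block_partition_def)
qed

lemma down_block_iff:
  assumes I: "I \<noteq> {}" "I \<subseteq> {1..n}" and w: "\<And>i. i \<in> {1..n} \<Longrightarrow> 0 < w i"
  shows "P \<in> down n (block_partition n I) (weight_cut n w) \<longleftrightarrow>
    P \<in> parts n \<and> weight_merge (block_items n I) (item_weight w I) P {1..n} w"
proof (cases "P \<in> parts n")
  case True
  let ?F = "block_partition n I" and ?U = "block_items n I"
  define e where "e u = (if u = 0 then I else {u})" for u :: nat
  have inj: "inj_on e ?U" using I by (auto simp: inj_on_def e_def block_items_def)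
  have im: "e ` ?U = ?F" by (auto simp: e_def block_items_def block_partition_def image_iff)
  have we: "sum w (e u) = item_weight w I u" for u by (simp add: e_def item_weight_def)
  have PB: "B \<inter> {1..n} = B" if "B \<in> P" for B using parts_block[OF True that] by blast
  have sums: "(\<Sum>A | A \<in> ?F \<and> g A = B. sum w A) = (\<Sum>u | u \<in> ?U \<and> g (e u) = B. item_weight w I u)" for g B
  proof -
    have "{A \<in> ?F. g A = B} = e ` {u \<in> ?U. g (e u) = B}" unfolding im[symmetric] by auto
    moreover have "inj_on e {u \<in> ?U. g (e u) = B}" by (rule inj_on_subset[OF inj]) auto
    ultimately show ?thesis by (simp add: sum.reindex we)
  qed
  have "(\<exists>g. g ` ?F \<subseteq> P \<and> (\<forall>B\<in>P. (\<Sum>A | A \<in> ?F \<and> g A = B. sum w A) = sum w B)) \<longleftrightarrow>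
      weight_merge ?U (item_weight w I) P {1..n} w"
  proof
    assume "\<exists>g. g ` ?F \<subseteq> P \<and> (\<forall>B\<in>P. (\<Sum>A | A \<in> ?F \<and> g A = B. sum w A) = sum w B)"
    then obtain g where g: "g ` ?F \<subseteq> P" "\<forall>B\<in>P. (\<Sum>A | A \<in> ?F \<and> g A = B. sum w A) = sum w B" by blast
    show "weight_merge ?U (item_weight w I) P {1..n} w"
      unfolding weight_merge_def
    proof (intro exI[of _ "\<lambda>u. g (e u)"] conjI ballI)
      show "(\<lambda>u. g (e u)) ` ?U \<subseteq> P" using g(1) unfolding im[symmetric] by auto
      show "(\<Sum>u | u \<in> ?U \<and> g (e u) = B. item_weight w I u) = sum w (B \<inter> {1..n})" if "B \<in> P" for B
        using g(2) that PB[OF that] by (simp only: sums)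
    qed
  next
    assume "weight_merge ?U (item_weight w I) P {1..n} w"
    then obtain c where c: "c ` ?U \<subseteq> P"
      "\<And>B. B \<in> P \<Longrightarrow> (\<Sum>u | u \<in> ?U \<and> c u = B. item_weight w I u) = sum w (B \<inter> {1..n})"
      unfolding weight_merge_def by blast
    let ?g = "\<lambda>A. c (inv_into ?U e A)"
    have ge: "?g (e u) = c u" if "u \<in> ?U" for u using inv_into_f_f[OF inj that] by simp
    have "?g ` ?F \<subseteq> P" unfolding im[symmetric] using ge c(1) by auto
    moreover have "(\<Sum>A | A \<in> ?F \<and> ?g A = B. sum w A) = sum w B" if "B \<in> P" for B
    proof -
      have "{u \<in> ?U. ?g (e u) = B} = {u \<in> ?U. c u = B}" using ge by auto
      then show ?thesis using c(2)[OF that] PB[OF that] by (simp only: sums)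
    qed
    ultimately show "\<exists>g. g ` ?F \<subseteq> P \<and> (\<forall>B\<in>P. (\<Sum>A | A \<in> ?F \<and> g A = B. sum w A) = sum w B)" by blast
  qed
  then show ?thesis
    using down_weight_cut_iff[OF block_partition_in_parts[OF I] w] True by simp
qed (simp add: down_def)

text \<open>Removing the last coordinate: a subset of items of the right weight takes over its role in the
  block that contained it.\<close>

lemma weight_merge_remove_last:
  assumes I: "I \<subseteq> {1..k}" and P: "P \<in> parts n" and k: "Suc k \<le> n"
    and H: "\<And>X Y. X \<subseteq> block_items k I \<Longrightarrow> Y \<subseteq> {1..Suc k} \<Longrightarrow> Suc k \<in> Y \<Longrightarrow>
      sum (item_weight w I) X = sum w Y \<Longrightarrow> \<exists>J\<subseteq>X. sum (item_weight w I) J = w (Suc k)"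
  shows "weight_merge (block_items (Suc k) I) (item_weight w I) P {1..Suc k} w \<longleftrightarrow>
    weight_merge (block_items k I) (item_weight w I) P {1..k} w"
proof -
  let ?U = "block_items k I" and ?\<omega> = "item_weight w I"
  have U': "block_items (Suc k) I = insert (Suc k) ?U" "Suc k \<notin> ?U" and fU: "finite ?U"
    using I by (auto simp: block_items_def)
  have \<omega>k: "?\<omega> (Suc k) = w (Suc k)" by (simp add: item_weight_def)
  have PU: "\<Union>P = {1..n}" "disjoint P" using P by (auto simp: parts_def partition_on_def)
  have "Suc k \<in> \<Union>P" unfolding PU(1) using k by simp
  then obtain B0 where B0: "B0 \<in> P" "Suc k \<in> B0" by blast
  have B0u: "B = B0" if "B \<in> P" "Suc k \<in> B" for B
    using disjointD[OF PU(2) that(1) B0(1)] B0(2) that(2) by blast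
  have wB: "sum w (B \<inter> {1..Suc k}) = sum w (B \<inter> {1..k}) + (if B = B0 then w (Suc k) else 0)" if "B \<in> P" for B
  proof (cases "B = B0")
    case True
    then have "B \<inter> {1..Suc k} = insert (Suc k) (B \<inter> {1..k})" using B0 by auto
    then show ?thesis using True by simp
  next
    case False
    then have "Suc k \<notin> B" using B0u that by blast
    then have "B \<inter> {1..Suc k} = B \<inter> {1..k}" by (auto simp: le_Suc_eq)
    then show ?thesis using False by simp
  qed
  have fib: "(\<Sum>u | u \<in> insert (Suc k) ?U \<and> c u = B. ?\<omega> u) =
      (\<Sum>u | u \<in> ?U \<and> c u = B. ?\<omega> u) + (if c (Suc k) = B then w (Suc k) else 0)" for c and B :: "nat set"
  proof -
    have "{u \<in> insert (Suc k) ?U. c u = B} =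
        (if c (Suc k) = B then insert (Suc k) {u \<in> ?U. c u = B} else {u \<in> ?U. c u = B})" by auto
    then show ?thesis using U'(2) fU by (simp add: \<omega>k)
  qed
  show ?thesis
    unfolding U'
  proof
    assume "weight_merge ?U ?\<omega> P {1..k} w"
    then obtain c where c: "c ` ?U \<subseteq> P" "\<And>B. B \<in> P \<Longrightarrow> (\<Sum>u | u \<in> ?U \<and> c u = B. ?\<omega> u) = sum w (B \<inter> {1..k})"
      unfolding weight_merge_def by blast
    let ?c = "c(Suc k := B0)"
    have cU: "{u \<in> ?U. ?c u = B} = {u \<in> ?U. c u = B}" for B using U'(2) by auto
    show "weight_merge (insert (Suc k) ?U) ?\<omega> P {1..Suc k} w"
      unfolding weight_merge_def
    proof (intro exI[of _ ?c] conjI ballI)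
      show "?c ` insert (Suc k) ?U \<subseteq> P" using c(1) B0(1) by auto
      fix B assume B: "B \<in> P"
      show "(\<Sum>u | u \<in> insert (Suc k) ?U \<and> ?c u = B. ?\<omega> u) = sum w (B \<inter> {1..Suc k})"
        unfolding fib cU wB[OF B] c(2)[OF B] by auto
    qed
  next
    assume "weight_merge (insert (Suc k) ?U) ?\<omega> P {1..Suc k} w"
    then obtain c where c: "c ` insert (Suc k) ?U \<subseteq> P"
      "\<And>B. B \<in> P \<Longrightarrow> (\<Sum>u | u \<in> insert (Suc k) ?U \<and> c u = B. ?\<omega> u) = sum w (B \<inter> {1..Suc k})"
      unfolding weight_merge_def by blast
    have c': "(\<Sum>u | u \<in> ?U \<and> c u = B. ?\<omega> u) + (if c (Suc k) = B then w (Suc k) else 0) =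
        sum w (B \<inter> {1..k}) + (if B = B0 then w (Suc k) else 0)" if "B \<in> P" for B
      using c(2)[OF that] fib wB[OF that] by metis
    show "weight_merge ?U ?\<omega> P {1..k} w"
    proof (cases "c (Suc k) = B0")
      case True
      then have "(\<Sum>u | u \<in> ?U \<and> c u = B. ?\<omega> u) = sum w (B \<inter> {1..k})" if "B \<in> P" for B
        using c'[OF that] by (cases "B = B0") auto
      then show ?thesis
        unfolding weight_merge_def using c(1) by (intro exI[of _ c]) auto
    next
      case False
      \<comment> \<open>The item \<open>Suc k\<close> sits in another block than the coordinate
        \<open>Suc k\<close>. Items of the same total weight are moved out of \<open>B0\<close> to
        take its place there, which balances both blocks without \<open>Suc k\<close>.\<close>
      let ?X = "{u \<in> ?U. c u = B0}"
      have "sum ?\<omega> ?X = sum w (B0 \<inter> {1..Suc k})"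
        using c'[OF B0(1)] False wB[OF B0(1)] by simp
      then obtain J where J: "J \<subseteq> ?X" "sum ?\<omega> J = w (Suc k)"
        using H[of ?X "B0 \<inter> {1..Suc k}"] B0 by auto
      let ?c = "\<lambda>u. if u \<in> J then c (Suc k) else c u"
      have fJ: "finite J" using J(1) fU by (auto intro: finite_subset)
      have "(\<Sum>u | u \<in> ?U \<and> ?c u = B. ?\<omega> u) = sum w (B \<inter> {1..k})" if B: "B \<in> P" for B
      proof -
        consider "B = B0" | "B = c (Suc k)" "B \<noteq> B0" | "B \<noteq> B0" "B \<noteq> c (Suc k)" by blast
        then show ?thesis
        proof cases
          case 1
          have "{u \<in> ?U. ?c u = B} = ?X - J" using 1 False J by auto
          then have "(\<Sum>u | u \<in> ?U \<and> ?c u = B. ?\<omega> u) = sum ?\<omega> ?X - sum ?\<omega> J"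
            using J(1) fJ by (simp add: sum_diff_nat)
          then show ?thesis using c'[OF B] 1 False J(2) by simp
        next
          case 2
          have "{u \<in> ?U. ?c u = B} = {u \<in> ?U. c u = B} \<union> J" "{u \<in> ?U. c u = B} \<inter> J = {}"
            using 2 J(1) by auto
          then have "(\<Sum>u | u \<in> ?U \<and> ?c u = B. ?\<omega> u) = sum ?\<omega> {u \<in> ?U. c u = B} + sum ?\<omega> J"
            using fJ fU by (simp add: sum.union_disjoint)
          then show ?thesis using c'[OF B] 2 J(2) by simp
        next
          case 3
          have "{u \<in> ?U. ?c u = B} = {u \<in> ?U. c u = B}" using 3 J(1) by auto
          then show ?thesis using c'[OF B] 3 by simp
        qed
      qed
      then show ?thesis
        unfolding weight_merge_def using c(1) by (intro exI[of _ ?c]) auto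
    qed
  qed
qed

lemma weight_merge_remove_tops:
  assumes I: "I \<subseteq> {1..N}" and P: "P \<in> parts (N + m)"
    and H: "\<And>k X Y. N \<le> k \<Longrightarrow> k < N + m \<Longrightarrow> X \<subseteq> block_items k I \<Longrightarrow> Y \<subseteq> {1..Suc k} \<Longrightarrow> Suc k \<in> Y \<Longrightarrow>
      sum (item_weight w I) X = sum w Y \<Longrightarrow> \<exists>J\<subseteq>X. sum (item_weight w I) J = w (Suc k)"
    and "j \<le> m"
  shows "weight_merge (block_items (N + j) I) (item_weight w I) P {1..N + j} w \<longleftrightarrow>
    weight_merge (block_items N I) (item_weight w I) P {1..N} w"
  using assms(4)
proof (induction j)
  case (Suc j)
  have "weight_merge (block_items (Suc (N + j)) I) (item_weight w I) P {1..Suc (N + j)} w \<longleftrightarrow>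
    weight_merge (block_items (N + j) I) (item_weight w I) P {1..N + j} w"
    by (rule weight_merge_remove_last[OF _ P]) (use I H[of "N + j"] Suc.prems in \<open>auto\<close>)
  then show ?case using Suc by simp
qed simp

lemma restrict_part_in_parts:
  assumes "P \<in> parts n" "N \<le> n"
  shows "restrict_part P {1..N} \<in> parts N"
proof -
  have 1: "{1..N} \<inter> {1..n} = {1..N}" using assms(2) by auto
  have "partition_on ({1..N} \<inter> {1..n}) ((\<inter>) {1..N} ` P - {{}})"
    using assms(1) by (intro partition_on_restrict) (simp add: parts_def)
  then show ?thesis unfolding 1 parts_def restrict_part_def by (simp add: Int_commute)
qed

lemma shifted_restrict_part_in_parts:
  assumes "P \<in> parts (n + m)"
  shows "(\<lambda>B. (\<lambda>i. i - n) ` B) ` restrict_part P {n+1..n+m} \<in> parts m"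
proof -
  have 1: "{n+1..n+m} \<inter> {1..n+m} = {n+1..n+m}" by auto
  have "partition_on ({n+1..n+m} \<inter> {1..n+m}) ((\<inter>) {n+1..n+m} ` P - {{}})"
    using assms by (intro partition_on_restrict) (simp add: parts_def)
  then have "partition_on {n+1..n+m} (restrict_part P {n+1..n+m})"
    unfolding 1 restrict_part_def by (simp add: Int_commute)
  then have "partition_on ((\<lambda>i. i - n) ` {n+1..n+m}) ((\<lambda>B. (\<lambda>i. i - n) ` B) ` restrict_part P {n+1..n+m} - {{}})"
    by (rule partition_on_inj_image) (auto simp: inj_on_def)
  moreover have "{} \<notin> (\<lambda>B. (\<lambda>i. i - n) ` B) ` restrict_part P {n+1..n+m}"
    by (auto simp: restrict_part_def)
  moreover have "(\<lambda>i. i - n) ` {n+1..n+m} = {1..m}"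
    by (auto simp: image_iff intro!: bexI[of _ "_ + n"])
  ultimately show ?thesis by (simp add: parts_def del: Diff_insert0) (metis Diff_empty Diff_insert0)
qed

text \<open>Positive weights keep every item out of the blocks that miss \<open>{1..N}\<close>. Each
  remaining block is determined by its trace on \<open>{1..N}\<close>, so the distributions over
  \<open>P\<close> and over its restriction correspond.\<close>

lemma weight_merge_restrict:
  assumes P: "P \<in> parts n" and fU: "finite U" and \<omega>: "\<And>u. u \<in> U \<Longrightarrow> 0 < \<omega> u"
  shows "weight_merge U \<omega> (restrict_part P {1..N}) {1..N} w \<longleftrightarrow> weight_merge U \<omega> P {1..N} w"
proof -
  let ?R = "restrict_part P {1..N}"
  have uniq: "B = B'" if "B \<in> P" "B' \<in> P" "B \<inter> {1..N} = B' \<inter> {1..N}" "B \<inter> {1..N} \<noteq> {}" for B B'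
    using P that disjointD[of P B B'] by (auto simp: parts_def partition_on_def)
  show ?thesis
  proof
    assume "weight_merge U \<omega> P {1..N} w"
    then obtain c where c: "c ` U \<subseteq> P" "\<And>B. B \<in> P \<Longrightarrow> (\<Sum>u | u \<in> U \<and> c u = B. \<omega> u) = sum w (B \<inter> {1..N})"
      unfolding weight_merge_def by blast
    have ne: "c u \<inter> {1..N} \<noteq> {}" if "u \<in> U" for u
    proof
      assume "c u \<inter> {1..N} = {}"
      then have "(\<Sum>v | v \<in> U \<and> c v = c u. \<omega> v) = 0" using c(1) c(2)[of "c u"] that by auto
      then show False using fU that \<omega>[OF that] by auto
    qed
    show "weight_merge U \<omega> ?R {1..N} w"
      unfolding weight_merge_def
    proof (intro exI[of _ "\<lambda>u. c u \<inter> {1..N}"] conjI ballI)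
      show "(\<lambda>u. c u \<inter> {1..N}) ` U \<subseteq> ?R" using c(1) ne by (auto simp: restrict_part_def)
      fix B' assume "B' \<in> ?R"
      then obtain B where B: "B \<in> P" "B' = B \<inter> {1..N}" "B' \<noteq> {}" by (auto simp: restrict_part_def)
      have "{u \<in> U. c u \<inter> {1..N} = B'} = {u \<in> U. c u = B}"
        using uniq B c(1) by auto
      then show "(\<Sum>u | u \<in> U \<and> c u \<inter> {1..N} = B'. \<omega> u) = sum w (B' \<inter> {1..N})"
        using c(2)[OF B(1)] B(2) by (simp add: Int_assoc)
    qed
  next
    assume "weight_merge U \<omega> ?R {1..N} w"
    then obtain g where g: "g ` U \<subseteq> ?R" "\<And>B. B \<in> ?R \<Longrightarrow> (\<Sum>u | u \<in> U \<and> g u = B. \<omega> u) = sum w (B \<inter> {1..N})"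
      unfolding weight_merge_def by blast
    have "\<forall>u\<in>U. \<exists>B. B \<in> P \<and> g u = B \<inter> {1..N}" using g(1) by (auto simp: restrict_part_def)
    then obtain c where c: "\<And>u. u \<in> U \<Longrightarrow> c u \<in> P \<and> g u = c u \<inter> {1..N}" by metis
    have gne: "g u \<noteq> {}" if "u \<in> U" for u using g(1) that by (auto simp: restrict_part_def)
    show "weight_merge U \<omega> P {1..N} w"
      unfolding weight_merge_def
    proof (intro exI[of _ c] conjI ballI)
      show "c ` U \<subseteq> P" using c by auto
      fix B assume B: "B \<in> P"
      show "(\<Sum>u | u \<in> U \<and> c u = B. \<omega> u) = sum w (B \<inter> {1..N})"
      proof (cases "B \<inter> {1..N} = {}")
        case True
        then have "{u \<in> U. c u = B} = {}" using c gne by fastforce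
        then show ?thesis using True by (simp only: sum.empty)
      next
        case False
        have "{u \<in> U. c u = B} = {u \<in> U. g u = B \<inter> {1..N}}"
        proof (intro set_eqI iffI)
          fix u assume "u \<in> {u \<in> U. g u = B \<inter> {1..N}}"
          then show "u \<in> {u \<in> U. c u = B}" using c[of u] uniq[of "c u" B] B False by simp
        qed (use c in auto)
        moreover have "B \<inter> {1..N} \<in> ?R" using B False by (auto simp: restrict_part_def)
        ultimately show ?thesis using g(2)[of "B \<inter> {1..N}"] by (simp add: Int_assoc)
      qed
    qed
  qed
qed

text \<open>Once the top coordinates are removed, only the trace of \<open>P\<close> on
  \<open>{1..N}\<close> enters the weight criterion. Membership therefore imposes nothing on the
  last \<open>m\<close> coordinates.\<close>

lemma down_block_prod:
  assumes I: "I \<noteq> {}" "I \<subseteq> {1..N}" and w: "\<And>i. i \<in> {1..N + m} \<Longrightarrow> 0 < w i"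
    and H: "\<And>k X Y. N \<le> k \<Longrightarrow> k < N + m \<Longrightarrow> X \<subseteq> block_items k I \<Longrightarrow> Y \<subseteq> {1..Suc k} \<Longrightarrow> Suc k \<in> Y \<Longrightarrow>
      sum (item_weight w I) X = sum w Y \<Longrightarrow> \<exists>J\<subseteq>X. sum (item_weight w I) J = w (Suc k)"
  shows "down (N + m) (block_partition (N + m) I) (weight_cut (N + m) w) =
    part_prod N (down N (block_partition N I) (weight_cut N w)) m (parts m)"
proof (intro set_eqI)
  fix P
  have I': "I \<subseteq> {1..N + m}" using I(2) by auto
  have wN: "0 < w i" if "i \<in> {1..N}" for i using w that by simp
  show "P \<in> down (N + m) (block_partition (N + m) I) (weight_cut (N + m) w) \<longleftrightarrow>
      P \<in> part_prod N (down N (block_partition N I) (weight_cut N w)) m (parts m)"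
  proof (cases "P \<in> parts (N + m)")
    case True
    let ?U = "block_items N I"
    have "0 < sum w I" using I wN finite_subset[OF I(2)] by (intro sum_pos; blast)
    then have \<omega>: "0 < item_weight w I u" if "u \<in> ?U" for u
      using that wN by (auto simp: item_weight_def block_items_def)
    have fU: "finite ?U" by (simp add: block_items_def)
    have "P \<in> down (N + m) (block_partition (N + m) I) (weight_cut (N + m) w) \<longleftrightarrow>
        weight_merge (block_items (N + m) I) (item_weight w I) P {1..N + m} w"
      using down_block_iff[OF I(1) I' w] True by simp
    also have "\<dots> \<longleftrightarrow> weight_merge ?U (item_weight w I) P {1..N} w"
      by (rule weight_merge_remove_tops[OF I(2) True H]) auto
    also have "\<dots> \<longleftrightarrow> weight_merge ?U (item_weight w I) (restrict_part P {1..N}) {1..N} w"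
      by (rule weight_merge_restrict[OF True fU \<omega>, symmetric])
    also have "\<dots> \<longleftrightarrow> restrict_part P {1..N} \<in> down N (block_partition N I) (weight_cut N w)"
      using down_block_iff[OF I wN] restrict_part_in_parts[OF True] by simp
    finally show ?thesis
      using True shifted_restrict_part_in_parts[OF True] by (simp add: part_prod_def)
  qed (simp add: down_def part_prod_def)
qed


subsection \<open>Splitting off the largest parts\<close>

lemma cut_prod_weight_cut:
  assumes t: "0 < t" "\<And>i. i \<in> {N+1..N+m} \<Longrightarrow> w i = t"
  shows "cut_prod N (weight_cut N w) m (weight_cut m (\<lambda>_. 1)) =
    {x \<in> weight_cut (N + m) w. (\<Sum>i\<in>{N+1..N+m}. x i) = 0}"
proof (intro set_eqI)
  fix x :: tvec
  let ?x' = "\<lambda>i. if i \<in> {1..N} then x i else 0" and ?x'' = "\<lambda>i. if i \<in> {1..m} then x (N + i) else 0"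
  show "x \<in> cut_prod N (weight_cut N w) m (weight_cut m (\<lambda>_. 1)) \<longleftrightarrow>
      x \<in> {x \<in> weight_cut (N + m) w. (\<Sum>i\<in>{N+1..N+m}. x i) = 0}"
  proof (cases "x \<in> tvecs (N + m)")
    case True
    have tv: "?x' \<in> tvecs N" "?x'' \<in> tvecs m" using tvecs_cases[OF True] by (auto simp: tvecs_def)
    have split: "{1..N + m} = {1..N} \<union> {N+1..N+m}" by auto
    have "(\<Sum>i=1..N + m. x i * int (w i)) = (\<Sum>i=1..N. x i * int (w i)) + (\<Sum>i\<in>{N+1..N+m}. x i * int (w i))"
      unfolding split by (rule sum.union_disjoint) auto
    also have "(\<Sum>i\<in>{N+1..N+m}. x i * int (w i)) = int t * (\<Sum>i\<in>{N+1..N+m}. x i)"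
      unfolding sum_distrib_left by (rule sum.cong) (use t in auto)
    finally have sum: "(\<Sum>i=1..N + m. x i * int (w i)) =
        (\<Sum>i=1..N. x i * int (w i)) + int t * (\<Sum>i\<in>{N+1..N+m}. x i)" .
    have s1: "(\<Sum>i=1..N. ?x' i * int (w i)) = (\<Sum>i=1..N. x i * int (w i))" by (rule sum.cong) auto
    have "(\<Sum>i\<in>{N+1..N+m}. x i) = (\<Sum>i\<in>{1..m}. x (N + i))"
      by (rule sum.reindex_bij_witness[of _ "\<lambda>i. N + i" "\<lambda>i. i - N"]) auto
    also have "\<dots> = (\<Sum>i=1..m. ?x'' i * int 1)" by (rule sum.cong) auto
    finally have s2: "(\<Sum>i=1..m. ?x'' i * int 1) = (\<Sum>i\<in>{N+1..N+m}. x i)" by simp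
    have "x \<in> cut_prod N (weight_cut N w) m (weight_cut m (\<lambda>_. 1)) \<longleftrightarrow>
      (\<Sum>i=1..N. x i * int (w i)) = 0 \<and> (\<Sum>i\<in>{N+1..N+m}. x i) = 0"
      unfolding cut_prod_def weight_cut_def mem_Collect_eq s1 s2 using True tv by blast
    also have "\<dots> \<longleftrightarrow> (\<Sum>i=1..N + m. x i * int (w i)) = 0 \<and> (\<Sum>i\<in>{N+1..N+m}. x i) = 0"
      using sum t(1) by auto
    finally show ?thesis using True by (simp add: weight_cut_def)
  qed (simp add: cut_prod_def weight_cut_def)
qed

lemma part_prod_empty_right: "part_prod N PP m {} = {}"
  by (simp add: part_prod_def)

lemma part_prod_empty_left: "part_prod N {} m LL = {}"
  by (simp add: part_prod_def)

lemma cut_diff_empty: "cut_diff S {} = S"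
  by (simp add: cut_diff_def)

lemma part_prod_extend:
  assumes "P \<in> PP" "PP \<subseteq> parts N"
  shows "P \<union> (\<lambda>i. {i}) ` {N+1..N+m} \<in> part_prod N PP m (parts m)"
proof -
  let ?P = "P \<union> (\<lambda>i. {i}) ` {N+1..N+m}"
  have P: "P \<in> parts N" using assms by blast
  then have PU: "\<Union>P = {1..N}" "disjoint P" "{} \<notin> P" by (auto simp: parts_def partition_on_def)
  have "partition_on ({1..N} \<union> {N+1..N+m}) ?P"
  proof (rule partition_onI)
    show "\<Union>?P = {1..N} \<union> {N+1..N+m}" using PU(1) by auto
    show "{} \<notin> ?P" using PU(3) by auto
    have single: "disjnt p {i}" if "p \<in> P" "i \<in> {N+1..N+m}" for p i
    proof -
      have "p \<subseteq> {1..N}" using PU(1) that(1) by blast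
      then show ?thesis using that(2) by (auto simp: disjnt_def)
    qed
    show "disjnt p q" if "p \<in> ?P" "q \<in> ?P" "p \<noteq> q" for p q
      using that(1,2)
    proof (elim UnE imageE)
      assume "p \<in> P" "q \<in> P"
      then show ?thesis using disjointD[OF PU(2)] that(3) by (simp add: disjnt_def)
    qed (use that(3) single in \<open>auto simp: disjnt_sym\<close>)
  qed
  moreover have "{1..N} \<union> {N+1..N+m} = {1..N+m}" by auto
  ultimately have P': "?P \<in> parts (N + m)" by (simp add: parts_def)
  have sub: "B \<inter> {1..N} = B" if "B \<in> P" for B using PU(1) that by blast
  have "restrict_part ?P {1..N} = P"
    unfolding restrict_part_def image_Un using sub PU(3) by (force simp: image_iff)
  then show ?thesis
    using P' assms(1) shifted_restrict_part_in_parts[OF P'] by (simp add: part_prod_def)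
qed

text \<open>By \<open>H\<close> every vector whose top coordinates do not sum to zero is removed, so
  both sides lie in the product cut. There the removals correspond: a partition of
  \<open>{1..N}\<close> is extended by singletons in one direction, and a partition of
  \<open>{1..N+m}\<close> is restricted in the other.\<close>

lemma cut_diff_prod:
  assumes t: "0 < t" "\<And>i. i \<in> {N+1..N+m} \<Longrightarrow> w i = t" and PP: "PP \<subseteq> parts N"
    and H: "\<And>x. x \<in> weight_cut (N + m) w \<Longrightarrow> (\<Sum>i\<in>{N+1..N+m}. x i) \<noteq> 0 \<Longrightarrow>
      \<exists>P\<in>part_prod N PP m (parts m). x \<in> cut_at (weight_cut (N + m) w) P"
  shows "cut_diff (weight_cut (N + m) w) (part_prod N PP m (parts m)) =
    cut_prod N (cut_diff (weight_cut N w) PP) m (weight_cut m (\<lambda>_. 1))"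
proof (intro set_eqI iffI)
  have cp: "cut_prod N (weight_cut N w) m (weight_cut m (\<lambda>_. 1)) =
      {x \<in> weight_cut (N + m) w. (\<Sum>i\<in>{N+1..N+m}. x i) = 0}"
    by (rule cut_prod_weight_cut[OF t])
  fix x :: tvec
  let ?x' = "\<lambda>i. if i \<in> {1..N} then x i else 0" and ?x'' = "\<lambda>i. if i \<in> {1..m} then x (N + i) else 0"
  let ?S = "weight_cut (N + m) w" and ?PP = "part_prod N PP m (parts m)"
  {
    assume x: "x \<in> cut_diff ?S ?PP"
    then have xP: "x \<notin> cut_at ?S P" if "P \<in> ?PP" for P
      using that by (auto simp: cut_diff_def)
    have xS: "x \<in> ?S" using x by (auto simp: cut_diff_def)
    have "(\<Sum>i\<in>{N+1..N+m}. x i) = 0" using H[OF xS] xP by blast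
    then have "x \<in> cut_prod N (weight_cut N w) m (weight_cut m (\<lambda>_. 1))"
      unfolding cp using xS by blast
    then have parts: "x \<in> tvecs (N + m)" "?x' \<in> weight_cut N w" "?x'' \<in> weight_cut m (\<lambda>_. 1)"
      by (auto simp: cut_prod_def)
    have "?x' \<notin> cut_at (weight_cut N w) P" if "P \<in> PP" for P
    proof
      assume c: "?x' \<in> cut_at (weight_cut N w) P"
      have "B \<subseteq> {1..N}" if "B \<in> P" for B
        using PP \<open>P \<in> PP\<close> that parts_block by blast
      then have "x \<in> cut_at ?S (P \<union> (\<lambda>i. {i}) ` {N+1..N+m})"
        using c xS unfolding cut_at_def by (fastforce split: if_splits)
      then show False using xP[OF part_prod_extend[OF that PP]] by blast
    qed
    then show "x \<in> cut_prod N (cut_diff (weight_cut N w) PP) m (weight_cut m (\<lambda>_. 1))"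
      using parts by (auto simp: cut_prod_def cut_diff_def)
  }
  {
    assume "x \<in> cut_prod N (cut_diff (weight_cut N w) PP) m (weight_cut m (\<lambda>_. 1))"
    then have x: "x \<in> tvecs (N + m)" "?x' \<in> cut_diff (weight_cut N w) PP" "?x'' \<in> weight_cut m (\<lambda>_. 1)"
      by (auto simp: cut_prod_def)
    then have x'T: "?x' \<in> weight_cut N w" by (simp add: cut_diff_def)
    with x have "x \<in> cut_prod N (weight_cut N w) m (weight_cut m (\<lambda>_. 1))" by (simp add: cut_prod_def)
    then have xS: "x \<in> ?S" unfolding cp by simp
    have "x \<notin> cut_at ?S P" if P: "P \<in> ?PP" for P
    proof
      assume "x \<in> cut_at ?S P"
      then have "?x' \<in> cut_at (weight_cut N w) (restrict_part P {1..N})"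
        using x'T unfolding cut_at_def restrict_part_def by auto
      moreover have "restrict_part P {1..N} \<in> PP" using P by (simp add: part_prod_def)
      ultimately show False using x(2) by (auto simp: cut_diff_def)
    qed
    then show "x \<in> cut_diff ?S ?PP" using xS by (auto simp: cut_diff_def)
  }
qed

section \<open>Sequential multisets\<close>

abbreviation weight_mset :: "(nat \<Rightarrow> nat) \<Rightarrow> nat set \<Rightarrow> nat multiset" where
  "weight_mset w V \<equiv> image_mset w (mset_set V)"

text \<open>Sequentiality phrased for values instead of indices. The inductions merge and reorder
  parts all the time; on multisets this needs no bookkeeping of positions, and the property passes
  to sub-multisets at once.\<close>

definition seq_mset :: "nat multiset \<Rightarrow> bool" where
  "seq_mset M \<longleftrightarrow> (\<forall>A B q. A \<subseteq># M \<and> B \<subseteq># M \<and> \<Sum>\<^sub># A = \<Sum>\<^sub># B \<and> q \<in># A \<and> (\<forall>x\<in>#A + B. x \<le> q) \<longrightarrow>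
     (\<exists>B'. B' \<subseteq># B \<and> q = \<Sum>\<^sub># B'))"

lemma seq_msetD:
  assumes "seq_mset M" "A \<subseteq># M" "B \<subseteq># M" "\<Sum>\<^sub># A = \<Sum>\<^sub># B" "q \<in># A" "\<And>x. x \<in># A \<Longrightarrow> x \<le> q" "\<And>x. x \<in># B \<Longrightarrow> x \<le> q"
  obtains B' where "B' \<subseteq># B" "\<Sum>\<^sub># B' = q"
  using assms(1)[unfolded seq_mset_def, rule_format, of A B q] assms(2-) by auto

lemma seq_mset_mono: "seq_mset M \<Longrightarrow> M' \<subseteq># M \<Longrightarrow> seq_mset M'"
  unfolding seq_mset_def by (meson subset_mset.order_trans)

lemma sum_weight_mset: "\<Sum>\<^sub># (weight_mset w X) = sum w X"
  by (simp add: sum_unfold_sum_mset)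

lemma weight_mset_mono: "finite V \<Longrightarrow> X \<subseteq> V \<Longrightarrow> weight_mset w X \<subseteq># weight_mset w V"
  by (intro image_mset_subseteq_mono subset_imp_msubset_mset_set)

lemma subset_add_mset_notin:
  assumes "A \<subseteq># add_mset x B" "x \<notin># A"
  shows "A \<subseteq># B"
proof (rule mset_subset_eqI)
  fix a
  show "count A a \<le> count B a"
    using mset_subset_eq_count[OF assms(1), of a] assms(2) by (cases "a = x") (auto simp: not_in_iff)
qed

lemma sub_weight_mset:
  assumes "finite V" "A \<subseteq># weight_mset w V"
  obtains X where "X \<subseteq> V" "A = weight_mset w X"
proof -
  have "\<exists>X\<subseteq>V. A = weight_mset w X"
    using assms
  proof (induction V arbitrary: A)
    case (insert v V)
    have sub: "A \<subseteq># add_mset (w v) (weight_mset w V)" using insert by simp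
    show ?case
    proof (cases "w v \<in># A")
      case True
      then obtain A' where A': "A = add_mset (w v) A'" by (metis insert_DiffM)
      then have "A' \<subseteq># weight_mset w V" using sub by simp
      from insert.IH[OF this] obtain X where X: "X \<subseteq> V" "A' = weight_mset w X" by blast
      have "finite X" "v \<notin> X" using X(1) insert.hyps finite_subset by blast+
      then have "A = weight_mset w (insert v X)" using A' X by simp
      then show ?thesis using X(1) by blast
    next
      case False
      then have "A \<subseteq># weight_mset w V" using sub by (simp add: subset_add_mset_notin)
      from insert.IH[OF this] show ?thesis by blast
    qed
  qed simp
  then show thesis using that by blast
qed

lemma seq_mset_index:
  assumes M: "seq_mset (weight_mset w V)" and fV: "finite V" and XY: "X \<subseteq> V" "Y \<subseteq> V" "sum w X = sum w Y"
    and q: "q \<in> X" "\<And>i. i \<in> V \<Longrightarrow> i \<in> X \<union> Y \<Longrightarrow> w i \<le> w q"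
  shows "\<exists>Y'\<subseteq>Y. sum w Y' = w q"
proof -
  have fin: "finite X" "finite Y" using XY fV finite_subset by blast+
  obtain B' where B': "B' \<subseteq># weight_mset w Y" "\<Sum>\<^sub># B' = w q"
    by (rule seq_msetD[OF M weight_mset_mono[OF fV XY(1)] weight_mset_mono[OF fV XY(2)], of "w q"])
      (use XY q fin in \<open>auto simp: sum_weight_mset subset_iff\<close>)
  obtain Y' where "Y' \<subseteq> Y" "B' = weight_mset w Y'" by (rule sub_weight_mset[OF fin(2) B'(1)])
  then show ?thesis using B'(2) by (auto simp: sum_weight_mset)
qed

lemma sequential_seq_mset:
  assumes "number_partition n l" and seq: "sequential n l"
  shows "seq_mset (weight_mset l {1..n})"
  unfolding seq_mset_def
proof (intro allI impI, elim conjE)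
  fix A B q assume A: "A \<subseteq># weight_mset l {1..n}" and B: "B \<subseteq># weight_mset l {1..n}"
    and eq: "\<Sum>\<^sub># A = \<Sum>\<^sub># B" and q: "q \<in># A" "\<forall>x\<in>#A + B. x \<le> q"
  have mono: "l i \<le> l j" if "1 \<le> i" "i \<le> j" "j \<le> n" for i j
    using assms(1) that by (auto simp: number_partition_def mono_on_def)
  obtain X where X: "X \<subseteq> {1..n}" "A = weight_mset l X" by (rule sub_weight_mset[OF finite_atLeastAtMost A])
  obtain Y where Y: "Y \<subseteq> {1..n}" "B = weight_mset l Y" by (rule sub_weight_mset[OF finite_atLeastAtMost B])
  have fin: "finite X" "finite Y" using X Y finite_subset by blast+
  obtain i where i: "i \<in> X" "l i = q" using q(1) X fin by auto
  \<comment> \<open>By monotonicity the maximal index has the maximal value \<open>q\<close>. It may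
    differ from \<open>i\<close> and may lie in \<open>Y\<close>; in that case \<open>q\<close>
    itself is a summand on the other side.\<close>
  define k where "k = Max (X \<union> Y)"
  have "k \<in> X \<union> Y" unfolding k_def by (rule Max_in) (use i fin in auto)
  moreover have "i \<le> k" unfolding k_def by (rule Max_ge) (use i fin in auto)
  ultimately have k: "k \<in> X \<union> Y" "i \<le> k" by auto
  have "l k \<le> q" using q(2) k(1) X(2) Y(2) fin by auto
  moreover have "i \<in> {1..n}" "k \<in> {1..n}" using i(1) k(1) X(1) Y(1) by blast+
  then have "q \<le> l k" using mono[of i k] i(2) k(2) by auto
  ultimately have lk: "l k = q" by simp
  show "\<exists>B'. B' \<subseteq># B \<and> q = \<Sum>\<^sub># B'"
  proof (cases "k \<in> X")
    case True
    have "sum l X = sum l Y" using eq X Y by (simp add: sum_weight_mset)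
    then obtain J where "J \<subseteq> Y" "l k = sum l J"
      using seq[unfolded sequential_def, rule_format, of X Y k] X(1) Y(1) True k_def by blast
    then show ?thesis
      using weight_mset_mono[OF fin(2)] Y(2) lk by (intro exI[of _ "weight_mset l J"]) (auto simp: sum_weight_mset)
  next
    case False
    then have "k \<in> Y" using k by simp
    then show ?thesis using Y(2) fin(2) lk by (intro exI[of _ "{#q#}"]) (auto simp: in_image_mset)
  qed
qed

text \<open>Peel off the largest element of \<open>X \<union> Y\<close>. If it lies in \<open>Y\<close>, the excluded configuration forces
  it to be matched with a single element of \<open>X\<close>.\<close>

lemma seq_refinement:
  assumes M: "seq_mset (weight_mset w V)" and fV: "finite V" and pos: "\<And>i. i \<in> V \<Longrightarrow> 0 < w i"
    and "X \<subseteq> V" "Y \<subseteq> V" "sum w X = sum w Y"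
    and "\<And>b X'. b \<in> Y \<Longrightarrow> X' \<subseteq> X \<Longrightarrow> 2 \<le> card X' \<Longrightarrow> w b \<noteq> sum w X'"
  shows "\<exists>f. f ` Y \<subseteq> X \<and> (\<forall>i\<in>X. (\<Sum>u | u \<in> Y \<and> f u = i. w u) = w i)"
  using assms(4-)
proof (induction "card X" arbitrary: X Y)
  case 0
  have fin: "finite X" "finite Y" using 0 fV finite_subset by blast+
  then have "X = {}" using 0 by simp
  then have "sum w Y = 0" using 0 by simp
  then have "\<forall>i\<in>Y. w i = 0" using fin by simp
  then have "Y = {}" using pos \<open>Y \<subseteq> V\<close> by (metis equals0I less_numeral_extra(3) subsetD)
  then show ?case using \<open>X = {}\<close> by simp
next
  case (Suc k)
  have fin: "finite X" "finite Y" using Suc.prems fV finite_subset by blast+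
  have Xne: "X \<noteq> {}" using Suc.hyps(2) by auto
  let ?m = "Max (w ` (X \<union> Y))"
  have "?m \<in> w ` (X \<union> Y)" using fin Xne by (intro Max_in) auto
  then have "\<exists>q\<in>X \<union> Y. w q = ?m" by (elim imageE) metis
  then obtain q where q: "q \<in> X \<union> Y" "w q = ?m" by blast
  have qmax: "w i \<le> w q" if "i \<in> X \<union> Y" for i using q(2) fin that by (auto intro: Max_ge)
  obtain x Z where xZ: "x \<in> X" "Z \<subseteq> Y" "sum w Z = w x"
  proof (cases "q \<in> X")
    case True
    have "\<exists>Z\<subseteq>Y. sum w Z = w q"
      by (rule seq_mset_index[OF M fV Suc.prems(1-3) True]) (use qmax in auto)
    then show thesis using that True by blast
  next
    case False
    then have qY: "q \<in> Y" using q by simp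
    have "\<exists>Z\<subseteq>X. sum w Z = w q"
      by (rule seq_mset_index[OF M fV Suc.prems(2,1) Suc.prems(3)[symmetric] qY]) (use qmax in auto)
    then obtain Z where Z: "Z \<subseteq> X" "sum w Z = w q" by blast
    have "\<not> 2 \<le> card Z" using Suc.prems(4)[OF qY Z(1)] Z(2) by auto
    moreover have "Z \<noteq> {}" using Z(2) pos[of q] qY Suc.prems(2) by auto
    moreover have "finite Z" using Z(1) fin finite_subset by blast
    ultimately have "card Z = 1" by (metis One_nat_def Suc_1 card_0_eq le_antisym not_less_eq_eq le_zero_eq)
    then obtain x where "Z = {x}" by (auto simp: card_1_singleton_iff)
    then show thesis using that[of x "{q}"] Z qY by auto
  qed
  have 1: "k = card (X - {x})" using Suc.hyps(2) xZ(1) fin by simp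
  have eq: "sum w (X - {x}) = sum w (Y - Z)"
    using Suc.prems(3) xZ fin by (simp add: sum_diff_nat finite_subset)
  have "\<exists>f. f ` (Y - Z) \<subseteq> X - {x} \<and> (\<forall>i\<in>X - {x}. (\<Sum>u | u \<in> Y - Z \<and> f u = i. w u) = w i)"
  proof (rule Suc.hyps(1)[OF 1 _ _ eq])
    show "w b \<noteq> sum w X'" if "b \<in> Y - Z" "X' \<subseteq> X - {x}" "2 \<le> card X'" for b X'
      using Suc.prems(4)[of b X'] that by blast
  qed (use Suc.prems in auto)
  then obtain f where f: "f ` (Y - Z) \<subseteq> X - {x}" "\<And>i. i \<in> X - {x} \<Longrightarrow> (\<Sum>u | u \<in> Y - Z \<and> f u = i. w u) = w i"
    by blast
  let ?f = "\<lambda>u. if u \<in> Z then x else f u"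
  have "(\<Sum>u | u \<in> Y \<and> ?f u = i. w u) = w i" if "i \<in> X" for i
  proof (cases "i = x")
    case True
    then have "{u \<in> Y. ?f u = i} = Z" using xZ f(1) by auto
    then show ?thesis using xZ True by simp
  next
    case False
    then have "{u \<in> Y. ?f u = i} = {u \<in> Y - Z. f u = i}" by auto
    then show ?thesis using f(2)[of i] that False by simp
  qed
  then show ?case using f(1) xZ by (intro exI[of _ ?f]) auto
qed

text \<open>Only the \<open>m\<close> largest parts have a prescribed place, at the end. The order
  of the others is free, so any multiset of positive parts can be arranged in this way.\<close>

definition top_form :: "nat \<Rightarrow> nat \<Rightarrow> (nat \<Rightarrow> nat) \<Rightarrow> nat \<Rightarrow> bool" where
  "top_form N m w t \<longleftrightarrow> 1 \<le> m \<and> 0 < t \<and> (\<forall>i\<in>{1..N}. 0 < w i \<and> w i < t) \<and> (\<forall>i\<in>{N+1..N+m}. w i = t)"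

lemma top_formD:
  assumes "top_form N m w t"
  shows "1 \<le> m" "0 < t" "i \<in> {1..N} \<Longrightarrow> w i < t" "i \<in> {1..N} \<Longrightarrow> 0 < w i" "i \<in> {N+1..N+m} \<Longrightarrow> w i = t"
    "i \<in> {1..N+m} \<Longrightarrow> 0 < w i" "i \<in> {1..N+m} \<Longrightarrow> w i \<le> t"
proof -
  show "1 \<le> m" "0 < t" "i \<in> {1..N} \<Longrightarrow> w i < t" "i \<in> {1..N} \<Longrightarrow> 0 < w i" "i \<in> {N+1..N+m} \<Longrightarrow> w i = t"
    using assms by (auto simp: top_form_def)
  show "i \<in> {1..N+m} \<Longrightarrow> 0 < w i" "i \<in> {1..N+m} \<Longrightarrow> w i \<le> t"
    using assms by (cases "i \<le> N"; force simp: top_form_def)+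
qed

text \<open>The form in which maximality of I(\<lambda>) enters the reachability of other blocks. It
  also makes sense for the partitions met in the inductions, where a different choice of summing set
  provides it.\<close>

definition irreducible_sum :: "nat \<Rightarrow> (nat \<Rightarrow> nat) \<Rightarrow> nat set \<Rightarrow> bool" where
  "irreducible_sum N w I \<longleftrightarrow> (\<forall>b\<in>{1..N} - I. \<forall>X\<subseteq>I. 2 \<le> card X \<longrightarrow> w b \<noteq> sum w X)"

text \<open>A summing set with the fewest elements works: trading two or more of its elements for a
  single one outside would make it smaller.\<close>

lemma irreducible_sum_exists:
  assumes "\<exists>J\<subseteq>{1..N}. sum w J = t"
  obtains I where "I \<subseteq> {1..N}" "sum w I = t" "irreducible_sum N w I"
proof -
  obtain J0 where J0: "J0 \<subseteq> {1..N} \<and> sum w J0 = t" using assms by blast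
  obtain I where "I \<subseteq> {1..N} \<and> sum w I = t" "\<forall>J. J \<subseteq> {1..N} \<and> sum w J = t \<longrightarrow> card I \<le> card J"
    using ex_has_least_nat[of "\<lambda>J. J \<subseteq> {1..N} \<and> sum w J = t", OF J0, of card] by blast
  then have I: "I \<subseteq> {1..N}" "sum w I = t" "\<And>J. J \<subseteq> {1..N} \<Longrightarrow> sum w J = t \<Longrightarrow> card I \<le> card J"
    by auto
  have fI: "finite I" using I(1) finite_subset by blast
  have "irreducible_sum N w I"
    unfolding irreducible_sum_def
  proof (intro ballI allI impI)
    fix b X assume b: "b \<in> {1..N} - I" and X: "X \<subseteq> I" "2 \<le> card X"
    show "w b \<noteq> sum w X"
    proof
      assume eq: "w b = sum w X"
      have fX: "finite X" using X fI finite_subset by blast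
      let ?J = "insert b (I - X)"
      have "sum w ?J = w b + (sum w I - sum w X)"
        using b fI fX X(1) by (simp add: sum_diff_nat)
      also have "\<dots> = t" using eq I(2) sum_mono2[OF fI X(1), of w] by simp
      finally have "sum w ?J = t" .
      moreover have "?J \<subseteq> {1..N}" using I(1) b by blast
      ultimately have "card I \<le> card ?J" using I(3) by blast
      also have "\<dots> = Suc (card I - card X)" using b fI fX X(1) by (simp add: card_Diff_subset)
      finally show False using X(2) card_mono[OF fI X(1)] by linarith
    qed
  qed
  then show thesis using that I by blast
qed

lemma seq_top_sum:
  assumes T: "top_form N m w t" and M: "seq_mset (weight_mset w {1..N+m})"
    and x: "x \<in> weight_cut (N + m) w" and nz: "(\<Sum>i\<in>{N+1..N+m}. x i) \<noteq> 0"
  shows "\<exists>J\<subseteq>{1..N}. sum w J = t \<and> (\<forall>i\<in>J. \<forall>j\<in>J. x i = x j \<and> x i \<noteq> 0)"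
proof -
  have pos: "\<exists>J\<subseteq>{1..N}. sum w J = t \<and> (\<forall>i\<in>J. x i = -1)"
    if x: "x \<in> weight_cut (N + m) w" and p: "0 < (\<Sum>i\<in>{N+1..N+m}. x i)" for x
  proof -
    have xt: "x \<in> tvecs (N + m)" "sum w (Plus x) = sum w (Minus x)" using x by (auto simp: weight_cut_iff)
    let ?T = "{N+1..N+m}"
    let ?a = "Plus x \<inter> ?T" and ?b = "Minus x \<inter> ?T"
    have "(\<Sum>i\<in>?T. x i) = (\<Sum>i\<in>?T. x i * int 1)" by simp
    also have "\<dots> = int (card ?a) - int (card ?b)"
      using sum_tvec[OF xt(1), of ?T "\<lambda>_. 1"] by (auto simp: subset_iff)
    finally have ab: "card ?b < card ?a" using p by linarith
    have wT: "sum w A = card A * t" if "A \<subseteq> ?T" for A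
      using top_formD(5)[OF T] that by (simp add: subset_iff)
    have split: "A = (A \<inter> {1..N}) \<union> (A \<inter> ?T)" if "A \<subseteq> {1..N+m}" for A using that by auto
    have wsplit: "sum w A = sum w (A \<inter> {1..N}) + card (A \<inter> ?T) * t" if "A \<subseteq> {1..N+m}" for A
      by (subst split[OF that], subst sum.union_disjoint) (auto simp: wT)
    have eq: "sum w (Plus x \<inter> {1..N}) + card ?a * t = sum w (Minus x \<inter> {1..N}) + card ?b * t"
      using wsplit[OF Plus_subset[OF xt(1)]] wsplit[OF Minus_subset[OF xt(1)]] xt(2) by simp
    \<comment> \<open>Equally many largest parts are cancelled on both sides. At least one remains
      among the positive coordinates and none among the negative ones, so the summands supplied by
      sequentiality are smaller parts.\<close>
    have "card ?a - card ?b \<le> card ?a" by simp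
    then obtain K where K: "K \<subseteq> ?a" "card K = card ?a - card ?b"
      by (rule obtain_subset_with_card_n)
    have fK: "finite K" using K(1) finite_subset by blast
    let ?X = "(Plus x \<inter> {1..N}) \<union> K" and ?Y = "Minus x \<inter> {1..N}"
    have "sum w ?X = sum w (Plus x \<inter> {1..N}) + card K * t"
      using K(1) fK by (subst sum.union_disjoint) (auto simp: wT)
    also have "\<dots> = sum w ?Y"
    proof -
      have "card ?a * t = card K * t + card ?b * t" using K(2) ab by (simp add: add_mult_distrib[symmetric])
      then show ?thesis using eq by simp
    qed
    finally have XY: "sum w ?X = sum w ?Y" .
    have "K \<noteq> {}" using K(2) ab by auto
    then obtain q where q: "q \<in> K" by blast
    have wq: "w q = t" using top_formD(5)[OF T, of q] q K(1) by blast
    have "\<exists>Y'\<subseteq>?Y. sum w Y' = w q"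
      by (rule seq_mset_index[OF M finite_atLeastAtMost _ _ XY]) (use q K(1) wq top_formD(7)[OF T] in auto)
    then show ?thesis using wq by (auto simp: Minus_def)
  qed
  consider "0 < (\<Sum>i\<in>{N+1..N+m}. x i)" | "0 < (\<Sum>i\<in>{N+1..N+m}. - x i)" using nz by (force simp: sum_negf)
  then show ?thesis
  proof cases
    case 1
    from pos[OF x this] obtain J where J: "J \<subseteq> {1..N}" "sum w J = t" "\<forall>i\<in>J. x i = -1" by blast
    then show ?thesis by (intro exI[of _ J]) auto
  next
    case 2
    have "(\<lambda>i. - x i) \<in> weight_cut (N + m) w"
      using x by (auto simp: weight_cut_def tvecs_def sum_negf)
    from pos[OF this] 2 obtain J where J: "J \<subseteq> {1..N}" "sum w J = t" "\<forall>i\<in>J. - x i = -1" by blast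
    then show ?thesis by (intro exI[of _ J]) auto
  qed
qed

lemma top_form_sum_card:
  assumes T: "top_form N m w t" and I: "I \<subseteq> {1..N}" "sum w I = t"
  shows "2 \<le> card I"
proof (rule ccontr)
  assume "\<not> 2 \<le> card I"
  then have "card I = 0 \<or> card I = 1" by linarith
  moreover have "finite I" using I finite_subset by blast
  ultimately have "I = {} \<or> (\<exists>i. I = {i})" by (auto simp: card_1_singleton_iff)
  then show False using I top_formD(2,3)[OF T] by fastforce
qed

text \<open>Without their common part \<open>I\<close> and \<open>J\<close> still have equal weight,
  and \<open>seq_refinement\<close> breaks each element of \<open>I - J\<close> into elements of
  \<open>J - I\<close>. So the block \<open>I\<close> is exchanged for \<open>J\<close>, while the
  singletons from \<open>J - I\<close> merge into those of \<open>I - J\<close>.\<close>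

lemma block_in_down:
  assumes T: "top_form N m w t" and M: "seq_mset (weight_mset w {1..N+m})"
    and I: "I \<subseteq> {1..N}" "sum w I = t" "irreducible_sum N w I" and J: "J \<subseteq> {1..N}" "sum w J = t"
  shows "block_partition (N + m) J \<in> down (N + m) (block_partition (N + m) I) (weight_cut (N + m) w)"
proof -
  let ?n = "N + m"
  have fin: "finite I" "finite J" using I J finite_subset by blast+
  have I2: "2 \<le> card I" and J2: "2 \<le> card J" using top_form_sum_card[OF T] I J by auto
  have Ine: "I \<noteq> {}" "J \<noteq> {}" using I2 J2 by auto
  have sub: "I \<subseteq> {1..?n}" "J \<subseteq> {1..?n}" using I J by auto
  have "sum w I = sum w (I - J) + sum w (I \<inter> J)" "sum w J = sum w (J - I) + sum w (I \<inter> J)"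
    using fin by (metis Int_commute add.commute sum.Int_Diff)+
  then have eq: "sum w (I - J) = sum w (J - I)" using I J by simp
  have "\<exists>f. f ` (J - I) \<subseteq> I - J \<and> (\<forall>i\<in>I - J. (\<Sum>u | u \<in> J - I \<and> f u = i. w u) = w i)"
  proof (rule seq_refinement[OF M _ _ _ _ eq])
    show "w b \<noteq> sum w X'" if "b \<in> J - I" "X' \<subseteq> I - J" "2 \<le> card X'" for b X'
      using I(3) that J(1) unfolding irreducible_sum_def by blast
  qed (use sub top_formD(6)[OF T] in auto)
  then obtain f where f: "f ` (J - I) \<subseteq> I - J" "\<And>i. i \<in> I - J \<Longrightarrow> (\<Sum>u | u \<in> J - I \<and> f u = i. w u) = w i" by blast
  let ?U = "block_items ?n I"
  define c where "c u = (if u = 0 then J else if u \<in> J - I then {f u} else {u})" for u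
  have sJ: "{i} \<noteq> J" for i using J2 by auto
  have fib: "{u \<in> ?U. c u = J} = {0}" using sJ by (auto simp: c_def block_items_def)
  have "weight_merge ?U (item_weight w I) (block_partition ?n J) {1..?n} w"
    unfolding weight_merge_def
  proof (intro exI[of _ c] conjI ballI)
    show "c ` ?U \<subseteq> block_partition ?n J"
      using f(1) sub by (auto simp: c_def block_items_def block_partition_def image_subset_iff)
    fix B assume "B \<in> block_partition ?n J"
    then consider "B = J" | i where "i \<in> {1..?n} - J" "B = {i}" by (auto simp: block_partition_def)
    then show "(\<Sum>u | u \<in> ?U \<and> c u = B. item_weight w I u) = sum w (B \<inter> {1..?n})"
    proof cases
      case 1
      then have "B \<inter> {1..?n} = J" using sub by auto
      then show ?thesis using 1 fib I J by (simp add: item_weight_def)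
    next
      case 2
      have i0: "i \<noteq> 0" using 2 by auto
      have B: "B \<inter> {1..?n} = {i}" using 2 by auto
      show ?thesis
      proof (cases "i \<in> I")
        case True
        have fib': "{u \<in> ?U. c u = B} = {u \<in> J - I. f u = i}"
          using 2 True sJ sub by (auto simp: c_def block_items_def split: if_splits)
        have "(\<Sum>u | u \<in> J - I \<and> f u = i. item_weight w I u) = (\<Sum>u | u \<in> J - I \<and> f u = i. w u)"
          using sub by (intro sum.cong refl) (auto simp: item_weight_def)
        then show ?thesis unfolding fib' B using f(2)[of i] True 2 by simp
      next
        case False
        have "{u \<in> ?U. c u = B} = {i}"
          using 2 False sJ f(1) i0 by (auto simp: c_def block_items_def split: if_splits)
        then show ?thesis using B i0 by (simp add: item_weight_def)
      qed
    qed
  qed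
  then show ?thesis
    using down_block_iff[OF Ine(1) sub(1) top_formD(6)[OF T]] block_partition_in_parts[OF Ine(2) sub(2)] by simp
qed

text \<open>Supplies the exchange hypothesis of \<open>down_block_prod\<close>. The item 0 alone has
  weight \<open>t\<close>; without it the items are ordinary coordinates, and sequentiality applies
  because \<open>Suc k\<close> has the largest weight.\<close>

lemma seq_item_sum:
  assumes T: "top_form N m w t" and M: "seq_mset (weight_mset w {1..N+m})"
    and I: "I \<subseteq> {1..N}" "sum w I = t" and k: "N \<le> k" "k < N + m"
    and X: "X \<subseteq> block_items k I" and Y: "Y \<subseteq> {1..Suc k}" "Suc k \<in> Y"
    and eq: "sum (item_weight w I) X = sum w Y"
  shows "\<exists>J\<subseteq>X. sum (item_weight w I) J = w (Suc k)"
proof (cases "0 \<in> X")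
  case True
  have "w (Suc k) = t" using top_formD(5)[OF T, of "Suc k"] k by simp
  then show ?thesis using True I(2) by (intro exI[of _ "{0}"]) (simp add: item_weight_def)
next
  case False
  have item: "sum (item_weight w I) A = sum w A" if "A \<subseteq> X" for A
    using that False by (intro sum.cong refl) (auto simp: item_weight_def)
  have "w (Suc k) = t" using top_formD(5)[OF T, of "Suc k"] k by simp
  then have "\<exists>J\<subseteq>X. sum w J = w (Suc k)"
    by (intro seq_mset_index[OF M finite_atLeastAtMost])
      (use X Y k False eq item[of X] top_formD(7)[OF T] in \<open>auto simp: block_items_def\<close>)
  then show ?thesis using item by metis
qed


subsection \<open>Lexicographic order\<close>

text \<open>The comparison of sorted lists from the top becomes a statement about sets: unless
  \<open>B\<close> is contained in \<open>A\<close>, the largest element in which the two differ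
  belongs to \<open>A\<close>.\<close>

lemma lex_largerD:
  assumes AB: "finite A" "finite B" and "lex_larger A B"
  shows "B \<subseteq> A \<or> (\<exists>e\<in>A - B. \<forall>y>e. y \<in> A \<longleftrightarrow> y \<in> B)"
proof (rule disjCI)
  assume ne: "\<not> (\<exists>e\<in>A - B. \<forall>y>e. y \<in> A \<longleftrightarrow> y \<in> B)"
  show "B \<subseteq> A"
  proof (rule ccontr)
    assume "\<not> B \<subseteq> A"
    let ?a = "sorted_list_of_set A" and ?b = "sorted_list_of_set B"
    let ?k = "card A" and ?m = "card B"
    obtain q where q: "q < min ?k ?m" "\<And>r. r < q \<Longrightarrow> ?a ! (?k - 1 - r) = ?b ! (?m - 1 - r)"
      "?b ! (?m - 1 - q) < ?a ! (?k - 1 - q)"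
      using assms(3) \<open>\<not> B \<subseteq> A\<close> unfolding lex_larger_def Let_def by blast
    have sorted: "sorted_wrt (<) ?a" "sorted_wrt (<) ?b" by simp_all
    have len: "length ?a = ?k" "length ?b = ?m" by simp_all
    have sets: "set ?a = A" "set ?b = B" using AB by simp_all
    let ?e = "?a ! (?k - 1 - q)"
    \<comment> \<open>The elements above the place \<open>?e\<close> of the first difference are
      exactly the last \<open>q\<close> entries of the sorted list; this is used for both
      lists.\<close>
    have above: "y \<in> C \<longleftrightarrow> (\<exists>r<q. y = c ! (length c - 1 - r))"
      if h: "sorted_wrt (<) c" "set c = C" "q < length c" "c ! (length c - 1 - q) \<le> ?e" "?e < y"
        "\<And>r. r < q \<Longrightarrow> ?e < c ! (length c - 1 - r)"
      for c :: "nat list" and C y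
    proof
      assume "y \<in> C"
      then obtain i where i: "i < length c" "y = c ! i" using h(2) by (auto simp: in_set_conv_nth)
      have "length c - 1 - q < i"
      proof (rule ccontr)
        assume "\<not> length c - 1 - q < i"
        then have "i = length c - 1 - q \<or> i < length c - 1 - q" by linarith
        moreover have "length c - 1 - q < length c" using h(3) by linarith
        ultimately have "c ! i \<le> c ! (length c - 1 - q)"
          using sorted_wrt_nth_less[OF h(1), of i "length c - 1 - q"] by auto
        then show False using h(4,5) i by simp
      qed
      then show "\<exists>r<q. y = c ! (length c - 1 - r)"
        using i h(3) by (intro exI[of _ "length c - 1 - i"]) auto
    next
      assume "\<exists>r<q. y = c ! (length c - 1 - r)"
      then show "y \<in> C" using h(2,3) by (auto intro!: nth_mem)
    qed
    have big: "?e < ?a ! (?k - 1 - r)" if "r < q" for r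
    proof (rule sorted_wrt_nth_less[OF sorted(1)])
      show "?k - 1 - q < ?k - 1 - r" "?k - 1 - r < length ?a" using that q(1) len by linarith+
    qed
    have iff: "y \<in> A \<longleftrightarrow> y \<in> B" if "?e < y" for y
    proof -
      have "y \<in> A \<longleftrightarrow> (\<exists>r<q. y = ?a ! (?k - 1 - r))"
        using above[OF sorted(1) sets(1), of y] q(1) that big unfolding len by simp
      also have "\<dots> \<longleftrightarrow> (\<exists>r<q. y = ?b ! (?m - 1 - r))" using q(2) by auto
      also have "\<dots> \<longleftrightarrow> y \<in> B"
        using above[OF sorted(2) sets(2), of y] q that big unfolding len by simp
      finally show ?thesis .
    qed
    have "?k - 1 - q < length ?a" using q(1) len by simp
    then have "?e \<in> set ?a" by (rule nth_mem)
    then have eA: "?e \<in> A" using sets(1) by simp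
    have eB: "?e \<notin> B"
    proof
      assume "?e \<in> B"
      then obtain i where i: "i < ?m" "?e = ?b ! i" using sets(2) len by (metis in_set_conv_nth)
      have "i > ?m - 1 - q"
      proof (rule ccontr)
        assume "\<not> ?m - 1 - q < i"
        then have "i = ?m - 1 - q \<or> i < ?m - 1 - q" by linarith
        moreover have "?m - 1 - q < length ?b" using q(1) len by simp
        ultimately have "?b ! i \<le> ?b ! (?m - 1 - q)"
          using sorted_wrt_nth_less[OF sorted(2), of i "?m - 1 - q"] by auto
        then show False using q(3) i(2) by simp
      qed
      then have "?m - 1 - i < q" "?m - 1 - (?m - 1 - i) = i" using i(1) q(1) by auto
      then show False using q(2)[of "?m - 1 - i"] big[of "?m - 1 - i"] i(2) by simp
    qed
    show False using ne eA eB iff by blast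
  qed
qed

section \<open>The set I(\<lambda>) when the largest part is unique\<close>

context
  fixes n l I
  assumes np: "number_partition n l" and top: "mm n l = 1" and I: "is_Iset n l I"
begin

lemma number_partition_top_form: "top_form (n - 1) 1 l (l n)"
proof -
  have n: "1 \<le> n" and pos: "\<And>i. i \<in> {1..n} \<Longrightarrow> 0 < l i" and mono: "mono_on {1..n} l"
    using np by (auto simp: number_partition_def)
  have "l i < l n" if i: "i \<in> {1..n - 1}" for i
  proof (rule ccontr)
    assume "\<not> l i < l n"
    moreover have "l i \<le> l n" using i n by (intro mono_onD[OF mono]) auto
    ultimately have "{i, n} \<subseteq> {i \<in> {1..n}. l i = l n}" using i n by auto
    then have "card {i, n} \<le> mm n l" unfolding mm_def by (intro card_mono) auto
    then show False using top i by auto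
  qed
  then show ?thesis using n pos by (auto simp: top_form_def)
qed

lemma Iset_sum: "I \<subseteq> {1..n - 1}" "sum l I = l n"
proof -
  have n: "1 \<le> n" using np by (simp add: number_partition_def)
  have I': "I \<subseteq> {1..n}" "2 \<le> card I" "sum l I = l n" using I by (auto simp: is_Iset_def summing_sets_def)
  show "sum l I = l n" by (rule I')
  have fI: "finite I" using I' finite_subset by blast
  have "n \<notin> I"
  proof
    assume "n \<in> I"
    then have "sum l I = l n + sum l (I - {n})" using fI by (simp add: sum.remove)
    then have 0: "sum l (I - {n}) = 0" using I' by simp
    have "I - {n} \<noteq> {}"
    proof
      assume "I - {n} = {}"
      then have "card I \<le> card {n}" by (intro card_mono) auto
      then show False using I'(2) by simp
    qed
    then obtain i where "i \<in> I" "i \<noteq> n" by blast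
    then have "0 < l i" using np I'(1) by (auto simp: number_partition_def)
    moreover have "l i = 0" using 0 fI \<open>i \<in> I\<close> \<open>i \<noteq> n\<close> by simp
    ultimately show False by simp
  qed
  then show "I \<subseteq> {1..n - 1}" using I'(1) n by (force simp: subset_iff le_eq_less_or_eq)
qed

lemma Iset_lex:
  assumes "X \<subseteq> {1..n - 1}" "sum l X = l n"
  shows "X \<subseteq> I \<or> (\<exists>e\<in>I - X. \<forall>y>e. y \<in> I \<longleftrightarrow> y \<in> X)"
proof -
  have "2 \<le> card X" by (rule top_form_sum_card[OF number_partition_top_form assms])
  moreover have "X \<subseteq> {1..n}" by (rule order_trans[OF assms(1)]) auto
  ultimately have "X \<in> summing_sets n l" using assms by (auto simp: summing_sets_def)
  then have "lex_larger I X" using I by (simp add: is_Iset_def)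
  moreover have "finite I" "finite X" using Iset_sum(1) assms(1) finite_subset by blast+
  ultimately show ?thesis using lex_largerD by blast
qed

text \<open>Every element of \<open>X\<close> is smaller than \<open>b\<close>, since
  \<open>l b\<close> exceeds each single summand. Trading \<open>X\<close> for \<open>b\<close>
  would therefore give a lexicographically larger summing set.\<close>

lemma Iset_irreducible: "irreducible_sum (n - 1) l I"
  unfolding irreducible_sum_def
proof (intro ballI allI impI notI)
  fix b X assume b: "b \<in> {1..n - 1} - I" and X: "X \<subseteq> I" "2 \<le> card X" and eq: "l b = sum l X"
  have fI: "finite I" by (rule finite_subset[OF Iset_sum(1)]) simp
  have fX: "finite X" by (rule finite_subset[OF X(1) fI])
  have big: "i < b" if i: "i \<in> X" for i
  proof (rule ccontr)
    assume "\<not> i < b"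
    then have "l b \<le> l i"
      using np b i X(1) Iset_sum(1) unfolding number_partition_def by (intro mono_onD[of "{1..n}" l]) auto
    moreover have "sum l X = l i + sum l (X - {i})" using fX i by (simp add: sum.remove)
    ultimately have 0: "sum l (X - {i}) = 0" using eq by simp
    have "X - {i} \<noteq> {}"
    proof
      assume "X - {i} = {}"
      then have "card X \<le> card {i}" by (intro card_mono) auto
      then show False using X(2) by simp
    qed
    then obtain j where "j \<in> X - {i}" by blast
    then have "l j = 0" "j \<in> {1..n - 1}" using 0 fX X(1) Iset_sum(1) by auto
    then show False using top_formD(4)[OF number_partition_top_form, of j] by simp
  qed
  let ?Y = "insert b (I - X)"
  have "sum l ?Y = l b + (sum l I - sum l X)" using b fI fX X(1) by (simp add: sum_diff_nat)
  also have "\<dots> = l n" using eq Iset_sum(2) sum_mono2[OF fI X(1), of l] by simp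
  finally have "sum l ?Y = l n" .
  moreover have "?Y \<subseteq> {1..n - 1}" using b Iset_sum(1) by auto
  ultimately consider "?Y \<subseteq> I" | e where "e \<in> I - ?Y" "\<forall>y>e. y \<in> I \<longleftrightarrow> y \<in> ?Y" using Iset_lex by blast
  then show False
  proof cases
    case 1
    then show False using b by auto
  next
    case 2
    then have "e \<in> X" by auto
    then have "b \<in> I" using big 2(2) by blast
    then show False using b by simp
  qed
qed

text \<open>As the parts are sorted, a larger part has an index beyond \<open>Max I\<close>, and a
  summing set reaching beyond \<open>Max I\<close> would be lexicographically larger than
  \<open>I\<close>.\<close>

lemma Iset_no_larger:
  assumes "X \<subseteq> {1..n - 1}" "sum l X = l n" "x \<in> X"
  shows "l x \<le> l (Max I)"
proof (rule ccontr)
  have fI: "finite I" using Iset_sum(1) finite_subset by blast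
  have "I \<noteq> {}" using Iset_sum(2) top_formD(2)[OF number_partition_top_form] by auto
  then have MI: "Max I \<in> I" using fI by simp
  assume "\<not> l x \<le> l (Max I)"
  then have lt: "l (Max I) < l x" by simp
  have big: "Max I < x"
  proof (rule ccontr)
    assume "\<not> Max I < x"
    have "{1..n - 1} \<subseteq> {1..n}" by auto
    then have "x \<in> {1..n}" "Max I \<in> {1..n}" using assms(1,3) MI Iset_sum(1) by blast+
    then have "l x \<le> l (Max I)"
      using np \<open>\<not> Max I < x\<close> unfolding number_partition_def by (intro mono_onD[of "{1..n}" l]) auto
    then show False using lt by simp
  qed
  consider "X \<subseteq> I" | e where "e \<in> I - X" "\<forall>y>e. y \<in> I \<longleftrightarrow> y \<in> X" using Iset_lex[OF assms(1,2)] by blast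
  then have "x \<in> I"
  proof cases
    case 1
    then show ?thesis using assms(3) by blast
  next
    case 2
    then have "e \<le> Max I" using fI by auto
    then show ?thesis using 2 big assms(3) by auto
  qed
  then show False using big fI by (meson Max_ge linorder_not_less)
qed

end


subsection \<open>Gaps\<close>

definition avoids_above :: "nat \<Rightarrow> nat multiset \<Rightarrow> bool" where
  "avoids_above v M \<longleftrightarrow> (\<forall>p B. p \<in># M \<and> v < p \<and> B \<subseteq># M \<and> \<Sum>\<^sub># B = p \<longrightarrow> v \<notin># B)"

lemma avoids_above_mono:
  assumes M: "avoids_above v M" and sub: "M' \<subseteq># M"
  shows "avoids_above v M'"
  unfolding avoids_above_def
proof (intro allI impI, elim conjE)
  fix p B assume p: "p \<in># M'" "v < p" "B \<subseteq># M'" "\<Sum>\<^sub># B = p"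
  have "p \<in># M" by (rule mset_subset_eqD[OF sub p(1)])
  moreover have "B \<subseteq># M" by (rule subset_mset.order_trans[OF p(3) sub])
  ultimately show "v \<notin># B" using M p(2,4) unfolding avoids_above_def by simp
qed

lemma subset_replicate_drop:
  assumes "C \<subseteq># replicate_mset k t + K" "t \<notin># C"
  shows "C \<subseteq># K"
proof (rule mset_subset_eqI)
  fix a
  show "count C a \<le> count K a"
    using mset_subset_eq_count[OF assms(1), of a] assms(2) by (cases "a = t") (auto simp: not_in_iff)
qed

lemma subset_add_mset_right: "A \<subseteq># B \<Longrightarrow> A \<subseteq># add_mset x B"
  by (rule mset_subset_eqI) (simp add: mset_subset_eq_count le_SucI)

lemma subset_union_disjoint:
  assumes "C \<subseteq># J + B" "C \<inter># J = {#}"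
  shows "C \<subseteq># B"
proof (rule mset_subset_eqI)
  fix a
  have "count (C \<inter># J) a = 0" using assms(2) by simp
  then show "count C a \<le> count B a"
    using mset_subset_eq_count[OF assms(1), of a] by (simp add: min_def split: if_splits)
qed

text \<open>A copy of \<open>t\<close> on the left can be expanded back into \<open>Iw\<close> as
  long as another copy stays behind to be the maximum \<open>q\<close>; a single copy on the left
  already fits into the old multiset, as \<open>m \<ge> 1\<close>. A copy of \<open>t\<close> on the
  right is itself the required sum.\<close>

lemma seq_mset_merge_top:
  assumes M: "seq_mset (replicate_mset m t + Iw + K)" and "\<Sum>\<^sub># Iw = t" "1 \<le> m" and lt: "\<And>x. x \<in># K \<Longrightarrow> x < t"
  shows "seq_mset (replicate_mset (Suc m) t + K)"
  unfolding seq_mset_def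
proof (intro allI impI, elim conjE)
  fix A B q assume A: "A \<subseteq># replicate_mset (Suc m) t + K" and B: "B \<subseteq># replicate_mset (Suc m) t + K"
    and eq: "\<Sum>\<^sub># A = \<Sum>\<^sub># B" and q: "q \<in># A" "\<forall>x\<in>#A + B. x \<le> q"
  note notop = subset_replicate_drop[of _ "Suc m" t K]
  have small: "C \<subseteq># replicate_mset m t + Iw + K" if "C \<subseteq># K" for C
    using that by (simp add: subset_mset.add_increasing)
  show "\<exists>B'. B' \<subseteq># B \<and> q = \<Sum>\<^sub># B'"
  proof (cases "q \<in># B")
    case True
    then show ?thesis by (intro exI[of _ "{#q#}"]) auto
  next
    case qB: False
    have qt: "q \<le> t" using q(1) A lt by (metis le_eq_less_or_eq in_replicate_mset mset_subset_eqD union_iff)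
    have tB: "t \<notin># B"
    proof
      assume "t \<in># B"
      then have "t \<le> q" using q(2) by auto
      then show False using qt qB \<open>t \<in># B\<close> by auto
    qed
    have B': "B \<subseteq># replicate_mset m t + Iw + K" by (rule small[OF notop[OF B tB]])
    have BA: "\<exists>B'. B' \<subseteq># B \<and> q = \<Sum>\<^sub># B'"
      if "A' \<subseteq># replicate_mset m t + Iw + K" "\<Sum>\<^sub># A' = \<Sum>\<^sub># B" "q \<in># A'" "\<forall>x\<in>#A'. x \<le> q" for A'
      using M[unfolded seq_mset_def, rule_format, of A' B q] that B' q(2) by auto
    show ?thesis
    proof (cases "t \<in># A")
      case False
      then show ?thesis using BA[of A] small[OF notop[OF A]] eq q by auto
    next
      case True
      then have "q = t" using qt q(2) by (auto intro: antisym)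
      obtain A0 where A0: "A = add_mset t A0" using True by (metis insert_DiffM)
      then have A0s: "A0 \<subseteq># replicate_mset m t + K" using A by simp
      show ?thesis
      proof (cases "t \<in># A0")
        case True
        define A1 where "A1 = A0 + Iw"
        have "A1 \<subseteq># replicate_mset m t + Iw + K"
          unfolding A1_def using subset_mset.add_right_mono[OF A0s, of Iw] by (simp add: union_ac)
        moreover have "\<Sum>\<^sub># A1 = \<Sum>\<^sub># B" using eq A0 assms(2) by (simp add: A1_def)
        moreover have "\<forall>x\<in>#A1. x \<le> q"
          using q(2) A0 assms(2) \<open>q = t\<close> by (auto simp: A1_def dest!: multi_member_split)
        ultimately show ?thesis using BA[of A1] True \<open>q = t\<close> by (simp add: A1_def)
      next
        case False
        have "A0 \<subseteq># K" by (rule subset_replicate_drop[OF A0s False])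
        then have "A \<subseteq># replicate_mset 1 t + K" using A0 by simp
        also have "\<dots> \<subseteq># replicate_mset m t + Iw + K"
        proof -
          have "replicate_mset 1 t \<subseteq># replicate_mset m t" using assms(3) by (simp add: subseteq_mset_def)
          then have "replicate_mset 1 t \<subseteq># replicate_mset m t + Iw" by (simp add: subset_mset.add_increasing2)
          then show ?thesis by (rule subset_mset.add_right_mono)
        qed
        finally show ?thesis using BA[of A] eq q by auto
      qed
    qed
  qed
qed

lemma seq_mset_merge_doubled:
  assumes M: "seq_mset (add_mset t (add_mset v (Jm + I0 + K)))" and t: "\<Sum>\<^sub># (add_mset v (Jm + I0)) = t"
    and v: "\<Sum>\<^sub># Jm = v" and pos: "0 \<notin># add_mset v (Jm + I0 + K)"
    and le: "\<And>x. x \<in># Jm + I0 \<Longrightarrow> x \<le> v" and lt: "\<And>x. x \<in># add_mset v (Jm + I0 + K) \<Longrightarrow> x < t"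
    and L: "\<And>B p. B \<subseteq># add_mset v (Jm + I0 + K) \<Longrightarrow> \<Sum>\<^sub># B = t \<Longrightarrow> p \<in># B \<Longrightarrow> p \<le> v"
  shows "seq_mset (add_mset v (add_mset v (I0 + K)))" "avoids_above v (add_mset v (add_mset v (I0 + K)))"
proof -
  let ?Iw = "add_mset v (Jm + I0)" and ?MT = "add_mset v (Jm + I0 + K)"
  let ?M1 = "add_mset v (add_mset v (I0 + K))"
  \<comment> \<open>With \<open>C\<close> the common part, \<open>B = C + B1\<close> and
    \<open>?Iw = C + I1\<close>, so \<open>t\<close> with \<open>B1\<close> and \<open>p\<close>
    with \<open>I1\<close> have equal sums. Sequentiality extracts \<open>t\<close> from the latter;
    by \<open>L\<close> this does not use \<open>p\<close>, so \<open>I1\<close> alone reaches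
    \<open>t\<close>, and \<open>C\<close> has sum 0.\<close>
  have star: "B \<inter># ?Iw = {#}" if p: "p \<in># ?MT" "v < p" and B: "B \<subseteq># ?MT" "\<Sum>\<^sub># B = p" for p B
  proof -
    define C where "C = B \<inter># ?Iw"
    obtain B1 where B1: "B = C + B1" unfolding C_def by (metis subset_mset.inf.cobounded1 subset_mset.le_iff_add)
    obtain I1 where I1: "?Iw = C + I1" unfolding C_def by (metis subset_mset.inf.cobounded2 subset_mset.le_iff_add)
    have pI: "p \<notin># ?Iw" using le[of p] p(2) by auto
    then have pK: "p \<in># K" using p(1) by auto
    have "I1 \<subseteq># ?Iw" unfolding I1 by simp
    then have "add_mset p I1 \<subseteq># ?Iw + K"
      using pK subset_mset.add_mono[of I1 ?Iw "{#p#}" K] by simp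
    then have s2: "add_mset p I1 \<subseteq># ?MT" by simp
    have "B1 \<subseteq># B" unfolding B1 by simp
    from subset_mset.order_trans[OF this B(1)] have s1: "add_mset t B1 \<subseteq># add_mset t ?MT"
      by (simp only: mset_subset_eq_add_mset_cancel)
    have eq: "\<Sum>\<^sub># (add_mset t B1) = \<Sum>\<^sub># (add_mset p I1)"
      using t B(2) unfolding I1 B1 by simp
    have s2': "add_mset p I1 \<subseteq># add_mset t ?MT" by (rule subset_add_mset_right[OF s2])
    have tle: "x \<le> t" if "x \<in># add_mset t ?MT" for x
    proof -
      from that have "x = t \<or> x \<in># ?MT" by (simp only: set_mset_add_mset_insert insert_iff)
      then show ?thesis using lt[of x] by auto
    qed
    obtain B' where B': "B' \<subseteq># add_mset p I1" "\<Sum>\<^sub># B' = t"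
    proof (rule seq_msetD[OF M s1 s2' eq, of t])
      show "x \<le> t" if "x \<in># add_mset t B1" for x
        by (rule tle[OF mset_subset_eqD[OF s1 that]])
      show "x \<le> t" if "x \<in># add_mset p I1" for x
        by (rule tle[OF mset_subset_eqD[OF s2' that]])
    qed auto
    have "p \<notin># B'" using L[OF subset_mset.order_trans[OF B'(1) s2] B'(2), of p] p(2) by auto
    then have "B' \<subseteq># I1" using B'(1) by (simp add: subset_add_mset_notin)
    then obtain I2 where "I1 = B' + I2" by (metis subset_mset.le_iff_add)
    then have "t \<le> \<Sum>\<^sub># I1" using B'(2) by simp
    moreover have "t = \<Sum>\<^sub># C + \<Sum>\<^sub># I1" using t unfolding I1 by simp
    ultimately have "\<Sum>\<^sub># C = 0" by simp
    moreover have "0 \<notin># C" using pos unfolding C_def by auto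
    ultimately have "C = {#}" by (metis multiset_nonemptyE sum_mset_0_iff)
    then show ?thesis by (simp add: C_def)
  qed
  have rest: "add_mset v (I0 + K) \<subseteq># ?MT" by (simp add: subset_mset.add_increasing union_ac)
  have vsub: "add_mset v C \<subseteq># ?MT" if "C \<subseteq># I0 + K" for C
    using that by (intro subset_mset.order_trans[OF _ rest]) simp
  show "avoids_above v ?M1"
    unfolding avoids_above_def
  proof (intro allI impI notI, elim conjE)
    fix p B assume p: "p \<in># ?M1" "v < p" and B: "B \<subseteq># ?M1" "\<Sum>\<^sub># B = p" and vB: "v \<in># B"
    have pT: "p \<in># ?MT" using p by auto
    obtain B0 where B0: "B = add_mset v B0" using vB by (metis insert_DiffM)
    have B0s: "B0 \<subseteq># add_mset v (I0 + K)" using B(1) B0 by simp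
    show False
    proof (cases "v \<in># B0")
      case True
      \<comment> \<open>One of the two copies of \<open>v\<close> is expanded into
        \<open>Jm\<close>. The other remains, and it also occurs in \<open>?Iw\<close>, against
        \<open>star\<close>.\<close>
      have "Jm + B0 \<subseteq># ?MT"
        using subset_mset.add_left_mono[OF B0s, of Jm] by (simp add: union_ac)
      moreover have "\<Sum>\<^sub># (Jm + B0) = p" using B(2) B0 v by simp
      ultimately have "(Jm + B0) \<inter># ?Iw = {#}" by (rule star[OF pT p(2)])
      moreover have "v \<in># (Jm + B0) \<inter># ?Iw" using True by simp
      ultimately show False by simp
    next
      case False
      have "B0 \<subseteq># I0 + K" by (rule subset_add_mset_notin[OF B0s False])
      then have "B \<subseteq># ?MT" unfolding B0 by (rule vsub)
      then have "B \<inter># ?Iw = {#}" by (rule star[OF pT p(2) _ B(2)])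
      moreover have "v \<in># B \<inter># ?Iw" using vB by simp
      ultimately show False by simp
    qed
  qed
  show "seq_mset ?M1"
    unfolding seq_mset_def
  proof (intro allI impI, elim conjE)
    fix A B q assume A: "A \<subseteq># ?M1" and B: "B \<subseteq># ?M1"
      and eq: "\<Sum>\<^sub># A = \<Sum>\<^sub># B" and q: "q \<in># A" "\<forall>x\<in>#A + B. x \<le> q"
    have MT: "?MT \<subseteq># add_mset t ?MT" by simp
    have seqT: "\<exists>B'. B' \<subseteq># B'' \<and> q = \<Sum>\<^sub># B'"
      if "A' \<subseteq># ?MT" "B'' \<subseteq># ?MT" "\<Sum>\<^sub># A' = \<Sum>\<^sub># B''" "q \<in># A'" "\<forall>x\<in>#A' + B''. x \<le> q" for A' B''
      using seq_mset_mono[OF M MT] that unfolding seq_mset_def by blast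
    have expand: "Jm + C0 \<subseteq># ?MT" if "add_mset v C0 \<subseteq># ?M1" for C0
    proof -
      have "C0 \<subseteq># add_mset v (I0 + K)" using that by simp
      from subset_mset.add_left_mono[OF this, of Jm] show ?thesis by (simp add: union_ac)
    qed
    have without: "C \<subseteq># ?MT" if "C \<subseteq># ?M1" "v \<notin># C" for C
      using that by (metis rest subset_add_mset_notin subset_mset.order_trans)
    show "\<exists>B'. B' \<subseteq># B \<and> q = \<Sum>\<^sub># B'"
    proof (cases "q \<in># B")
      case True
      then show ?thesis by (intro exI[of _ "{#q#}"]) auto
    next
      case qB: False
      consider "v \<in># A" "v \<in># B" | "v \<in># A" "v \<notin># B" | "v \<notin># A" "v \<in># B" | "v \<notin># A" "v \<notin># B" by blast
      then show ?thesis
      proof cases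
        case 1
        obtain A0 B0 where AB: "A = add_mset v A0" "B = add_mset v B0" using 1 by (metis insert_DiffM)
        have "A0 \<subseteq># add_mset v (I0 + K)" "B0 \<subseteq># add_mset v (I0 + K)" using A B AB by auto
        then have s: "A0 \<subseteq># ?MT" "B0 \<subseteq># ?MT" using subset_mset.order_trans[OF _ rest] by blast+
        have "q \<noteq> v" using qB 1 by auto
        then have "\<exists>B'. B' \<subseteq># B0 \<and> q = \<Sum>\<^sub># B'"
          by (intro seqT[OF s]) (use eq q AB in auto)
        then obtain B' where "B' \<subseteq># B0" "q = \<Sum>\<^sub># B'" by blast
        then show ?thesis using subset_add_mset_right[of B' B0 v] unfolding AB by blast
      next
        case 2
        obtain A0 where A0: "A = add_mset v A0" using 2 by (metis insert_DiffM)
        have BT: "B \<subseteq># ?MT" by (rule without[OF B 2(2)])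
        show ?thesis
        proof (cases "v \<in># A0")
          case True
          have "v \<le> q" using q(2) 2 by auto
          have "q \<in># A0" using q(1) A0 True by auto
          moreover have "x \<le> q" if "x \<in># Jm + A0 + B" for x
            using that q(2) A0 le[of x] \<open>v \<le> q\<close> by auto
          moreover have "\<Sum>\<^sub># (Jm + A0) = \<Sum>\<^sub># B" using eq A0 v by simp
          ultimately show ?thesis
            by (intro seqT[OF expand BT, of A0]) (use A A0 in auto)
        next
          case False
          have "A0 \<subseteq># add_mset v (I0 + K)" using A A0 by simp
          then have "A0 \<subseteq># I0 + K" by (rule subset_add_mset_notin[OF _ False])
          then have "A \<subseteq># ?MT" unfolding A0 by (rule vsub)
          then show ?thesis by (rule seqT[OF _ BT eq q])
        qed
      next
        case 3
        \<comment> \<open>The copy of \<open>v\<close> in \<open>B\<close> is expanded into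
          \<open>Jm\<close>. The summands found for \<open>q\<close>, which exceeds
          \<open>v\<close>, avoid \<open>Jm\<close> by \<open>star\<close> and therefore come from
          \<open>B\<close> itself.\<close>
        obtain B0 where B0: "B = add_mset v B0" using 3 by (metis insert_DiffM)
        have AT: "A \<subseteq># ?MT" by (rule without[OF A 3(1)])
        have "v \<le> q" "v \<noteq> q" using q(2) 3 qB by auto
        then have vq: "v < q" by simp
        have B1: "Jm + B0 \<subseteq># ?MT" using expand B B0 by simp
        have "\<Sum>\<^sub># A = \<Sum>\<^sub># (Jm + B0)" using eq B0 v by simp
        moreover have "x \<le> q" if "x \<in># A + (Jm + B0)" for x
          using that q(2) B0 le[of x] vq by auto
        ultimately have "\<exists>B'. B' \<subseteq># Jm + B0 \<and> q = \<Sum>\<^sub># B'"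
          by (intro seqT[OF AT B1 _ q(1)]) auto
        then obtain B' where B': "B' \<subseteq># Jm + B0" "q = \<Sum>\<^sub># B'" by blast
        have "q \<in># ?MT" using AT q(1) by (rule mset_subset_eqD)
        then have dis: "B' \<inter># ?Iw = {#}"
          by (rule star[OF _ vq subset_mset.order_trans[OF B'(1) B1] B'(2)[symmetric]])
        have "B' \<inter># Jm = {#}"
        proof -
          have "B' \<inter># Jm \<subseteq># B' \<inter># ?Iw" by (intro subset_mset.inf_mono) (auto simp: subset_mset.add_increasing2)
          then show ?thesis using dis by simp
        qed
        then have "B' \<subseteq># B0"
          by (rule subset_union_disjoint[OF B'(1)])
        then show ?thesis using B'(2) subset_add_mset_right[of B' B0 v] unfolding B0 by blast
      next
        case 4
        show ?thesis by (rule seqT[OF without[OF A 4(1)] without[OF B 4(2)] eq q])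
      qed
    qed
  qed
qed

section \<open>Values of a resonance functor\<close>

definition block_weight :: "nat set list \<Rightarrow> (nat \<Rightarrow> nat) \<Rightarrow> nat \<Rightarrow> nat" where
  "block_weight p w j = sum w (p ! (j - 1))"

lemma pull_obj_weight_cut:
  "p \<in> ord_parts n \<Longrightarrow> pull_obj p (weight_cut n w) = (length p, weight_cut (length p) (block_weight p w))"
  using pull_weight_cut[of p n w] unfolding pull_obj_def block_weight_def[abs_def] by simp

lemma ord_parts_block:
  assumes "p \<in> ord_parts n" "j \<in> {1..length p}"
  shows "p ! (j - 1) \<subseteq> {1..n}" "p ! (j - 1) \<noteq> {}"
proof -
  have "p ! (j - 1) \<in> set p" using assms(2) by (intro nth_mem) auto
  then show "p ! (j - 1) \<subseteq> {1..n}" "p ! (j - 1) \<noteq> {}"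
    using assms(1) parts_block by (auto simp: ord_parts_def)
qed

lemma block_weight_pos:
  assumes "p \<in> ord_parts n" "\<And>i. i \<in> {1..n} \<Longrightarrow> 0 < w i" "j \<in> {1..length p}"
  shows "0 < block_weight p w j"
  unfolding block_weight_def
  using ord_parts_block[OF assms(1,3)] assms(2) finite_subset[OF _ finite_atLeastAtMost]
  by (intro sum_pos; blast)

lemma ord_parts_length:
  assumes "p \<in> ord_parts n" "1 \<le> n"
  shows "1 \<le> length p"
proof (rule ccontr)
  assume "\<not> 1 \<le> length p"
  then have "set p = {}" by (cases p) auto
  then have "{1..n} = {}" using assms(1) by (auto simp: ord_parts_def parts_def partition_on_def)
  then show False using assms(2) by simp
qed

lemma ord_parts_exists:
  assumes "P \<in> parts n"
  obtains p where "p \<in> ord_parts n" "set p = P"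
  using finite_distinct_list[OF parts_finite[OF assms]] assms that by (auto simp: ord_parts_def)

lemma image_mset_shift: "image_mset (\<lambda>j. f (j - 1)) (mset_set {1..k}) = image_mset f (mset_set {0..<k})" for k :: nat
proof -
  have "mset_set {1..k} = image_mset Suc (mset_set {0..<k})"
    by (subst image_mset_mset_set) (auto simp: image_Suc_atLeastLessThan atLeastLessThanSuc_atLeastAtMost)
  then show ?thesis by (simp add: image_mset.compositionality o_def)
qed

lemma weight_mset_block_weight:
  assumes "p \<in> ord_parts n"
  shows "weight_mset (block_weight p w) {1..length p} = image_mset (sum w) (mset_set (set p))"
proof -
  have "mset p = image_mset (nth p) (mset_set {0..<length p})"
    by (metis map_nth mset_map mset_upt)
  moreover have "mset p = mset_set (set p)"
    using assms by (simp add: ord_parts_def mset_set_set)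
  ultimately have "image_mset (sum w) (mset_set (set p)) = image_mset (\<lambda>j. sum w (p ! j)) (mset_set {0..<length p})"
    by (simp add: image_mset.compositionality o_def)
  then show ?thesis
    unfolding block_weight_def using image_mset_shift[of "\<lambda>j. sum w (p ! j)" "length p"] by simp
qed

lemma weight_mset_block_partition:
  "image_mset (sum w) (mset_set (block_partition n I)) = add_mset (sum w I) (weight_mset w ({1..n} - I))"
proof -
  have "I \<notin> (\<lambda>i. {i}) ` ({1..n} - I)" by auto
  moreover have "mset_set ((\<lambda>i. {i}) ` ({1..n} - I)) = image_mset (\<lambda>i. {i}) (mset_set ({1..n} - I))"
    by (rule image_mset_mset_set[symmetric]) auto
  ultimately show ?thesis
    by (simp add: block_partition_def image_mset.compositionality o_def)
qed

lemma weight_mset_diff: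
  assumes "I \<subseteq> V" "finite V"
  shows "weight_mset w V = weight_mset w I + weight_mset w (V - I)"
proof -
  have "mset_set V = mset_set I + mset_set (V - I)"
    using assms by (metis Diff_disjoint Diff_partition finite_Diff finite_subset mset_set_Union)
  then show ?thesis by simp
qed

lemma weight_mset_top:
  assumes "top_form N m w t"
  shows "weight_mset w {1..N + m} = replicate_mset m t + weight_mset w {1..N}"
proof -
  have "weight_mset w {1..N + m} = weight_mset w {1..N} + weight_mset w ({1..N + m} - {1..N})"
    by (rule weight_mset_diff) auto
  moreover have "{1..N + m} - {1..N} = {N+1..N+m}" by auto
  moreover have "weight_mset w {N+1..N+m} = image_mset (\<lambda>_. t) (mset_set {N+1..N+m})"
    by (rule image_mset_cong) (use top_formD(5)[OF assms] in auto)
  ultimately show ?thesis by (simp add: image_mset_const_eq union_ac)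
qed

lemma top_form_exists:
  assumes "0 \<notin># M" "t \<in># M" "\<And>x. x \<in># M \<Longrightarrow> x \<le> t"
  obtains N m w where "top_form N m w t" "weight_mset w {1..N + m} = M" "m = count M t"
proof -
  obtain xs where xs: "mset xs = filter_mset (\<lambda>x. x \<noteq> t) M" using ex_mset by blast
  define w where "w i = (if i \<le> length xs then xs ! (i - 1) else t)" for i
  let ?N = "length xs" and ?m = "count M t"
  have xs_mem: "xs ! (i - 1) \<in># M \<and> xs ! (i - 1) \<noteq> t" if "i \<in> {1..?N}" for i
  proof -
    have "i - 1 < length xs" using that by auto
    then have "xs ! (i - 1) \<in># mset xs" by simp
    then show ?thesis unfolding xs by simp
  qed
  have "0 < t" using assms(1,2) by (metis gr0I)
  moreover have "0 < w i \<and> w i < t" if "i \<in> {1..?N}" for i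
    using xs_mem[OF that] assms(1,3) that by (auto simp: w_def le_neq_implies_less intro: gr0I)
  moreover have "1 \<le> ?m" using assms(2) by (simp add: Suc_le_eq)
  ultimately have T: "top_form ?N ?m w t"
    by (auto simp: top_form_def w_def)
  have "weight_mset w {1..?N} = image_mset (\<lambda>j. xs ! (j - 1)) (mset_set {1..?N})"
    by (rule image_mset_cong) (auto simp: w_def)
  also have "\<dots> = mset xs"
    unfolding image_mset_shift by (metis map_nth mset_map mset_upt)
  finally have "weight_mset w {1..?N + ?m} = replicate_mset ?m t + filter_mset (\<lambda>x. x \<noteq> t) M"
    using weight_mset_top[OF T] xs by simp
  also have "\<dots> = M" by (rule multiset_eqI) auto
  finally show thesis using that[OF T] by simp
qed

lemma weight_cut_const:
  assumes "0 < t" "\<And>i. i \<in> {1..k} \<Longrightarrow> w i = t"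
  shows "weight_cut k w = weight_cut k (\<lambda>_. 1)"
proof -
  have "(\<Sum>i=1..k. x i * int (w i)) = int t * (\<Sum>i=1..k. x i * int 1)" for x :: tvec
    unfolding sum_distrib_left by (rule sum.cong) (use assms in auto)
  then show ?thesis using assms(1) by (auto simp: weight_cut_def)
qed

text \<open>A permutation of the coordinates as a morphism: an ordered partition into singletons,
  listed in the order given by \<open>\<sigma>\<close>.\<close>

definition single_blocks :: "nat \<Rightarrow> (nat \<Rightarrow> nat) \<Rightarrow> nat set list" where
  "single_blocks k \<sigma> = map (\<lambda>i. {\<sigma> i}) [1..<Suc k]"

lemma single_blocks_nth: "j \<in> {1..k} \<Longrightarrow> single_blocks k \<sigma> ! (j - 1) = {\<sigma> j}"
  by (auto simp: single_blocks_def simp del: upt_Suc)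

lemma length_single_blocks [simp]: "length (single_blocks k \<sigma>) = k"
  by (simp add: single_blocks_def)

lemma single_blocks_ord_parts:
  assumes "\<sigma> permutes {1..k}"
  shows "single_blocks k \<sigma> \<in> ord_parts k"
proof -
  have inj: "inj_on \<sigma> {1..k}" using permutes_inj_on[OF assms] .
  have set: "set (single_blocks k \<sigma>) = (\<lambda>i. {i}) ` {1..k}"
  proof -
    have "set (single_blocks k \<sigma>) = (\<lambda>i. {i}) ` \<sigma> ` {1..k}"
      by (simp add: single_blocks_def image_image atLeastLessThanSuc_atLeastAtMost del: upt_Suc)
    then show ?thesis using permutes_image[OF assms] by simp
  qed
  have "set [1..<Suc k] = {1..k}" by auto
  then have "inj_on (\<lambda>i. {\<sigma> i}) (set [1..<Suc k])"
    using inj by (simp only: inj_on_def singleton_inject) blast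
  then have "distinct (single_blocks k \<sigma>)"
    unfolding single_blocks_def by (simp add: distinct_map del: upt_Suc)
  then show ?thesis
    unfolding ord_parts_def parts_def set using partition_on_singletons[of "{1..k}"] set by simp
qed

lemma comp_single_blocks:
  assumes "\<sigma> permutes {1..k}"
  shows "comp_part (single_blocks k \<sigma>) (single_blocks k \<tau>) = single_blocks k (\<tau> \<circ> \<sigma>)"
proof -
  have "(\<Union>j\<in>{\<sigma> i}. single_blocks k \<tau> ! (j - 1)) = {(\<tau> \<circ> \<sigma>) i}" if "i \<in> {1..k}" for i
    using single_blocks_nth[of "\<sigma> i" k \<tau>] permutes_in_image[OF assms, of i] that by simp
  then show ?thesis
    unfolding comp_part_def
    by (subst (1 3) single_blocks_def) (auto simp: atLeastLessThanSuc_atLeastAtMost simp del: upt_Suc)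
qed

lemma single_blocks_id: "single_blocks k id = id_part k"
  by (simp add: single_blocks_def id_part_def)

context
  fixes Fo :: "cut \<Rightarrow> 'a pspace" and Fm :: "cut \<Rightarrow> cut \<Rightarrow> nat set list \<Rightarrow> 'a \<Rightarrow> 'a"
  assumes RF: "resonance_functor Fo Fm"
begin

lemma res_obj_weight_cut:
  assumes "1 \<le> k" "\<And>i. i \<in> {1..k} \<Longrightarrow> 0 < w i"
  shows "res_obj (k, weight_cut k w)"
  using assms weight_cut_in_cuts[of k w] by (simp add: res_obj_def)

lemma is_pspace_Fpart:
  assumes "1 \<le> k" "\<And>i. i \<in> {1..k} \<Longrightarrow> 0 < w i"
  shows "is_pspace (Fpart Fo k w)"
  using RF res_obj_weight_cut[OF assms] by (simp add: resonance_functor_def res_functor_def Fpart_def)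

lemma Fpart_cong: "weight_cut k w = weight_cut k w' \<Longrightarrow> Fpart Fo k w = Fpart Fo k w'"
  by (simp add: Fpart_def)

lemma Fpart_pointed_map:
  assumes "res_mor (k, weight_cut k w) (k', weight_cut k' w') p"
  shows "pointed_map (Fpart Fo k w) (Fpart Fo k' w') (Fm (k, weight_cut k w) (k', weight_cut k' w') p)"
  using RF assms by (simp add: resonance_functor_def res_functor_def Fpart_def)

text \<open>A permutation that matches the weights and its inverse give two morphisms whose
  composites are identities. The value thus depends only on the multiset of parts.\<close>

lemma Fpart_homeo:
  assumes k: "1 \<le> k" and w: "\<And>i. i \<in> {1..k} \<Longrightarrow> 0 < w i" and k': "1 \<le> k'" and w': "\<And>i. i \<in> {1..k'} \<Longrightarrow> 0 < w' i"
    and eq: "weight_mset w {1..k} = weight_mset w' {1..k'}"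
  shows "\<exists>h. pointed_homeo (Fpart Fo k w) (Fpart Fo k' w') h"
proof -
  have kk: "k' = k" using arg_cong[OF eq, of size] by simp
  obtain \<sigma> where \<sigma>: "\<sigma> permutes {1..k}" "\<forall>x\<in>{1..k}. w x = w' (\<sigma> x)"
    by (rule image_mset_eq_implies_permutes[OF finite_atLeastAtMost eq[unfolded kk]]) blast
  have \<sigma>': "inv \<sigma> permutes {1..k}" by (rule permutes_inv[OF \<sigma>(1)])
  have w2: "w' x = w (inv \<sigma> x)" if "x \<in> {1..k}" for x
    using \<sigma>(2) permutes_in_image[OF \<sigma>', of x] that permutes_inverses(1)[OF \<sigma>(1), of x] by metis
  let ?p = "single_blocks k \<sigma>" and ?q = "single_blocks k (inv \<sigma>)"
  let ?a = "(k, weight_cut k w)" and ?b = "(k, weight_cut k w')"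
  have a: "res_obj ?a" by (rule res_obj_weight_cut[OF k w])
  have b: "res_obj ?b" by (rule res_obj_weight_cut[OF k w'[unfolded kk]])
  have pull: "pull (single_blocks k \<rho>) (weight_cut k u) = weight_cut k v"
    if "\<rho> permutes {1..k}" "\<And>x. x \<in> {1..k} \<Longrightarrow> v x = u (\<rho> x)" for \<rho> u v
    unfolding pull_weight_cut[OF single_blocks_ord_parts[OF that(1)]] length_single_blocks
  proof (rule weight_cut_cong)
    fix j assume j: "j \<in> {1..k}"
    then show "sum u (single_blocks k \<rho> ! (j - 1)) = v j"
      unfolding single_blocks_nth[OF j] using that(2)[OF j] by simp
  qed
  have p: "res_mor ?a ?b ?p"
    unfolding res_mor_def using a b single_blocks_ord_parts[OF \<sigma>(1)] pull[OF \<sigma>(1), of w w'] \<sigma>(2) by simp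
  have q: "res_mor ?b ?a ?q"
    unfolding res_mor_def using a b single_blocks_ord_parts[OF \<sigma>'] pull[OF \<sigma>', of w' w] w2 by simp
  have rf: "res_functor Fo Fm" using RF by (simp only: resonance_functor_def)
  note fcomp = rf[unfolded res_functor_def, THEN conjunct2, THEN conjunct2, THEN conjunct2, rule_format, OF conjI]
  note ident = rf[unfolded res_functor_def, THEN conjunct2, THEN conjunct2, THEN conjunct1, rule_format]
  have pq: "comp_part ?p ?q = id_part k" "comp_part ?q ?p = id_part k"
    using comp_single_blocks[OF \<sigma>(1), of "inv \<sigma>"] comp_single_blocks[OF \<sigma>', of \<sigma>]
      permutes_inv_o[OF \<sigma>(1)] single_blocks_id by simp_all
  have "pointed_homeo (Fpart Fo k w) (Fpart Fo k w') (Fm ?a ?b ?p)"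
  proof (rule pointed_homeoI)
    show "pointed_map (Fpart Fo k w) (Fpart Fo k w') (Fm ?a ?b ?p)" by (rule Fpart_pointed_map[OF p])
    show "pointed_map (Fpart Fo k w') (Fpart Fo k w) (Fm ?b ?a ?q)" by (rule Fpart_pointed_map[OF q])
    show "Fm ?b ?a ?q (Fm ?a ?b ?p x) = x" if "x \<in> topspace (fst (Fpart Fo k w))" for x
      using fcomp[OF p q, of x] ident[OF a, of x] that by (simp add: pq Fpart_def)
    show "Fm ?a ?b ?p (Fm ?b ?a ?q x) = x" if "x \<in> topspace (fst (Fpart Fo k w'))" for x
      using fcomp[OF q p, of x] ident[OF b, of x] that by (simp add: pq Fpart_def)
  qed
  then show ?thesis unfolding kk by blast
qed

lemma Fpart_equiv:
  assumes "1 \<le> k" "\<And>i. i \<in> {1..k} \<Longrightarrow> 0 < w i" "1 \<le> k'" "\<And>i. i \<in> {1..k'} \<Longrightarrow> 0 < w' i"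
    and "weight_mset w {1..k} = weight_mset w' {1..k'}"
  shows "Fpart Fo k w \<simeq>\<^sub>* Fpart Fo k' w'"
proof -
  have X: "is_pspace (Fpart Fo k w)" by (rule is_pspace_Fpart[OF assms(1,2)])
  have Y: "is_pspace (Fpart Fo k' w')" by (rule is_pspace_Fpart[OF assms(3,4)])
  have "\<exists>h. pointed_homeo (Fpart Fo k w) (Fpart Fo k' w') h" by (rule Fpart_homeo[OF assms])
  then show ?thesis using pointed_homeo_imp_equiv[OF _ X Y] by blast
qed

lemma Fpart_contractible_mset:
  assumes "pointed_contractible (Fpart Fo k w)" "1 \<le> k" "\<And>i. i \<in> {1..k} \<Longrightarrow> 0 < w i"
    and "weight_mset w {1..k} = weight_mset w' {1..k'}"
  shows "pointed_contractible (Fpart Fo k' w')"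
proof -
  have kk: "k' = k" using arg_cong[OF assms(4), of size] by simp
  have "0 < w' i" if "i \<in> {1..k'}" for i
  proof -
    have "w' i \<in># weight_mset w' {1..k'}" using that by simp
    then have "w' i \<in># weight_mset w {1..k}" unfolding assms(4) .
    then show ?thesis using assms(3) by auto
  qed
  then have "Fpart Fo k' w' \<simeq>\<^sub>* Fpart Fo k w"
    by (intro Fpart_equiv) (use assms(2-4) kk in auto)
  then show ?thesis using pointed_contractible_equiv assms(1) by blast
qed

lemma inclusion_axiom:
  assumes "1 \<le> n" "\<And>i. i \<in> {1..n} \<Longrightarrow> 0 < w i" "p \<in> ord_parts n"
  shows "inclusion_map (Fpart Fo (length p) (block_weight p w)) (Fpart Fo n w)
      (Fm (pull_obj p (weight_cut n w)) (n, weight_cut n w) p)"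
    and "pquot (Fpart Fo n w) (mor_image Fo Fm n (weight_cut n w) p) \<simeq>\<^sub>*
      FQ Fo Fm n (weight_cut n w) (down n (set p) (weight_cut n w))"
proof -
  have A1: "\<forall>n\<ge>1. \<forall>S\<in>cuts n. \<forall>p\<in>ord_parts n.
        inclusion_map (Fo (pull_obj p S)) (Fo (n, S)) (Fm (pull_obj p S) (n, S) p) \<and>
        pquot (Fo (n, S)) (mor_image Fo Fm n S p) \<simeq>\<^sub>* FQ Fo Fm n S (down n (set p) S)"
    using RF unfolding resonance_functor_def by blast
  have S: "weight_cut n w \<in> cuts n" by (rule weight_cut_in_cuts[OF assms(2)])
  note A = A1[rule_format, OF assms(1) S assms(3)]
  show "inclusion_map (Fpart Fo (length p) (block_weight p w)) (Fpart Fo n w)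
      (Fm (pull_obj p (weight_cut n w)) (n, weight_cut n w) p)"
    using A pull_obj_weight_cut[OF assms(3), of w] by (simp add: Fpart_def)
  show "pquot (Fpart Fo n w) (mor_image Fo Fm n (weight_cut n w) p) \<simeq>\<^sub>*
      FQ Fo Fm n (weight_cut n w) (down n (set p) (weight_cut n w))"
    using A by (simp add: Fpart_def)
qed

lemma mor_image_eq:
  assumes "p \<in> ord_parts n"
  shows "mor_image Fo Fm n (weight_cut n w) p =
    Fm (pull_obj p (weight_cut n w)) (n, weight_cut n w) p ` topspace (fst (Fpart Fo (length p) (block_weight p w)))"
  using pull_obj_weight_cut[OF assms, of w] by (simp add: mor_image_def Fpart_def)

lemma collapse_to_FQ:
  assumes n: "1 \<le> n" and w: "\<And>i. i \<in> {1..n} \<Longrightarrow> 0 < w i" and p: "p \<in> ord_parts n"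
    and c: "pointed_contractible (Fpart Fo (length p) (block_weight p w))"
  shows "Fpart Fo n w \<simeq>\<^sub>* FQ Fo Fm n (weight_cut n w) (down n (set p) (weight_cut n w))"
proof -
  have A: "is_pspace (Fpart Fo (length p) (block_weight p w))"
    by (rule is_pspace_Fpart[OF ord_parts_length[OF p n] block_weight_pos[OF p w]])
  have X: "is_pspace (Fpart Fo n w)" by (rule is_pspace_Fpart[OF n w])
  have i: "inclusion_map (Fpart Fo (length p) (block_weight p w)) (Fpart Fo n w)
      (Fm (pull_obj p (weight_cut n w)) (n, weight_cut n w) p)"
    by (rule inclusion_axiom(1)[OF n w p])
  have "pquot (Fpart Fo n w) (mor_image Fo Fm n (weight_cut n w) p) \<simeq>\<^sub>*
      FQ Fo Fm n (weight_cut n w) (down n (set p) (weight_cut n w))"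
    by (rule inclusion_axiom(2)[OF n w p])
  with collapse_contractible[OF A X i c] show ?thesis
    unfolding mor_image_eq[OF p] by (rule pointed_equiv_trans)
qed

lemma FQ_empty: "FQ Fo Fm n S {} = Fo (n, S)"
  by (simp add: FQ_def pquot_empty)

lemma is_pspace_FQ:
  assumes "1 \<le> n" "S \<in> cuts n"
  shows "is_pspace (FQ Fo Fm n S PP)"
proof -
  have "is_pspace (Fo (n, S))"
    using RF assms by (simp add: resonance_functor_def res_functor_def res_obj_def)
  then show ?thesis unfolding FQ_def by (rule is_pspace_pquot)
qed

text \<open>The smash axiom speaks of values over the span of the remaining vectors. Axiom (A2),
  applied to two presentations of one and the same pair, compares them with values over
  \<open>S\<close>.\<close>

lemma FQ_equiv_Frel:
  assumes "1 \<le> n" "S \<in> cuts n" "down_closed n S PP"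
  shows "FQ Fo Fm n S PP \<simeq>\<^sub>* Frel Fo Fm n (cut_diff S PP) PP"
proof -
  have A2: "\<forall>n\<ge>1. \<forall>S\<in>cuts n. \<forall>T\<in>cuts n. \<forall>PP LL.
        down_closed n S PP \<and> down_closed n T LL \<and> cut_orbit n (Q S PP) = cut_orbit n (Q T LL) \<longrightarrow>
        FQ Fo Fm n S PP \<simeq>\<^sub>* FQ Fo Fm n T LL"
    using RF unfolding resonance_functor_def by blast
  note r = rel_cut_diff[OF assms(2,3)]
  show ?thesis
    unfolding Frel_def
    by (rule A2[rule_format, OF assms(1,2) r(2)]) (use assms(3) r(3,4) in simp)
qed

lemma down_closed_empty: "down_closed n S {}"
  by (simp add: down_closed_def)

text \<open>The second factor carries no set partitions, so only the partitions coming from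
  \<open>PP\<close>, extended arbitrarily over the last coordinates, remain in the product. The
  values are moved to relative cuts, smashed there and moved back.\<close>

lemma FQ_prod:
  assumes N: "1 \<le> N" and m: "1 \<le> m" and w: "\<And>i. i \<in> {1..N + m} \<Longrightarrow> 0 < w i"
    and PP: "down_closed N (weight_cut N w) PP"
    and PP': "down_closed (N + m) (weight_cut (N + m) w) (part_prod N PP m (parts m))"
    and eq: "cut_diff (weight_cut (N + m) w) (part_prod N PP m (parts m)) =
      cut_prod N (cut_diff (weight_cut N w) PP) m (weight_cut m (\<lambda>_. 1))"
  shows "FQ Fo Fm (N + m) (weight_cut (N + m) w) (part_prod N PP m (parts m)) \<simeq>\<^sub>*
    FQ Fo Fm N (weight_cut N w) PP \<and>\<^sub>* Fpart Fo m (\<lambda>_. 1)"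
proof -
  let ?S = "weight_cut (N + m) w" and ?T = "weight_cut N w" and ?U = "weight_cut m (\<lambda>_. 1)"
  have A3: "\<forall>n\<ge>1. \<forall>m\<ge>1. \<forall>S T PP LL. rel_cut n S PP \<and> rel_cut m T LL \<longrightarrow>
        Frel Fo Fm n S PP \<and>\<^sub>* Frel Fo Fm m T LL \<simeq>\<^sub>*
        Frel Fo Fm (n + m) (cut_prod n S m T) (part_prod n PP m (parts m) \<union> part_prod n (parts n) m LL)"
    using RF unfolding resonance_functor_def by blast
  have S: "?S \<in> cuts (N + m)" by (rule weight_cut_in_cuts[OF w])
  have T: "?T \<in> cuts N" by (rule weight_cut_in_cuts) (use w in simp)
  have U: "?U \<in> cuts m" by (rule weight_cut_in_cuts) simp
  have rT: "rel_cut N (cut_diff ?T PP) PP" by (rule rel_cut_diff(1)[OF T PP])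
  have rU: "rel_cut m ?U {}" using rel_cut_diff(1)[OF U down_closed_empty] by (simp add: cut_diff_empty)
  have FU: "Frel Fo Fm m ?U {} = Fpart Fo m (\<lambda>_. 1)"
    using U by (simp add: Frel_def FQ_empty Fpart_def cuts_def)
  have l: "lspan N (cut_diff ?T PP) \<in> cuts N" by (rule rel_cut_diff(2)[OF T PP])
  have 1: "FQ Fo Fm (N + m) ?S (part_prod N PP m (parts m)) \<simeq>\<^sub>*
      Frel Fo Fm (N + m) (cut_prod N (cut_diff ?T PP) m ?U) (part_prod N PP m (parts m))"
    using FQ_equiv_Frel[OF _ S PP'] m unfolding eq by simp
  have 2: "Frel Fo Fm N (cut_diff ?T PP) PP \<and>\<^sub>* Fpart Fo m (\<lambda>_. 1) \<simeq>\<^sub>*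
      Frel Fo Fm (N + m) (cut_prod N (cut_diff ?T PP) m ?U) (part_prod N PP m (parts m))"
    using A3[rule_format, OF N m conjI[OF rT rU]] by (simp only: FU part_prod_empty_right Un_empty_right)
  have 3: "FQ Fo Fm N ?T PP \<and>\<^sub>* Fpart Fo m (\<lambda>_. 1) \<simeq>\<^sub>* Frel Fo Fm N (cut_diff ?T PP) PP \<and>\<^sub>* Fpart Fo m (\<lambda>_. 1)"
    by (rule smash_equiv[OF FQ_equiv_Frel[OF N T PP] pointed_equiv_refl])
      (use N m T l in \<open>auto simp: Frel_def intro!: is_pspace_FQ is_pspace_Fpart\<close>)
  show ?thesis
    by (rule pointed_equiv_trans[OF 1 pointed_equiv_sym[OF pointed_equiv_trans[OF 3 2]]])
qed

text \<open>The case without set partitions: by \<open>H\<close> the cut is already the product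
  cut.\<close>

lemma Fpart_split:
  assumes N: "1 \<le> N" and m: "1 \<le> m" and w: "\<And>i. i \<in> {1..N + m} \<Longrightarrow> 0 < w i"
    and t: "0 < t" "\<And>i. i \<in> {N+1..N+m} \<Longrightarrow> w i = t"
    and H: "\<And>x. x \<in> weight_cut (N + m) w \<Longrightarrow> (\<Sum>i\<in>{N+1..N+m}. x i) = 0"
  shows "Fpart Fo (N + m) w \<simeq>\<^sub>* Fpart Fo N w \<and>\<^sub>* Fpart Fo m (\<lambda>_. 1)"
proof -
  have "cut_diff (weight_cut (N + m) w) (part_prod N {} m (parts m)) =
      cut_prod N (cut_diff (weight_cut N w) {}) m (weight_cut m (\<lambda>_. 1))"
    by (rule cut_diff_prod[OF t]) (use H in auto)
  from FQ_prod[OF N m w down_closed_empty _ this] show ?thesis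
    by (simp add: part_prod_empty_left down_closed_empty FQ_empty Fpart_def)
qed

lemma FQ_split:
  assumes T: "top_form N m w t" and M: "seq_mset (weight_mset w {1..N+m})"
    and I: "I \<subseteq> {1..N}" "sum w I = t" "irreducible_sum N w I"
  shows "FQ Fo Fm (N + m) (weight_cut (N + m) w) (down (N + m) (block_partition (N + m) I) (weight_cut (N + m) w)) \<simeq>\<^sub>*
    FQ Fo Fm N (weight_cut N w) (down N (block_partition N I) (weight_cut N w)) \<and>\<^sub>* Fpart Fo m (\<lambda>_. 1)"
proof -
  let ?D = "down N (block_partition N I) (weight_cut N w)"
  let ?D' = "down (N + m) (block_partition (N + m) I) (weight_cut (N + m) w)"
  have I2: "2 \<le> card I" by (rule top_form_sum_card[OF T I(1,2)])
  then have Ine: "I \<noteq> {}" by auto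
  have N: "1 \<le> N" using Ine I(1) by (cases N) auto
  have I': "I \<subseteq> {1..N + m}" using I(1) by auto
  have prod: "?D' = part_prod N ?D m (parts m)"
  proof (rule down_block_prod[OF Ine I(1)])
    show "0 < w i" if "i \<in> {1..N + m}" for i by (rule top_formD(6)[OF T that])
    show "\<exists>J\<subseteq>X. sum (item_weight w I) J = w (Suc k)"
      if "N \<le> k" "k < N + m" "X \<subseteq> block_items k I" "Y \<subseteq> {1..Suc k}" "Suc k \<in> Y"
        "sum (item_weight w I) X = sum w Y" for k X Y
      by (rule seq_item_sum[OF T M I(1,2) that])
  qed
  have Ppos: "block_partition N I \<in> parts N" "block_partition (N + m) I \<in> parts (N + m)"
    using block_partition_in_parts[OF Ine] I(1) I' by auto
  have "cut_diff (weight_cut (N + m) w) (part_prod N ?D m (parts m)) =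
      cut_prod N (cut_diff (weight_cut N w) ?D) m (weight_cut m (\<lambda>_. 1))"
  proof (rule cut_diff_prod[OF top_formD(2)[OF T] top_formD(5)[OF T]])
    show "?D \<subseteq> parts N" by (auto simp: down_def)
    fix x assume x: "x \<in> weight_cut (N + m) w" "(\<Sum>i\<in>{N+1..N+m}. x i) \<noteq> 0"
    obtain J where J: "J \<subseteq> {1..N}" "sum w J = t" "\<forall>i\<in>J. \<forall>j\<in>J. x i = x j \<and> x i \<noteq> 0"
      using seq_top_sum[OF T M x] by blast
    \<comment> \<open>\<open>J\<close> is the only block with two different elements, and there
      \<open>x\<close> is constant and nonzero.\<close>
    have "x i = x j \<and> x i \<noteq> 0" if "B \<in> block_partition (N + m) J" "i \<in> B" "j \<in> B" "i \<noteq> j" for B i j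
    proof -
      have "B = J" using that by (auto simp: block_partition_def)
      then show ?thesis using J(3) that by blast
    qed
    then have "x \<in> cut_at (weight_cut (N + m) w) (block_partition (N + m) J)"
      unfolding cut_at_def using x(1) by blast
    moreover have "block_partition (N + m) J \<in> part_prod N ?D m (parts m)"
      unfolding prod[symmetric] by (rule block_in_down[OF T M I J(1,2)])
    ultimately show "\<exists>P\<in>part_prod N ?D m (parts m). x \<in> cut_at (weight_cut (N + m) w) P" by blast
  qed
  moreover have "down_closed (N + m) (weight_cut (N + m) w) (part_prod N ?D m (parts m))"
    using down_closed_down[OF Ppos(2), of "weight_cut (N + m) w"] unfolding prod .
  ultimately show ?thesis
    unfolding prod by (intro FQ_prod[OF N top_formD(1)[OF T]] top_formD(6)[OF T] down_closed_down[OF Ppos(1)])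
qed

end

lemma zero_notin_weight_mset:
  assumes "\<And>i. i \<in> V \<Longrightarrow> 0 < w i" "finite V"
  shows "0 \<notin># weight_mset w V"
proof
  assume "0 \<in># weight_mset w V"
  then obtain i where "i \<in> V" "w i = 0" using assms(2) by auto
  then show False using assms(1)[of i] by simp
qed

lemma weight_mset_remove_block:
  assumes T: "top_form N m w t" and I: "I \<subseteq> {1..N}"
  shows "weight_mset w ({1..N + m} - I) = replicate_mset m t + weight_mset w ({1..N} - I)"
proof -
  have "weight_mset w I + weight_mset w ({1..N + m} - I) = weight_mset w {1..N + m}"
    by (rule weight_mset_diff[symmetric]) (use I in auto)
  also have "\<dots> = replicate_mset m t + weight_mset w {1..N}" by (rule weight_mset_top[OF T])
  also have "weight_mset w {1..N} = weight_mset w I + weight_mset w ({1..N} - I)"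
    by (rule weight_mset_diff[OF I]) simp
  finally have "weight_mset w I + weight_mset w ({1..N + m} - I) =
      weight_mset w I + (replicate_mset m t + weight_mset w ({1..N} - I))"
    by (simp only: union_ac)
  then show ?thesis by (rule add_left_imp_eq)
qed

lemma weight_mset_block:
  assumes "p \<in> ord_parts n" "set p = block_partition n I"
  shows "weight_mset (block_weight p w) {1..length p} = add_mset (sum w I) (weight_mset w ({1..n} - I))"
  using weight_mset_block_weight[OF assms(1), of w] weight_mset_block_partition[of w n I] assms(2) by simp

section \<open>Contractible values at partitions with a repeated part\<close>

context
  fixes Fo :: "cut \<Rightarrow> 'a pspace" and Fm :: "cut \<Rightarrow> cut \<Rightarrow> nat set list \<Rightarrow> 'a \<Rightarrow> 'a"
  assumes RF: "resonance_functor Fo Fm"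
    and contr: "\<forall>k\<ge>2. pointed_contractible (Fpart Fo k (\<lambda>_. 1))"
begin

lemma is_pspace_ones: "1 \<le> m \<Longrightarrow> is_pspace (Fpart Fo m (\<lambda>_. 1))"
  by (rule is_pspace_Fpart[OF RF]) auto

lemma is_pspace_FQ_weights:
  "1 \<le> N \<Longrightarrow> (\<And>i. i \<in> {1..N} \<Longrightarrow> 0 < w i) \<Longrightarrow> is_pspace (FQ Fo Fm N (weight_cut N w) PP)"
  by (rule is_pspace_FQ[OF RF _ weight_cut_in_cuts])

text \<open>The hypothesis \<open>c\<close> is left to an induction. It is stated for all
  arrangements of the multiset of parts because the order of the blocks in \<open>p\<close> is
  arbitrary.\<close>

lemma Fpart_equiv_FQ_smash:
  assumes T: "top_form N m w t" and M: "seq_mset (weight_mset w {1..N+m})"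
    and I: "I \<subseteq> {1..N}" "sum w I = t" "irreducible_sum N w I"
    and c: "\<And>k u. weight_mset u {1..k} = replicate_mset (Suc m) t + weight_mset w ({1..N} - I) \<Longrightarrow>
      pointed_contractible (Fpart Fo k u)"
  shows "Fpart Fo (N + m) w \<simeq>\<^sub>*
    FQ Fo Fm N (weight_cut N w) (down N (block_partition N I) (weight_cut N w)) \<and>\<^sub>* Fpart Fo m (\<lambda>_. 1)"
proof -
  have "2 \<le> card I" by (rule top_form_sum_card[OF T I(1,2)])
  then have Ine: "I \<noteq> {}" by auto
  have I': "I \<subseteq> {1..N + m}" using I(1) by auto
  obtain p where p: "p \<in> ord_parts (N + m)" "set p = block_partition (N + m) I"
    by (rule ord_parts_exists[OF block_partition_in_parts[OF Ine I']])
  have "weight_mset (block_weight p w) {1..length p} = replicate_mset (Suc m) t + weight_mset w ({1..N} - I)"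
    unfolding weight_mset_block[OF p] weight_mset_remove_block[OF T I(1)] I(2) by simp
  then have c': "pointed_contractible (Fpart Fo (length p) (block_weight p w))" by (rule c)
  have n: "1 \<le> N + m" using top_formD(1)[OF T] by simp
  have "Fpart Fo (N + m) w \<simeq>\<^sub>* FQ Fo Fm (N + m) (weight_cut (N + m) w) (down (N + m) (set p) (weight_cut (N + m) w))"
    by (rule collapse_to_FQ[OF RF n top_formD(6)[OF T] p(1) c'])
  then show ?thesis
    unfolding p(2) by (rule pointed_equiv_trans[OF _ FQ_split[OF RF T M I]])
qed

lemma Fpart_no_sum:
  assumes T: "top_form N m w t" and M: "seq_mset (weight_mset w {1..N+m})" and N: "1 \<le> N"
    and no: "\<not> (\<exists>J\<subseteq>{1..N}. sum w J = t)"
  shows "Fpart Fo (N + m) w \<simeq>\<^sub>* Fpart Fo N w \<and>\<^sub>* Fpart Fo m (\<lambda>_. 1)"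
proof (rule Fpart_split[OF RF N top_formD(1)[OF T] _ top_formD(2)[OF T]])
  show "(\<Sum>i\<in>{N+1..N+m}. x i) = 0" if "x \<in> weight_cut (N + m) w" for x
    using seq_top_sum[OF T M that] no by blast
qed (use top_formD(5,6)[OF T] in auto)

text \<open>With two or more largest parts the factor F(1^m) is contractible by assumption and
  carries the conclusion. The induction serves only to make the merged partition
  collapsible.\<close>

lemma contractible_repeated_top:
  assumes "seq_mset M" "0 \<notin># M" "t \<in># M" "\<And>x. x \<in># M \<Longrightarrow> x \<le> t" "2 \<le> count M t" "weight_mset w {1..k} = M"
  shows "pointed_contractible (Fpart Fo k w)"
  using assms
proof (induction "size M" arbitrary: M k w rule: less_induct)
  case less
  obtain N m u where T: "top_form N m u t" and uM: "weight_mset u {1..N + m} = M" and m: "m = count M t"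
    by (rule top_form_exists[OF less.prems(2-4)])
  have upos: "0 < u i" if "i \<in> {1..N + m}" for i by (rule top_formD(6)[OF T that])
  have Npos: "0 < u i" if "i \<in> {1..N}" for i by (rule top_formD(4)[OF T that])
  have m2: "2 \<le> m" using less.prems(5) m by simp
  have seq: "seq_mset (weight_mset u {1..N + m})" using less.prems(1) uM by simp
  have pone: "is_pspace (Fpart Fo m (\<lambda>_. 1))" by (rule is_pspace_ones) (use m2 in simp)
  have "pointed_contractible (Fpart Fo (N + m) u)"
  proof (cases "N = 0")
    case True
    \<comment> \<open>All parts are equal, and dividing the equation by \<open>t\<close> gives the
      cut of F(1^m).\<close>
    have "weight_cut m u = weight_cut m (\<lambda>_. 1)"
      by (rule weight_cut_const[OF top_formD(2)[OF T]]) (use top_formD(5)[OF T] True in auto)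
    then show ?thesis using contr[rule_format, OF m2] True by (simp add: Fpart_def)
  next
    case False
    then have N: "1 \<le> N" by simp
    show ?thesis
    proof (cases "\<exists>J\<subseteq>{1..N}. sum u J = t")
      case False
      have "pointed_contractible (Fpart Fo N u \<and>\<^sub>* Fpart Fo m (\<lambda>_. 1))"
        by (rule smash_contractible_right[OF contr[rule_format, OF m2] is_pspace_Fpart[OF RF N Npos] pone])
      then show ?thesis by (rule pointed_contractible_equiv[OF Fpart_no_sum[OF T seq N False]])
    next
      case True
      obtain I where I: "I \<subseteq> {1..N}" "sum u I = t" "irreducible_sum N u I"
        by (rule irreducible_sum_exists[OF True])
      let ?K = "weight_mset u ({1..N} - I)" and ?M' = "replicate_mset (Suc m) t + weight_mset u ({1..N} - I)"
      have Mdec: "M = replicate_mset m t + weight_mset u I + ?K"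
        using uM weight_mset_top[OF T] weight_mset_diff[OF I(1), of u] by (simp add: union_ac)
      have Kt: "x < t" if "x \<in># ?K" for x using that top_formD(3)[OF T] by auto
      have K0: "0 \<notin># ?K" by (rule zero_notin_weight_mset) (use Npos in auto)
      have seq': "seq_mset ?M'"
        by (rule seq_mset_merge_top[of _ _ "weight_mset u I"])
          (use less.prems(1) Mdec I(2) m2 Kt in \<open>auto simp: sum_weight_mset\<close>)
      have I2: "2 \<le> card I" by (rule top_form_sum_card[OF T I(1,2)])
      \<comment> \<open>The elements of \<open>I\<close>, at least two, have been replaced by one
        copy of \<open>t\<close>.\<close>
      have size: "size ?M' < size M" unfolding Mdec using I2 by simp
      have c: "pointed_contractible (Fpart Fo k' u')" if "weight_mset u' {1..k'} = ?M'" for k' u'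
      proof (rule less.hyps[OF size seq' _ _ _ _ that])
        show "0 \<notin># ?M'" using K0 top_formD(2)[OF T] by auto
        show "x \<le> t" if "x \<in># ?M'" for x using that Kt[of x] by (auto simp: less_imp_le split: if_splits)
      qed (use m2 in auto)
      have "pointed_contractible (FQ Fo Fm N (weight_cut N u) (down N (block_partition N I) (weight_cut N u)) \<and>\<^sub>* Fpart Fo m (\<lambda>_. 1))"
        by (rule smash_contractible_right[OF contr[rule_format, OF m2] is_pspace_FQ_weights[OF N Npos] pone])
      moreover have "Fpart Fo (N + m) u \<simeq>\<^sub>*
          FQ Fo Fm N (weight_cut N u) (down N (block_partition N I) (weight_cut N u)) \<and>\<^sub>* Fpart Fo m (\<lambda>_. 1)"
        by (rule Fpart_equiv_FQ_smash[OF T seq I c])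
      ultimately show ?thesis by (rule pointed_contractible_equiv[rotated])
    qed
  qed
  then show ?case
  proof (rule Fpart_contractible_mset[OF RF _ _ upos])
    show "1 \<le> N + m" using m2 by simp
    show "weight_mset u {1..N + m} = weight_mset w {1..k}" using uM less.prems(6) by simp
  qed
qed

lemma Fpart_equiv_FQ_smash_seq:
  assumes T: "top_form N m w t" and M: "seq_mset (weight_mset w {1..N+m})"
    and I: "I \<subseteq> {1..N}" "sum w I = t" "irreducible_sum N w I"
  shows "Fpart Fo (N + m) w \<simeq>\<^sub>*
    FQ Fo Fm N (weight_cut N w) (down N (block_partition N I) (weight_cut N w)) \<and>\<^sub>* Fpart Fo m (\<lambda>_. 1)"
proof (rule Fpart_equiv_FQ_smash[OF T M I])
  let ?K = "weight_mset w ({1..N} - I)"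
  have m: "1 \<le> m" by (rule top_formD(1)[OF T])
  have Mdec: "weight_mset w {1..N + m} = replicate_mset m t + weight_mset w I + ?K"
    using weight_mset_top[OF T] weight_mset_diff[OF I(1), of w] by (simp add: union_ac)
  have Kt: "x < t" if "x \<in># ?K" for x using that top_formD(3)[OF T] by auto
  have K0: "0 \<notin># ?K" by (rule zero_notin_weight_mset) (use top_formD(4)[OF T] in auto)
  have seq': "seq_mset (replicate_mset (Suc m) t + ?K)"
    by (rule seq_mset_merge_top[of _ _ "weight_mset w I"])
      (use M Mdec I(2) m Kt in \<open>auto simp: sum_weight_mset\<close>)
  show "pointed_contractible (Fpart Fo k u)"
    if "weight_mset u {1..k} = replicate_mset (Suc m) t + ?K" for k u
  proof (rule contractible_repeated_top[OF seq' _ _ _ _ that])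
    show "0 \<notin># replicate_mset (Suc m) t + ?K" using K0 top_formD(2)[OF T] by auto
    show "x \<le> t" if "x \<in># replicate_mset (Suc m) t + ?K" for x using that Kt[of x] by (auto simp: less_imp_le split: if_splits)
  qed (use m in auto)
qed

text \<open>If \<open>v\<close> is below the maximum \<open>t\<close>, possibly \<open>m = 1\<close>
  and F(1^m) gives nothing. The other factor is handled instead: the partition without its largest
  parts still contains \<open>v\<close> twice, and so does the one with \<open>I\<close> merged,
  since a set with sum \<open>t > v\<close> avoids \<open>v\<close>. By induction both values are
  contractible, and so is their quotient.\<close>

lemma contractible_repeated_value:
  assumes "seq_mset M" "0 \<notin># M" "2 \<le> count M v" "avoids_above v M" "weight_mset w {1..k} = M"
  shows "pointed_contractible (Fpart Fo k w)"
  using assms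
proof (induction "size M" arbitrary: M k w rule: less_induct)
  case less
  have vM: "v \<in># M" using less.prems(3) by (metis count_eq_zero_iff not_numeral_le_zero)
  then have Mne: "M \<noteq> {#}" by auto
  define t where "t = Max_mset M"
  have tM: "t \<in># M" unfolding t_def by (rule Max_in) (use Mne in auto)
  have tmax: "x \<le> t" if "x \<in># M" for x unfolding t_def using that by auto
  show ?case
  proof (cases "t = v")
    case True
    show ?thesis
      by (rule contractible_repeated_top[OF less.prems(1,2) tM tmax _ less.prems(5)]) (use True less.prems(3) in auto)
  next
    case False
    then have vt: "v < t" using tmax[OF vM] by simp
    obtain N m u where T: "top_form N m u t" and uM: "weight_mset u {1..N + m} = M" and m: "m = count M t"
      by (rule top_form_exists[OF less.prems(2) tM tmax])
    have m1: "1 \<le> m" by (rule top_formD(1)[OF T])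
    have upos: "0 < u i" if "i \<in> {1..N + m}" for i by (rule top_formD(6)[OF T that])
    have Npos: "0 < u i" if "i \<in> {1..N}" for i by (rule top_formD(4)[OF T that])
    have seq: "seq_mset (weight_mset u {1..N + m})" using less.prems(1) uM by simp
    have pone: "is_pspace (Fpart Fo m (\<lambda>_. 1))" by (rule is_pspace_ones[OF m1])
    let ?M0 = "weight_mset u {1..N}"
    have Mdec: "M = replicate_mset m t + ?M0" using uM weight_mset_top[OF T] by simp
    have M0: "?M0 \<subseteq># M" unfolding Mdec by simp
    have cv: "count ?M0 v = count M v" using vt Mdec by simp
    have N: "1 \<le> N"
    proof (rule ccontr)
      assume "\<not> 1 \<le> N"
      then have "?M0 = {#}" by simp
      then show False using cv less.prems(3) by simp
    qed
    have "size ?M0 < size M" unfolding Mdec using m1 by simp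
    then have cN: "pointed_contractible (Fpart Fo N u)"
    proof (rule less.hyps[OF _ _ _ _ _ refl])
      show "seq_mset ?M0" by (rule seq_mset_mono[OF less.prems(1) M0])
      show "0 \<notin># ?M0" by (rule zero_notin_weight_mset) (use Npos in auto)
      show "2 \<le> count ?M0 v" using cv less.prems(3) by simp
      show "avoids_above v ?M0" by (rule avoids_above_mono[OF less.prems(4) M0])
    qed
    have "pointed_contractible (Fpart Fo (N + m) u)"
    proof (cases "\<exists>J\<subseteq>{1..N}. sum u J = t")
      case False
      have "pointed_contractible (Fpart Fo N u \<and>\<^sub>* Fpart Fo m (\<lambda>_. 1))"
        by (rule smash_contractible[OF cN is_pspace_Fpart[OF RF N Npos] pone])
      then show ?thesis by (rule pointed_contractible_equiv[OF Fpart_no_sum[OF T seq N False]])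
    next
      case True
      obtain I where I: "I \<subseteq> {1..N}" "sum u I = t" "irreducible_sum N u I"
        by (rule irreducible_sum_exists[OF True])
      have I2: "2 \<le> card I" by (rule top_form_sum_card[OF T I(1,2)])
      then have Ine: "I \<noteq> {}" by auto
      obtain p where p: "p \<in> ord_parts N" "set p = block_partition N I"
        by (rule ord_parts_exists[OF block_partition_in_parts[OF Ine I(1)]])
      let ?K = "weight_mset u ({1..N} - I)"
      have pM: "weight_mset (block_weight p u) {1..length p} = add_mset t ?K"
        unfolding weight_mset_block[OF p] I(2) ..
      have M0dec: "?M0 = weight_mset u I + ?K" by (rule weight_mset_diff[OF I(1)]) simp
      have IM: "weight_mset u I \<subseteq># M" unfolding Mdec M0dec by simp
      \<comment> \<open>This is what the avoidance condition is for: no copy of \<open>v\<close> is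
        absorbed when \<open>I\<close> is merged.\<close>
      have vI: "v \<notin># weight_mset u I"
        using less.prems(4)[unfolded avoids_above_def, rule_format, of t "weight_mset u I"] tM vt IM I(2)
        by (simp add: sum_weight_mset)
      have sub: "add_mset t ?K \<subseteq># M"
      proof -
        have "{#t#} \<subseteq># replicate_mset m t" using m1 by simp
        moreover have "?K \<subseteq># ?M0" unfolding M0dec by simp
        ultimately have "{#t#} + ?K \<subseteq># M" unfolding Mdec by (rule subset_mset.add_mono)
        then show ?thesis by simp
      qed
      have "size (add_mset t ?K) < size M"
        unfolding Mdec M0dec using m1 I2 by simp
      then have "pointed_contractible (Fpart Fo (length p) (block_weight p u))"
      proof (rule less.hyps[OF _ _ _ _ _ pM])
        show "seq_mset (add_mset t ?K)" by (rule seq_mset_mono[OF less.prems(1) sub])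
        have "0 \<notin># ?K" by (rule zero_notin_weight_mset) (use Npos in auto)
        then show "0 \<notin># add_mset t ?K" using top_formD(2)[OF T] by simp
        have "count ?M0 v = count ?K v" unfolding M0dec count_union using vI[unfolded not_in_iff] by simp
        then show "2 \<le> count (add_mset t ?K) v" using cv less.prems(3) vt by simp
        show "avoids_above v (add_mset t ?K)" by (rule avoids_above_mono[OF less.prems(4) sub])
      qed
      then have "Fpart Fo N u \<simeq>\<^sub>* FQ Fo Fm N (weight_cut N u) (down N (set p) (weight_cut N u))"
        by (intro collapse_to_FQ[OF RF N _ p(1)] Npos)
      then have "pointed_contractible (FQ Fo Fm N (weight_cut N u) (down N (block_partition N I) (weight_cut N u)))"
        unfolding p(2) by (rule pointed_contractible_equiv[OF pointed_equiv_sym cN])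
      then have "pointed_contractible
          (FQ Fo Fm N (weight_cut N u) (down N (block_partition N I) (weight_cut N u)) \<and>\<^sub>* Fpart Fo m (\<lambda>_. 1))"
        by (rule smash_contractible[OF _ is_pspace_FQ_weights[OF N Npos] pone])
      then show ?thesis
        by (rule pointed_contractible_equiv[OF Fpart_equiv_FQ_smash_seq[OF T seq I]])
    qed
    then show ?thesis
    proof (rule Fpart_contractible_mset[OF RF _ _ upos])
      show "1 \<le> N + m" using m1 by simp
      show "weight_mset u {1..N + m} = weight_mset w {1..k}" using uM less.prems(5) by simp
    qed
  qed
qed

end

text \<open>Needed because the blocks of an ordered partition list the parts in another order than
  \<mu> does. The extension problem is transported along the inverse homeomorphism.\<close>

lemma inclusion_map_compose_homeo:
  fixes A B X :: "'a pspace"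
  assumes A: "is_pspace A" and h: "pointed_homeo A B h" and f: "inclusion_map B X f"
  shows "inclusion_map A X (f \<circ> h)" and "(f \<circ> h) ` topspace (fst A) = f ` topspace (fst B)"
proof -
  obtain g where g: "pointed_map A B h" "pointed_map B A g"
    "\<And>x. x \<in> topspace (fst A) \<Longrightarrow> g (h x) = x" "\<And>y. y \<in> topspace (fst B) \<Longrightarrow> h (g y) = y"
    using pointed_homeoE[OF h A] by blast
  have fm: "pointed_map B X f" "embedding_map (fst B) (fst X) f" "pointed_HEP B X f"
    using f by (auto simp: inclusion_map_def)
  have "h ` topspace (fst A) = topspace (fst B)"
    using pointed_map_topspace[OF g(1)] pointed_map_topspace[OF g(2)] g(4) by force
  note him = this
  show "(f \<circ> h) ` topspace (fst A) = f ` topspace (fst B)" using him by (simp only: image_comp[symmetric])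
  have "embedding_map (fst A) (fst B) h"
    using h unfolding embedding_map_def him pointed_homeo_def by simp
  then have emb: "embedding_map (fst A) (fst X) (f \<circ> h)" using fm(2) by (rule embedding_map_compose)
  have "pointed_HEP A X (f \<circ> h)"
    unfolding pointed_HEP_def
  proof (intro allI impI, elim conjE)
    fix Y :: "('a \<times> real) pspace" and u k
    assume Y: "is_pspace Y" and u: "pointed_map X Y u"
      and k: "continuous_map (prod_topology unit_top (fst A)) (fst Y) k"
      and k0: "\<forall>a\<in>topspace (fst A). k (0, a) = u ((f \<circ> h) a)" and kb: "\<forall>t\<in>{0..1}. k (t, snd A) = snd Y"
    have gc: "continuous_map (fst B) (fst A) g" and gb: "g (snd B) = snd A"
      using g(2) by (auto simp: pointed_map_def)
    have kc: "continuous_map (prod_topology unit_top (fst B)) (fst Y) (\<lambda>z. k (fst z, g (snd z)))"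
      by (intro continuous_map_comp[OF k] continuous_map_pairedI continuous_map_fst
          continuous_map_comp[OF gc continuous_map_snd])
    obtain H where H: "continuous_map (prod_topology unit_top (fst X)) (fst Y) H"
      "\<And>x. x \<in> topspace (fst X) \<Longrightarrow> H (0, x) = u x"
      "\<And>t b. 0 \<le> t \<Longrightarrow> t \<le> 1 \<Longrightarrow> b \<in> topspace (fst B) \<Longrightarrow> H (t, f b) = (\<lambda>z. k (fst z, g (snd z))) (t, b)"
      by (rule pointed_HEP_E[OF fm(3) Y u kc])
        (use k0 kb gb g(4) pointed_map_topspace[OF g(2)] in auto)
    show "\<exists>H. continuous_map (prod_topology unit_top (fst X)) (fst Y) H \<and> (\<forall>x\<in>topspace (fst X). H (0, x) = u x) \<and>
        (\<forall>t\<in>{0..1}. \<forall>a\<in>topspace (fst A). H (t, (f \<circ> h) a) = k (t, a))"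
    proof (intro exI[of _ H] conjI H(1) ballI)
      fix t :: real and a assume "t \<in> {0..1}" and a: "a \<in> topspace (fst A)"
      then show "H (t, (f \<circ> h) a) = k (t, a)"
        using H(3)[of t "h a"] pointed_map_topspace[OF g(1) a] g(3)[OF a] by simp
    qed (rule H(2))
  qed
  then show "inclusion_map A X (f \<circ> h)"
    unfolding inclusion_map_def using emb pointed_map_compose[OF g(1) fm(1)] by blast
qed


subsection \<open>Refinements of ordered set partitions\<close>

text \<open>When \<open>q\<close> refines \<open>p\<close>, this is the ordered partition of the
  block indices of \<open>q\<close> through which \<open>p\<close> factors: composing it with
  \<open>q\<close> returns \<open>p\<close>.\<close>

definition index_partition :: "nat set list \<Rightarrow> nat set list \<Rightarrow> nat set list" where
  "index_partition p q = map (\<lambda>P. {j \<in> {1..length q}. q ! (j - 1) \<subseteq> P}) p"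

context
  fixes n :: nat and p q :: "nat set list"
  assumes p: "p \<in> ord_parts n" and q: "q \<in> ord_parts n" and refines: "\<And>B. B \<in> set q \<Longrightarrow> \<exists>P\<in>set p. B \<subseteq> P"
begin

lemma index_partition_union:
  assumes "P \<in> set p"
  shows "(\<Union>j\<in>{j \<in> {1..length q}. q ! (j - 1) \<subseteq> P}. q ! (j - 1)) = P"
proof
  have pp: "\<Union>(set p) = {1..n}" "disjoint (set p)" using p by (auto simp: ord_parts_def parts_def partition_on_def)
  show "P \<subseteq> (\<Union>j\<in>{j \<in> {1..length q}. q ! (j - 1) \<subseteq> P}. q ! (j - 1))"
  proof
    fix x assume x: "x \<in> P"
    then have "x \<in> {1..n}" using pp(1) assms by blast
    then obtain j where j: "j \<in> {1..length q}" "x \<in> q ! (j - 1)" using ord_parts_cover[OF q] by blast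
    have "q ! (j - 1) \<in> set q" using j(1) by (intro nth_mem) auto
    then obtain P' where P': "P' \<in> set p" "q ! (j - 1) \<subseteq> P'" using refines by blast
    have "P' = P" using disjointD[OF pp(2) P'(1) assms] x j(2) P'(2) by blast
    then show "x \<in> (\<Union>j\<in>{j \<in> {1..length q}. q ! (j - 1) \<subseteq> P}. q ! (j - 1))" using j P'(2) by blast
  qed
qed auto

lemma comp_index_partition: "comp_part (index_partition p q) q = p"
  unfolding comp_part_def index_partition_def map_map
  by (rule map_idI) (simp only: o_def index_partition_union)

lemma index_partition_ord_parts: "index_partition p q \<in> ord_parts (length q)"
proof -
  let ?f = "\<lambda>P. {j \<in> {1..length q}. q ! (j - 1) \<subseteq> P}"
  have pp: "disjoint (set p)" "{} \<notin> set p" "distinct p"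
    using p by (auto simp: ord_parts_def parts_def partition_on_def)
  have "inj_on ?f (set p)"
  proof (rule inj_onI)
    fix P P' assume "P \<in> set p" "P' \<in> set p" "?f P = ?f P'"
    then show "P = P'" using index_partition_union[of P] index_partition_union[of P'] by simp
  qed
  then have "distinct (index_partition p q)" using pp(3) by (simp add: index_partition_def distinct_map)
  moreover have "partition_on {1..length q} (?f ` set p)"
  proof (rule partition_onI)
    show "\<Union>(?f ` set p) = {1..length q}"
    proof
      show "{1..length q} \<subseteq> \<Union>(?f ` set p)"
      proof
        fix j assume j: "j \<in> {1..length q}"
        then have "q ! (j - 1) \<in> set q" by (intro nth_mem) auto
        then show "j \<in> \<Union>(?f ` set p)" using refines j by blast
      qed
    qed auto
    show "{} \<notin> ?f ` set p"
    proof
      assume "{} \<in> ?f ` set p"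
      then obtain P where P: "P \<in> set p" "?f P = {}" by (elim imageE) simp
      then have "P = {}" using index_partition_union[OF P(1)] by (simp only: UN_empty)
      then show False using P(1) pp(2) by simp
    qed
    fix X Y assume "X \<in> ?f ` set p" "Y \<in> ?f ` set p" and XY: "X \<noteq> Y"
    then obtain P P' where P: "P \<in> set p" "P' \<in> set p" "X = ?f P" "Y = ?f P'" by blast
    then have "P \<inter> P' = {}" using XY disjointD[OF pp(1)] by blast
    show "disjnt X Y"
      unfolding disjnt_def
    proof (rule equals0I)
      fix j assume "j \<in> X \<inter> Y"
      then have "j \<in> {1..length q}" "q ! (j - 1) \<subseteq> P \<inter> P'" using P by auto
      then show False using ord_parts_block(2)[OF q] \<open>P \<inter> P' = {}\<close> by blast
    qed
  qed
  ultimately show ?thesis by (simp add: ord_parts_def parts_def index_partition_def)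
qed

lemma block_weight_index_partition:
  assumes "j \<in> {1..length p}"
  shows "block_weight (index_partition p q) (block_weight q w) j = block_weight p w j"
proof -
  let ?R = "{j' \<in> {1..length q}. q ! (j' - 1) \<subseteq> p ! (j - 1)}"
  have P: "p ! (j - 1) \<in> set p" using assms by (intro nth_mem) auto
  have "index_partition p q ! (j - 1) = ?R" using assms by (auto simp: index_partition_def)
  then have "block_weight (index_partition p q) (block_weight q w) j = (\<Sum>i\<in>?R. sum w (q ! (i - 1)))"
    by (simp add: block_weight_def)
  also have "\<dots> = sum w (\<Union>i\<in>?R. q ! (i - 1))"
  proof (rule sum.UNION_disjoint[symmetric])
    show "\<forall>i\<in>?R. finite (q ! (i - 1))"
      using ord_parts_block(1)[OF q] finite_subset[OF _ finite_atLeastAtMost] by blast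
    show "\<forall>i\<in>?R. \<forall>i'\<in>?R. i \<noteq> i' \<longrightarrow> q ! (i - 1) \<inter> q ! (i' - 1) = {}"
    proof (intro ballI impI)
      fix i i' assume "i \<in> ?R" "i' \<in> ?R" "i \<noteq> i'"
      then show "q ! (i - 1) \<inter> q ! (i' - 1) = {}" by (intro ord_parts_nth_disjoint[OF q]) auto
    qed
  qed simp
  also have "(\<Union>i\<in>?R. q ! (i - 1)) = p ! (j - 1)" by (rule index_partition_union[OF P])
  finally show ?thesis by (simp add: block_weight_def)
qed

end

lemma sum_block_weight:
  assumes "p \<in> ord_parts n"
  shows "sum (block_weight p w) {1..length p} = sum w {1..n}"
proof -
  have "sum (block_weight p w) {1..length p} = (\<Sum>j\<in>{1..length p}. sum w (p ! (j - 1)))"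
    by (simp add: block_weight_def)
  also have "\<dots> = sum w (\<Union>j\<in>{1..length p}. p ! (j - 1))"
  proof (rule sum.UNION_disjoint[symmetric])
    show "\<forall>i\<in>{1..length p}. finite (p ! (i - 1))"
      using ord_parts_block(1)[OF assms] finite_subset[OF _ finite_atLeastAtMost] by blast
    show "\<forall>i\<in>{1..length p}. \<forall>i'\<in>{1..length p}. i \<noteq> i' \<longrightarrow> p ! (i - 1) \<inter> p ! (i' - 1) = {}"
    proof (intro ballI impI)
      fix i i' assume "i \<in> {1..length p}" "i' \<in> {1..length p}" "i \<noteq> i'"
      then show "p ! (i - 1) \<inter> p ! (i' - 1) = {}" by (intro ord_parts_nth_disjoint[OF assms]) auto
    qed
  qed simp
  finally show ?thesis unfolding ord_parts_cover[OF assms] .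
qed

lemma weight_mset_subpartition:
  assumes "finite J"
  shows "weight_mset (subpartition l J) {1..card J} = weight_mset l J"
proof -
  have "weight_mset (subpartition l J) {1..card J} =
      image_mset (\<lambda>j. l (sorted_list_of_set J ! j)) (mset_set {0..<card J})"
    unfolding subpartition_def by (rule image_mset_shift[of "\<lambda>j. l (sorted_list_of_set J ! j)"])
  also have "\<dots> = image_mset l (image_mset ((!) (sorted_list_of_set J)) (mset_set {0..<length (sorted_list_of_set J)}))"
    by (simp add: image_mset.compositionality o_def)
  also have "image_mset ((!) (sorted_list_of_set J)) (mset_set {0..<length (sorted_list_of_set J)}) = mset (sorted_list_of_set J)"
    by (metis map_nth mset_map mset_upt)
  also have "mset (sorted_list_of_set J) = mset_set J"
    using mset_set_set[of "sorted_list_of_set J"] assms by simp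
  finally show ?thesis .
qed

lemma weight_cut_dominated:
  assumes "sum w {1..N} < w (Suc N)" "x \<in> weight_cut (Suc N) w"
  shows "x (Suc N) = 0"
proof (rule ccontr)
  assume nz: "x (Suc N) \<noteq> 0"
  have xt: "x \<in> tvecs (Suc N)" "sum w (Plus x) = sum w (Minus x)" using assms(2) by (auto simp: weight_cut_iff)
  have le: "sum w A \<le> sum w {1..N}" if "A \<subseteq> {1..Suc N}" "Suc N \<notin> A" for A
    using that by (intro sum_mono2) (auto simp: le_Suc_eq subset_iff)
  have ge: "w (Suc N) \<le> sum w A" if "A \<subseteq> {1..Suc N}" "Suc N \<in> A" for A
    using that finite_subset[OF that(1)] by (intro member_le_sum) auto
  have sub: "Plus x \<subseteq> {1..Suc N}" "Minus x \<subseteq> {1..Suc N}" using Plus_subset[OF xt(1)] Minus_subset[OF xt(1)] .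
  consider "Suc N \<in> Plus x" "Suc N \<notin> Minus x" | "Suc N \<in> Minus x" "Suc N \<notin> Plus x"
    using nz tvecs_cases[OF xt(1), of "Suc N"] by (auto simp: Plus_def Minus_def)
  then show False
  proof cases
    case 1
    then show False using le[OF sub(2)] ge[OF sub(1)] xt(2) assms(1) by simp
  next
    case 2
    then show False using le[OF sub(1)] ge[OF sub(2)] xt(2) assms(1) by simp
  qed
qed

section \<open>Null-homotopies through refinements, and a dominating largest part\<close>

context
  fixes Fo :: "cut \<Rightarrow> 'a pspace" and Fm :: "cut \<Rightarrow> cut \<Rightarrow> nat set list \<Rightarrow> 'a \<Rightarrow> 'a"
  assumes RF: "resonance_functor Fo Fm"
begin

text \<open>By functoriality the map of \<open>p\<close> is the map of
  \<open>index_partition p q\<close> followed by that of \<open>q\<close>, so it passes through the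
  contractible value at \<open>q\<close>.\<close>

lemma null_homotopic_through_refinement:
  assumes n: "1 \<le> n" and w: "\<And>i. i \<in> {1..n} \<Longrightarrow> 0 < w i" and p: "p \<in> ord_parts n" and q: "q \<in> ord_parts n"
    and refines: "\<And>B. B \<in> set q \<Longrightarrow> \<exists>P\<in>set p. B \<subseteq> P"
    and c: "pointed_contractible (Fpart Fo (length q) (block_weight q w))"
  shows "pointed_homotopic (Fpart Fo (length p) (block_weight p w)) (Fpart Fo n w)
    (Fm (pull_obj p (weight_cut n w)) (n, weight_cut n w) p) (\<lambda>_. snd (Fpart Fo n w))"
proof -
  let ?r = "index_partition p q"
  let ?a = "(length p, weight_cut (length p) (block_weight p w))"
  let ?b = "(length q, weight_cut (length q) (block_weight q w))"
  let ?c = "(n, weight_cut n w)"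
  have ppos: "0 < block_weight p w i" if "i \<in> {1..length p}" for i
    by (rule block_weight_pos[OF p _ that]) (rule w)
  have qpos: "0 < block_weight q w i" if "i \<in> {1..length q}" for i
    by (rule block_weight_pos[OF q _ that]) (rule w)
  have r: "?r \<in> ord_parts (length q)" by (rule index_partition_ord_parts[OF p q refines])
  have rq: "comp_part ?r q = p" by (rule comp_index_partition[OF p q refines])
  have lr: "length ?r = length p" by (simp add: index_partition_def)
  have a: "res_obj ?a"
    by (rule res_obj_weight_cut[OF RF ord_parts_length[OF p n] ppos])
  have b: "res_obj ?b"
    by (rule res_obj_weight_cut[OF RF ord_parts_length[OF q n] qpos])
  have c': "res_obj ?c" by (rule res_obj_weight_cut[OF RF n w])
  have "pull ?r (weight_cut (length q) (block_weight q w)) = weight_cut (length ?r) (block_weight ?r (block_weight q w))"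
    using pull_obj_weight_cut[OF r, of "block_weight q w"] by (simp add: pull_obj_def)
  also have "\<dots> = weight_cut (length p) (block_weight p w)"
    unfolding lr by (rule weight_cut_cong) (rule block_weight_index_partition[OF p q refines])
  finally have pull_r: "pull ?r (weight_cut (length q) (block_weight q w)) = weight_cut (length p) (block_weight p w)" .
  have ab: "res_mor ?a ?b ?r" unfolding res_mor_def using a b r lr pull_r by simp
  have "pull q (weight_cut n w) = weight_cut (length q) (block_weight q w)"
    using pull_obj_weight_cut[OF q, of w] by (simp add: pull_obj_def)
  then have bc: "res_mor ?b ?c q" unfolding res_mor_def using b c' q by simp
  have "pull p (weight_cut n w) = weight_cut (length p) (block_weight p w)"
    using pull_obj_weight_cut[OF p, of w] by (simp add: pull_obj_def)
  then have ac: "res_mor ?a ?c p" unfolding res_mor_def using a c' p by simp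
  have rf: "res_functor Fo Fm" using RF by (simp only: resonance_functor_def)
  note fcomp = rf[unfolded res_functor_def, THEN conjunct2, THEN conjunct2, THEN conjunct2, rule_format, OF conjI]
  have pX: "is_pspace (Fpart Fo (length p) (block_weight p w))"
    by (rule is_pspace_Fpart[OF RF ord_parts_length[OF p n] ppos])
  have "pointed_homotopic (Fpart Fo (length p) (block_weight p w)) (Fpart Fo n w)
      (Fm ?a ?c p) (Fm ?b ?c q \<circ> Fm ?a ?b ?r)"
  proof (rule pointed_homotopic_eq[OF pX Fpart_pointed_map[OF RF ac]])
    fix x assume "x \<in> topspace (fst (Fpart Fo (length p) (block_weight p w)))"
    then have "Fm ?a ?c (comp_part ?r q) x = Fm ?b ?c q (Fm ?a ?b ?r x)"
      by (intro fcomp[OF ab bc]) (simp add: Fpart_def)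
    then show "Fm ?a ?c p x = (Fm ?b ?c q \<circ> Fm ?a ?b ?r) x" by (simp add: rq)
  qed
  moreover have "pointed_homotopic (Fpart Fo (length p) (block_weight p w)) (Fpart Fo n w)
      (Fm ?b ?c q \<circ> Fm ?a ?b ?r) (\<lambda>_. snd (Fpart Fo n w))"
    by (rule pointed_homotopic_through_contractible[OF c Fpart_pointed_map[OF RF ab] Fpart_pointed_map[OF RF bc]])
  ultimately have "pointed_homotopic (Fpart Fo (length p) (block_weight p w)) (Fpart Fo n w)
      (Fm ?a ?c p) (\<lambda>_. snd (Fpart Fo n w))"
    by (rule pointed_homotopic_trans)
  then show ?thesis unfolding pull_obj_weight_cut[OF p, of w] .
qed

lemma Fpart_dominated:
  assumes N: "1 \<le> N" and w: "\<And>i. i \<in> {1..Suc N} \<Longrightarrow> 0 < w i" and big: "sum w {1..N} < w (Suc N)"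
  shows "Fpart Fo (Suc N) w \<simeq>\<^sub>* Fpart Fo N w \<and>\<^sub>* Fpart Fo 1 (\<lambda>_. 1)"
proof -
  have "Fpart Fo (N + 1) w \<simeq>\<^sub>* Fpart Fo N w \<and>\<^sub>* Fpart Fo 1 (\<lambda>_. 1)"
  proof (rule Fpart_split[OF RF N, of 1 w "w (Suc N)"])
    show "(\<Sum>i\<in>{N+1..N+1}. x i) = 0" if "x \<in> weight_cut (N + 1) w" for x
      using weight_cut_dominated[OF big, of x] that by simp
    show "w i = w (Suc N)" if "i \<in> {N+1..N+1}" for i using that by (simp add: le_antisym)
  qed (use w in auto)
  then show ?thesis by simp
qed

lemma Fpart_dominated_block:
  assumes N: "1 \<le> N" and w: "\<And>i. i \<in> {1..Suc N} \<Longrightarrow> 0 < w i" and big: "sum w {1..N} < w (Suc N)"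
    and B: "B \<noteq> {}" "B \<subseteq> {1..N}"
    and p: "p \<in> ord_parts N" "set p = block_partition N B"
    and p': "p' \<in> ord_parts (Suc N)" "set p' = block_partition (Suc N) B"
  shows "Fpart Fo (length p') (block_weight p' w) \<simeq>\<^sub>*
    Fpart Fo (length p) (block_weight p w) \<and>\<^sub>* Fpart Fo 1 (\<lambda>_. 1)"
proof -
  \<comment> \<open>The block weights of \<open>p\<close> followed by the dominating part.
    \<open>p'\<close> yields the same multiset, possibly in another order, and merging inside
    \<open>{1..N}\<close> keeps the total, so the last part still dominates.\<close>
  let ?k = "length p" and ?u = "(block_weight p w)(Suc (length p) := w (Suc N))"
  have wN: "0 < w i" if "i \<in> {1..N}" for i using w that by simp
  have ppos: "0 < block_weight p w i" if "i \<in> {1..length p}" for i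
    by (rule block_weight_pos[OF p(1) _ that]) (rule wN)
  have p'pos: "0 < block_weight p' w i" if "i \<in> {1..length p'}" for i
    by (rule block_weight_pos[OF p'(1) _ that]) (rule w)
  have k: "1 \<le> ?k" by (rule ord_parts_length[OF p(1) N])
  have upos: "0 < ?u i" if "i \<in> {1..Suc ?k}" for i
    using that ppos[of i] w[of "Suc N"] by (cases "i = Suc ?k") auto
  have uk: "weight_mset ?u {1..?k} = weight_mset (block_weight p w) {1..?k}"
    by (rule image_mset_cong) auto
  have "weight_mset ?u {1..Suc ?k} = add_mset (w (Suc N)) (weight_mset ?u {1..?k})"
    by (simp add: atLeastAtMostSuc_conv)
  also have "\<dots> = add_mset (w (Suc N)) (add_mset (sum w B) (weight_mset w ({1..N} - B)))"
    unfolding uk weight_mset_block[OF p] ..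
  also have "\<dots> = add_mset (sum w B) (weight_mset w ({1..Suc N} - B))"
  proof -
    have "{1..Suc N} - B = insert (Suc N) ({1..N} - B)" using B by auto
    then show ?thesis by (simp add: add_mset_commute)
  qed
  also have "\<dots> = weight_mset (block_weight p' w) {1..length p'}" by (rule weight_mset_block[OF p', symmetric])
  finally have eq: "weight_mset (block_weight p' w) {1..length p'} = weight_mset ?u {1..Suc ?k}" ..
  have n': "1 \<le> Suc N" by simp
  have 1: "Fpart Fo (length p') (block_weight p' w) \<simeq>\<^sub>* Fpart Fo (Suc ?k) ?u"
    by (rule Fpart_equiv[OF RF ord_parts_length[OF p'(1) n'] p'pos _ upos eq]) auto
  have "sum ?u {1..?k} = sum (block_weight p w) {1..?k}" by (rule sum.cong) auto
  also have "\<dots> < w (Suc N)" using big unfolding sum_block_weight[OF p(1)] .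
  finally have "sum ?u {1..?k} < ?u (Suc ?k)" by simp
  then have 2: "Fpart Fo (Suc ?k) ?u \<simeq>\<^sub>* Fpart Fo ?k ?u \<and>\<^sub>* Fpart Fo 1 (\<lambda>_. 1)"
    by (intro Fpart_dominated[OF k] upos)
  have "Fpart Fo ?k ?u = Fpart Fo ?k (block_weight p w)"
    by (intro Fpart_cong[OF RF] weight_cut_cong) auto
  then show ?thesis using pointed_equiv_trans[OF 1 2] by simp
qed

lemma FQ_dominated:
  assumes N: "1 \<le> N" and w: "\<And>i. i \<in> {1..Suc N} \<Longrightarrow> 0 < w i" and big: "sum w {1..N} < w (Suc N)"
    and B: "B \<noteq> {}" "B \<subseteq> {1..N}"
  shows "FQ Fo Fm (Suc N) (weight_cut (Suc N) w) (down (Suc N) (block_partition (Suc N) B) (weight_cut (Suc N) w)) \<simeq>\<^sub>*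
    FQ Fo Fm N (weight_cut N w) (down N (block_partition N B) (weight_cut N w)) \<and>\<^sub>* Fpart Fo 1 (\<lambda>_. 1)"
proof -
  let ?D = "down N (block_partition N B) (weight_cut N w)"
  let ?D' = "down (N + 1) (block_partition (N + 1) B) (weight_cut (N + 1) w)"
  have B': "B \<subseteq> {1..N + 1}" using B(2) by auto
  have w': "0 < w i" if "i \<in> {1..N + 1}" for i using w that by simp
  have prod: "?D' = part_prod N ?D 1 (parts 1)"
  proof (rule down_block_prod[OF B w'])
    fix k X Y assume "N \<le> k" "k < N + 1" and X: "X \<subseteq> block_items k B" and Y: "Y \<subseteq> {1..Suc k}" "Suc k \<in> Y"
      and eq: "sum (item_weight w B) X = sum w Y"
    then have k: "k = N" by simp
    \<comment> \<open>All items together weigh less than the dominating part, so the situation of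
      the exchange hypothesis cannot occur.\<close>
    have "sum (item_weight w B) X \<le> sum (item_weight w B) (block_items N B)"
      using X unfolding k by (intro sum_mono2) (auto simp: block_items_def)
    also have "\<dots> = sum w B + sum (item_weight w B) ({1..N} - B)"
      unfolding block_items_def by (subst sum.insert) (auto simp: item_weight_def)
    also have "sum (item_weight w B) ({1..N} - B) = sum w ({1..N} - B)"
      by (rule sum.cong) (auto simp: item_weight_def)
    also have "sum w B + sum w ({1..N} - B) = sum w {1..N}"
      using sum.subset_diff[OF B(2), of w] by simp
    also have "\<dots> < w (Suc N)" by (rule big)
    also have "\<dots> \<le> sum w Y" using Y finite_subset[OF Y(1)] unfolding k by (intro member_le_sum) auto
    finally show "\<exists>J\<subseteq>X. sum (item_weight w B) J = w (Suc k)" using eq by simp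
  qed
  have "cut_diff (weight_cut (N + 1) w) (part_prod N ?D 1 (parts 1)) =
      cut_prod N (cut_diff (weight_cut N w) ?D) 1 (weight_cut 1 (\<lambda>_. 1))"
  proof (rule cut_diff_prod[of "w (Suc N)"])
    show "?D \<subseteq> parts N" by (auto simp: down_def)
    show "w i = w (Suc N)" if "i \<in> {N+1..N+1}" for i using that by (simp add: le_antisym)
    show "\<exists>P\<in>part_prod N ?D 1 (parts 1). x \<in> cut_at (weight_cut (N + 1) w) P"
      if "x \<in> weight_cut (N + 1) w" "(\<Sum>i\<in>{N+1..N+1}. x i) \<noteq> 0" for x
      using weight_cut_dominated[OF big, of x] that by simp
  qed (use w in simp)
  moreover have "down_closed (N + 1) (weight_cut (N + 1) w) (part_prod N ?D 1 (parts 1))"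
    using down_closed_down[OF block_partition_in_parts[OF B(1) B'], of "weight_cut (N + 1) w"] unfolding prod .
  ultimately have "FQ Fo Fm (N + 1) (weight_cut (N + 1) w) ?D' \<simeq>\<^sub>* FQ Fo Fm N (weight_cut N w) ?D \<and>\<^sub>* Fpart Fo 1 (\<lambda>_. 1)"
    unfolding prod by (intro FQ_prod[OF RF N _ w'] down_closed_down[OF block_partition_in_parts[OF B]]) auto
  then show ?thesis by simp
qed

end

lemma weight_mset_insert:
  "finite S \<Longrightarrow> x \<notin> S \<Longrightarrow> weight_mset w (insert x S) = add_mset (w x) (weight_mset w S)"
  by simp

text \<open>\<open>strongly_sequential\<close> speaks of a maximal summing set of its own, which has
  to be identified with \<open>I\<close>. Neither of two distinct such sets contains the other, as
  parts are positive; and the largest element in which they differ cannot belong to both.\<close>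

lemma Iset_unique:
  assumes np: "number_partition n l" and top: "mm n l = 1" and I: "is_Iset n l I" and A: "is_Iset n l A"
  shows "A = I"
proof -
  note T = number_partition_top_form[OF np top I]
  note sI = Iset_sum[OF np top I] and sA = Iset_sum[OF np top A]
  have eq: "X = Y" if "X \<subseteq> Y" "Y \<subseteq> {1..n - 1}" "sum l X = l n" "sum l Y = l n" for X Y
  proof (rule ccontr)
    assume "X \<noteq> Y"
    with that(1) have "Y - X \<noteq> {}" by blast
    then obtain y where y: "y \<in> Y - X" by blast
    have fY: "finite Y" using that(2) finite_subset by blast
    have "sum l Y = sum l (Y - X) + sum l X" by (rule sum.subset_diff[OF that(1) fY])
    then have "sum l (Y - X) = 0" using that by simp
    then have "l y = 0" using y fY by simp
    moreover have "0 < l y" using top_formD(4)[OF T, of y] y that(2) by blast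
    ultimately show False by simp
  qed
  have 1: "A \<subseteq> I \<or> (\<exists>e\<in>I - A. \<forall>y>e. y \<in> I \<longleftrightarrow> y \<in> A)" by (rule Iset_lex[OF np top I sA])
  have 2: "I \<subseteq> A \<or> (\<exists>e\<in>A - I. \<forall>y>e. y \<in> A \<longleftrightarrow> y \<in> I)" by (rule Iset_lex[OF np top A sI])
  show ?thesis
  proof (cases "A \<subseteq> I \<or> I \<subseteq> A")
    case True
    then show ?thesis using eq[OF _ sI(1) sA(2) sI(2)] eq[OF _ sA(1) sI(2) sA(2)] by blast
  next
    case False
    then obtain e e' where e: "e \<in> I - A" "\<forall>y>e. y \<in> I \<longleftrightarrow> y \<in> A" "e' \<in> A - I" "\<forall>y>e'. y \<in> A \<longleftrightarrow> y \<in> I"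
      using 1 2 by blast
    then have "\<not> e < e'" "\<not> e' < e" "e \<noteq> e'" by blast+
    then show ?thesis by simp
  qed
qed

section \<open>The given partition \<lambda>\<close>

context
  fixes Fo :: "cut \<Rightarrow> 'a pspace" and Fm :: "cut \<Rightarrow> cut \<Rightarrow> nat set list \<Rightarrow> 'a \<Rightarrow> 'a"
    and n :: nat and l :: "nat \<Rightarrow> nat" and I :: "nat set"
  assumes RF: "resonance_functor Fo Fm"
    and contr: "\<forall>k\<ge>2. pointed_contractible (Fpart Fo k (\<lambda>_. 1))"
    and np: "number_partition n l" and seq: "sequential n l" and Iset: "is_Iset n l I"
begin

lemma contractible_repeated_largest:
  assumes "2 \<le> mm n l"
  shows "pointed_contractible (Fpart Fo n l)"
proof -
  have pos: "0 < l i" if "i \<in> {1..n}" for i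
    using np that by (auto simp: number_partition_def)
  have mono: "l i \<le> l n" if "i \<in> {1..n}" for i
    using np that unfolding number_partition_def by (intro mono_onD[of "{1..n}" l]) auto
  have n: "1 \<le> n" using np by (simp add: number_partition_def)
  let ?A = "{i \<in> {1..n}. l i = l n}"
  have "weight_mset l ?A = image_mset (\<lambda>_. l n) (mset_set ?A)" by (rule image_mset_cong) auto
  then have "weight_mset l ?A = replicate_mset (card ?A) (l n)" by (simp add: image_mset_const_eq)
  moreover have "weight_mset l ?A \<subseteq># weight_mset l {1..n}" by (rule weight_mset_mono) auto
  ultimately have "card ?A \<le> count (weight_mset l {1..n}) (l n)"
    by (metis count_replicate_mset mset_subset_eq_count)
  then have c: "2 \<le> count (weight_mset l {1..n}) (l n)" using assms by (simp add: mm_def)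
  show ?thesis
  proof (rule contractible_repeated_top[OF RF contr sequential_seq_mset[OF np seq] _ _ _ c refl])
    show "0 \<notin># weight_mset l {1..n}" by (rule zero_notin_weight_mset[OF pos]) auto
    show "l n \<in># weight_mset l {1..n}" using n by simp
    show "x \<le> l n" if "x \<in># weight_mset l {1..n}" for x using that mono by auto
  qed
qed

context
  assumes top: "mm n l = 1"
begin

abbreviation (input) "T' \<equiv> weight_cut (n - 1) l"
abbreviation (input) "\<nu>' \<equiv> block_partition (n - 1) I"
abbreviation (input) "FQT' \<equiv> FQ Fo Fm (n - 1) (weight_cut (n - 1) l) (down (n - 1) (block_partition (n - 1) I) (weight_cut (n - 1) l))"
abbreviation (input) "F\<mu>' \<equiv> Fpart Fo (card ({1..n} - I)) (subpartition l ({1..n} - I))"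

lemma top_form_l: "top_form (n - 1) 1 l (l n)"
  by (rule number_partition_top_form[OF np top Iset])

lemma I_sub: "I \<subseteq> {1..n - 1}" and I_sum: "sum l I = l n"
  using Iset_sum[OF np top Iset] by auto

lemma I_ne: "I \<noteq> {}"
  using top_form_sum_card[OF top_form_l I_sub I_sum] by auto

lemma N_pos: "1 \<le> n - 1"
  using I_ne I_sub by (cases "n - 1") auto

lemma n_eq: "n - 1 + 1 = n" "Suc (n - 1) = n"
  using N_pos by auto

lemma l_pos: "i \<in> {1..n} \<Longrightarrow> 0 < l i" and l_pos': "i \<in> {1..n - 1} \<Longrightarrow> 0 < l i"
  using np by (auto simp: number_partition_def)

lemma seq_l: "seq_mset (weight_mset l {1..n})"
  by (rule sequential_seq_mset[OF np seq])

lemma Fpart_l_equiv: "Fpart Fo n l \<simeq>\<^sub>* FQT' \<and>\<^sub>* Fpart Fo 1 (\<lambda>_. 1)"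
  using Fpart_equiv_FQ_smash_seq[OF RF contr top_form_l _ I_sub I_sum Iset_irreducible[OF np top Iset]] seq_l
  unfolding n_eq by blast

lemma is_pspace_F': "is_pspace (Fpart Fo (n - 1) l)"
  by (rule is_pspace_Fpart[OF RF N_pos l_pos'])

lemma n_not_in_I: "n \<notin> I"
proof
  assume "n \<in> I"
  then have "n \<in> {1..n - 1}" using I_sub by blast
  then show False using N_pos by auto
qed

lemma mu_mset: "weight_mset (subpartition l ({1..n} - I)) {1..card ({1..n} - I)} = weight_mset l ({1..n} - I)"
  by (rule weight_mset_subpartition) simp

lemma mu_pos: "1 \<le> card ({1..n} - I)" "i \<in> {1..card ({1..n} - I)} \<Longrightarrow> 0 < subpartition l ({1..n} - I) i"
proof -
  have "n \<in> {1..n} - I" using n_not_in_I N_pos by auto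
  then have "card ({1..n} - I) \<noteq> 0" by (metis card_eq_0_iff empty_iff finite_Diff finite_atLeastAtMost)
  then show "1 \<le> card ({1..n} - I)" by linarith
  show "0 < subpartition l ({1..n} - I) i" if i: "i \<in> {1..card ({1..n} - I)}"
  proof -
    have "subpartition l ({1..n} - I) i \<in># weight_mset (subpartition l ({1..n} - I)) {1..card ({1..n} - I)}"
      using i by simp
    then have "subpartition l ({1..n} - I) i \<in># weight_mset l ({1..n} - I)" unfolding mu_mset .
    then show ?thesis using l_pos by auto
  qed
qed

lemma is_pspace_mu: "is_pspace F\<mu>'"
  by (rule is_pspace_Fpart[OF RF mu_pos])

lemma block_weight_mu:
  assumes p: "p \<in> ord_parts (n - 1)" "set p = \<nu>'"
  shows "weight_mset (block_weight p l) {1..length p} = weight_mset l ({1..n} - I)"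
proof -
  have "{1..n} - I = insert n ({1..n - 1} - I)" using n_not_in_I N_pos by auto
  moreover have "n \<notin> {1..n - 1} - I" using N_pos by auto
  ultimately have "weight_mset l ({1..n} - I) = add_mset (l n) (weight_mset l ({1..n - 1} - I))"
    using weight_mset_insert[of "{1..n - 1} - I" n l] by simp
  then show ?thesis unfolding weight_mset_block[OF p] I_sum ..
qed

text \<open>\<open>h\<close> only reorders: \<mu> lists its parts by increasing index, the block
  sums follow the order of \<open>p\<close>, and the multisets agree because the block
  \<open>I\<close> contributes the part \<open>l n\<close>.\<close>

lemma nu_inclusion:
  assumes p: "p \<in> ord_parts (n - 1)" "set p = \<nu>'"
  obtains h where "pointed_homeo F\<mu>' (Fpart Fo (length p) (block_weight p l)) h"
    "inclusion_map F\<mu>' (Fpart Fo (n - 1) l) (Fm (pull_obj p T') (n - 1, T') p \<circ> h)"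
    "pquot (Fpart Fo (n - 1) l) ((Fm (pull_obj p T') (n - 1, T') p \<circ> h) ` topspace (fst F\<mu>')) \<simeq>\<^sub>* FQT'"
proof -
  have ppos: "0 < block_weight p l i" if "i \<in> {1..length p}" for i
    by (rule block_weight_pos[OF p(1) _ that]) (rule l_pos')
  have "\<exists>h. pointed_homeo F\<mu>' (Fpart Fo (length p) (block_weight p l)) h"
  proof (rule Fpart_homeo[OF RF mu_pos(1) _ ord_parts_length[OF p(1) N_pos]])
    show "weight_mset (subpartition l ({1..n} - I)) {1..card ({1..n} - I)} = weight_mset (block_weight p l) {1..length p}"
      by (rule trans[OF mu_mset block_weight_mu[OF p, symmetric]])
  qed (use mu_pos(2) ppos in auto)
  then obtain h where h: "pointed_homeo F\<mu>' (Fpart Fo (length p) (block_weight p l)) h" by blast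
  have i: "inclusion_map (Fpart Fo (length p) (block_weight p l)) (Fpart Fo (n - 1) l)
      (Fm (pull_obj p T') (n - 1, T') p)"
    by (rule inclusion_axiom(1)[OF RF N_pos l_pos' p(1)])
  have "pquot (Fpart Fo (n - 1) l) (mor_image Fo Fm (n - 1) T' p) \<simeq>\<^sub>* FQ Fo Fm (n - 1) T' (down (n - 1) (set p) T')"
    by (rule inclusion_axiom(2)[OF RF N_pos l_pos' p(1)])
  then have q: "pquot (Fpart Fo (n - 1) l) ((Fm (pull_obj p T') (n - 1, T') p \<circ> h) ` topspace (fst F\<mu>')) \<simeq>\<^sub>* FQT'"
    unfolding mor_image_eq[OF RF p(1)] p(2) inclusion_map_compose_homeo(2)[OF is_pspace_mu h i] .
  show thesis by (rule that[OF h inclusion_map_compose_homeo(1)[OF is_pspace_mu h i] q])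
qed

lemma strongly_sequentialE:
  assumes "strongly_sequential n l"
  obtains J where "J \<subseteq> I - {Max I}" "J \<noteq> {}" "sum l J = l (Max I)"
proof -
  obtain A J where A: "is_Iset n l A" and J: "J \<subseteq> A - {Max A}" "l (Max A) = sum l J"
    using assms unfolding strongly_sequential_def by blast
  have AI: "A = I" by (rule Iset_unique[OF np top Iset A])
  have "finite I" using I_sub finite_subset by blast
  then have "Max I \<in> {1..n - 1}" using I_ne I_sub Max_in by blast
  then have "0 < l (Max I)" by (rule l_pos')
  then have "J \<noteq> {}" using J(2) AI by auto
  then show thesis using that[of J] J unfolding AI by simp
qed

text \<open>After merging \<open>J\<close>, the value \<open>l (Max I)\<close> is repeated, and no larger part is a sum that uses
  it: otherwise an exchange would produce a summing set larger than \<open>I\<close>.\<close>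

lemma contractible_merged:
  assumes J: "J \<subseteq> I - {Max I}" "J \<noteq> {}" "sum l J = l (Max I)"
    and q: "q \<in> ord_parts (n - 1)" "set q = block_partition (n - 1) J"
  shows "pointed_contractible (Fpart Fo (length q) (block_weight q l))"
proof -
  let ?x = "Max I"
  have fI: "finite I" using I_sub finite_subset by blast
  have xI: "?x \<in> I" using fI I_ne by simp
  have fJ: "finite J" using J(1) fI finite_subset by blast
  let ?v = "l ?x" and ?J = "weight_mset l J" and ?I0 = "weight_mset l (I - {?x} - J)" and ?K = "weight_mset l ({1..n - 1} - I)"
  have split3: "weight_mset l I = add_mset ?v (?J + ?I0)"
  proof -
    have "weight_mset l I = weight_mset l {?x} + weight_mset l (I - {?x})"
      by (rule weight_mset_diff) (use xI fI in auto)
    moreover have "weight_mset l (I - {?x}) = ?J + ?I0"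
      by (rule weight_mset_diff) (use J fI in auto)
    ultimately show ?thesis by simp
  qed
  have MT: "weight_mset l {1..n - 1} = add_mset ?v (?J + ?I0 + ?K)"
    using weight_mset_diff[OF I_sub, of l] unfolding split3 by simp
  have M: "weight_mset l {1..n} = add_mset (l n) (add_mset ?v (?J + ?I0 + ?K))"
    using weight_mset_top[OF top_form_l] unfolding n_eq MT by simp
  have MTpos: "0 \<notin># weight_mset l {1..n - 1}" by (rule zero_notin_weight_mset[OF l_pos']) auto
  have "{1..n - 1} - J = insert ?x ((I - {?x} - J) \<union> ({1..n - 1} - I))"
    using J(1) I_sub xI by auto
  moreover have "weight_mset l (insert ?x ((I - {?x} - J) \<union> ({1..n - 1} - I))) =
      add_mset ?v (weight_mset l ((I - {?x} - J) \<union> ({1..n - 1} - I)))"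
    by (rule weight_mset_insert) (use fI xI in auto)
  moreover have "weight_mset l ((I - {?x} - J) \<union> ({1..n - 1} - I)) = ?I0 + ?K"
    using fI by (subst mset_set_Union) auto
  ultimately have "weight_mset l ({1..n - 1} - J) = add_mset ?v (?I0 + ?K)" by simp
  then have qM: "weight_mset (block_weight q l) {1..length q} = add_mset ?v (add_mset ?v (?I0 + ?K))"
    unfolding weight_mset_block[OF q] J(3) by simp
  have seqM: "seq_mset (add_mset (l n) (add_mset ?v (?J + ?I0 + ?K)))" using seq_l unfolding M .
  have t: "\<Sum>\<^sub># (add_mset ?v (?J + ?I0)) = l n"
    unfolding split3[symmetric] sum_weight_mset by (rule I_sum)
  have v: "\<Sum>\<^sub># ?J = ?v" unfolding sum_weight_mset by (rule J(3))
  have le: "y \<le> ?v" if "y \<in># ?J + ?I0" for y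
  proof -
    have "\<exists>i\<in>I. y = l i" using that J(1) fI fJ by auto
    then obtain i where i: "i \<in> I" "y = l i" by blast
    have "{1..n - 1} \<subseteq> {1..n}" by auto
    then have "i \<in> {1..n}" "?x \<in> {1..n}" using i xI I_sub by blast+
    then show ?thesis
      using np i fI unfolding number_partition_def by (auto intro!: mono_onD[of "{1..n}" l])
  qed
  have lt: "y < l n" if "y \<in># add_mset ?v (?J + ?I0 + ?K)" for y
    using that top_formD(3)[OF top_form_l] unfolding MT[symmetric] by auto
  \<comment> \<open>Here lexicographic maximality of \<open>I\<close> enters: a set with sum
    \<open>l n\<close> that contains a part larger than \<open>?v\<close> would exceed
    \<open>I\<close>.\<close>
  have L: "p \<le> ?v" if B: "B \<subseteq># add_mset ?v (?J + ?I0 + ?K)" "\<Sum>\<^sub># B = l n" "p \<in># B" for B p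
  proof -
    obtain X where X: "X \<subseteq> {1..n - 1}" "B = weight_mset l X"
      by (rule sub_weight_mset[OF _ B(1)[folded MT]]) simp
    have fX: "finite X" using X(1) finite_subset by blast
    obtain x where x: "x \<in> X" "p = l x" using B(3) X(2) fX by auto
    have "sum l X = l n" using B(2) X(2) by (simp add: sum_weight_mset)
    then show ?thesis using Iset_no_larger[OF np top Iset X(1) _ x(1)] x(2) by simp
  qed
  have pos: "0 \<notin># add_mset ?v (?J + ?I0 + ?K)" using MTpos unfolding MT .
  note D = seq_mset_merge_doubled[OF seqM t v pos le lt L]
  show ?thesis
  proof (rule contractible_repeated_value[OF RF contr D(1) _ _ D(2) qM])
    show "0 \<notin># add_mset ?v (add_mset ?v (?I0 + ?K))" using pos by auto
    show "2 \<le> count (add_mset ?v (add_mset ?v (?I0 + ?K))) ?v" by simp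
  qed
qed

lemma block_partition_refines:
  assumes J: "J \<subseteq> I" "J \<noteq> {}" and B: "B \<in> block_partition k J"
  shows "\<exists>P\<in>block_partition k I. B \<subseteq> P"
  using assms by (auto simp: block_partition_def)

end

end

theorem theorem1p5p7:
  fixes Fo :: "cut \<Rightarrow> 'a pspace"
    and Fm :: "cut \<Rightarrow> cut \<Rightarrow> nat set list \<Rightarrow> 'a \<Rightarrow> 'a"
    and n :: nat and l :: "nat \<Rightarrow> nat" and I :: "nat set"
  assumes "resonance_functor Fo Fm"
    and "\<And>k. k \<ge> 2 \<Longrightarrow> pointed_contractible (Fpart Fo k (\<lambda>_. 1))"
    and "number_partition n l"
    and "sequential n l"
    and "is_Iset n l I"
  shows "(mm n l \<ge> 2 \<longrightarrow> pointed_contractible (Fpart Fo n l)) \<and>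
    (mm n l = 1 \<longrightarrow>
      (let F1 = Fpart Fo 1 (\<lambda>_. 1);
           N = n - mm n l;
           T = weight_cut N l;
           \<nu> = block_partition N I;
           F\<mu> = Fpart Fo (card ({1..n} - I)) (subpartition l ({1..n} - I));
           F' = Fpart Fo (n - 1) l;
           FQT = FQ Fo Fm N T (down N \<nu> T)
       in Fpart Fo n l \<simeq>\<^sub>* FQT \<and>\<^sub>* F1 \<and>
          (\<forall>p\<in>ord_parts N. set p = \<nu> \<longrightarrow>
             (\<exists>h i. pointed_homeo F\<mu> (Fo (pull_obj p T)) h \<and>
                i = Fm (pull_obj p T) (N, T) p \<circ> h \<and>
                inclusion_triple F\<mu> F' FQT i \<and>
                (strongly_sequential n l \<longrightarrow> pointed_homotopic F\<mu> F' i (\<lambda>_. snd F')))) \<and>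
          (strongly_sequential n l \<longrightarrow>
             FQT \<simeq>\<^sub>* F' \<or>\<^sub>* psusp F\<mu> \<and>
             Fpart Fo n l \<simeq>\<^sub>* (F1 \<and>\<^sub>* F') \<or>\<^sub>* psusp (F1 \<and>\<^sub>* F\<mu>))))"
proof (intro conjI impI)
  have contr: "\<forall>k\<ge>2. pointed_contractible (Fpart Fo k (\<lambda>_. 1))" using assms(2) by blast
  note A = assms(1) contr assms(3-5)
  assume "2 \<le> mm n l"
  then show "pointed_contractible (Fpart Fo n l)"
    by (rule contractible_repeated_largest[OF A])
next
  have contr: "\<forall>k\<ge>2. pointed_contractible (Fpart Fo k (\<lambda>_. 1))" using assms(2) by blast
  note A = assms(1) contr assms(3-5)
  assume top: "mm n l = 1"
  note RF = assms(1)
  note N_pos = N_pos[OF A top] and n_eq = n_eq(2)[OF A top] and I_ne = I_ne[OF A top]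
    and I_sub = I_sub[OF A top] and l_pos = l_pos[OF A top] and l_pos' = l_pos'[OF A top]
  let ?N = "n - 1" and ?T = "weight_cut (n - 1) l" and ?\<nu> = "block_partition (n - 1) I"
  let ?F1 = "Fpart Fo 1 (\<lambda>_. 1)" and ?F' = "Fpart Fo (n - 1) l"
  let ?F\<mu> = "Fpart Fo (card ({1..n} - I)) (subpartition l ({1..n} - I))"
  let ?FQT = "FQ Fo Fm ?N ?T (down ?N ?\<nu> ?T)"
  have pF1: "is_pspace ?F1" by (rule is_pspace_Fpart[OF RF]) auto
  have pF': "is_pspace ?F'" by (rule is_pspace_F'[OF A top])
  have p\<mu>: "is_pspace ?F\<mu>" by (rule is_pspace_mu[OF A top])
  have part1: "Fpart Fo n l \<simeq>\<^sub>* ?FQT \<and>\<^sub>* ?F1" by (rule Fpart_l_equiv[OF A top])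
  have triple: "\<exists>h. pointed_homeo ?F\<mu> (Fo (pull_obj p ?T)) h \<and>
      inclusion_triple ?F\<mu> ?F' ?FQT (Fm (pull_obj p ?T) (?N, ?T) p \<circ> h) \<and>
      (strongly_sequential n l \<longrightarrow> pointed_homotopic ?F\<mu> ?F' (Fm (pull_obj p ?T) (?N, ?T) p \<circ> h) (\<lambda>_. snd ?F'))"
    if p: "p \<in> ord_parts ?N" "set p = ?\<nu>" for p
  proof -
    obtain h where h: "pointed_homeo ?F\<mu> (Fpart Fo (length p) (block_weight p l)) h"
      "inclusion_map ?F\<mu> ?F' (Fm (pull_obj p ?T) (?N, ?T) p \<circ> h)"
      "pquot ?F' ((Fm (pull_obj p ?T) (?N, ?T) p \<circ> h) ` topspace (fst ?F\<mu>)) \<simeq>\<^sub>* ?FQT"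
      by (rule nu_inclusion[OF A top p])
    have "pointed_homotopic ?F\<mu> ?F' (Fm (pull_obj p ?T) (?N, ?T) p \<circ> h) (\<lambda>_. snd ?F')"
      if strong: "strongly_sequential n l"
    proof -
      obtain J where J: "J \<subseteq> I - {Max I}" "J \<noteq> {}" "sum l J = l (Max I)"
        by (rule strongly_sequentialE[OF A top strong])
      have J': "J \<subseteq> {1..?N}" using J(1) I_sub by blast
      obtain q where q: "q \<in> ord_parts ?N" "set q = block_partition ?N J"
        by (rule ord_parts_exists[OF block_partition_in_parts[OF J(2) J']])
      have ref: "\<exists>P\<in>set p. B \<subseteq> P" if "B \<in> set q" for B
        using block_partition_refines[OF A top _ J(2), of B ?N] J(1) that unfolding p(2) q(2) by blast
      have "pointed_homotopic (Fpart Fo (length p) (block_weight p l)) ?F'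
          (Fm (pull_obj p ?T) (?N, ?T) p) (\<lambda>_. snd ?F')"
        by (rule null_homotopic_through_refinement[OF RF N_pos l_pos' p(1) q(1) ref
              contractible_merged[OF A top J q]])
      moreover have "pointed_map ?F\<mu> (Fpart Fo (length p) (block_weight p l)) h"
        using pointed_homeoE[OF h(1) p\<mu>] by blast
      ultimately have "pointed_homotopic ?F\<mu> ?F' (Fm (pull_obj p ?T) (?N, ?T) p \<circ> h) ((\<lambda>_. snd ?F') \<circ> h)"
        by (rule pointed_homotopic_compose_right)
      then show ?thesis by (simp add: o_def)
    qed
    then show ?thesis
      using h pull_obj_weight_cut[OF p(1), of l] unfolding inclusion_triple_def Fpart_def by (intro exI[of _ h]) simp
  qed
  have split: "?FQT \<simeq>\<^sub>* ?F' \<or>\<^sub>* psusp ?F\<mu> \<and> Fpart Fo n l \<simeq>\<^sub>* (?F1 \<and>\<^sub>* ?F') \<or>\<^sub>* psusp (?F1 \<and>\<^sub>* ?F\<mu>)"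
    if strong: "strongly_sequential n l"
  proof
    obtain p where p: "p \<in> ord_parts ?N" "set p = ?\<nu>"
      by (rule ord_parts_exists[OF block_partition_in_parts[OF I_ne I_sub]])
    obtain h where h: "inclusion_triple ?F\<mu> ?F' ?FQT (Fm (pull_obj p ?T) (?N, ?T) p \<circ> h)"
      "pointed_homotopic ?F\<mu> ?F' (Fm (pull_obj p ?T) (?N, ?T) p \<circ> h) (\<lambda>_. snd ?F')"
      using triple[OF p] strong by blast
    let ?i = "Fm (pull_obj p ?T) (?N, ?T) p \<circ> h"
    have incl: "inclusion_map ?F\<mu> ?F' ?i" "pquot ?F' (?i ` topspace (fst ?F\<mu>)) \<simeq>\<^sub>* ?FQT"
      using h(1) by (auto simp: inclusion_triple_def)
    show "?FQT \<simeq>\<^sub>* ?F' \<or>\<^sub>* psusp ?F\<mu>"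
      by (rule pointed_equiv_trans[OF pointed_equiv_sym[OF incl(2)] pquot_null_homotopic[OF p\<mu> pF' incl(1) h(2)]])
    \<comment> \<open>\<open>u\<close> differs from \<open>l\<close> only in the last part, so the
      values at partitions of \<open>{1..n - 1}\<close> are unchanged, while domination lets a
      factor F(1) split off from each space involved.\<close>
    define u where "u = l(n := Suc (sum l {1..?N}))"
    have ul: "u i = l i" if "i \<in> {1..?N}" for i using that by (auto simp: u_def)
    have upos: "0 < u i" if "i \<in> {1..Suc ?N}" for i
      using that l_pos[of i] n_eq by (simp add: u_def)
    have big: "sum u {1..?N} < u (Suc ?N)"
    proof -
      have "sum u {1..?N} = sum l {1..?N}" by (rule sum.cong) (use ul in auto)
      then show ?thesis using n_eq by (simp add: u_def)
    qed
    have uT: "weight_cut ?N u = ?T" by (rule weight_cut_cong) (rule ul)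
    have I_sub': "I \<subseteq> {1..Suc ?N}" using I_sub by auto
    obtain J where J: "J \<subseteq> I - {Max I}" "J \<noteq> {}" "sum l J = l (Max I)"
      by (rule strongly_sequentialE[OF A top strong])
    have J': "J \<subseteq> {1..?N}" "J \<subseteq> {1..Suc ?N}" using J(1) I_sub by auto
    obtain q where q: "q \<in> ord_parts ?N" "set q = block_partition ?N J"
      by (rule ord_parts_exists[OF block_partition_in_parts[OF J(2) J'(1)]])
    obtain p' where p': "p' \<in> ord_parts (Suc ?N)" "set p' = block_partition (Suc ?N) I"
      by (rule ord_parts_exists[OF block_partition_in_parts[OF I_ne I_sub']])
    obtain q' where q': "q' \<in> ord_parts (Suc ?N)" "set q' = block_partition (Suc ?N) J"
      by (rule ord_parts_exists[OF block_partition_in_parts[OF J(2) J'(2)]])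
    have bw: "Fpart Fo (length r) (block_weight r u) = Fpart Fo (length r) (block_weight r l)"
      if "r \<in> ord_parts ?N" for r
    proof (intro Fpart_cong[OF RF] weight_cut_cong)
      fix j assume "j \<in> {1..length r}"
      then have "r ! (j - 1) \<subseteq> {1..?N}" by (rule ord_parts_block[OF that])
      then show "block_weight r u j = block_weight r l j"
        unfolding block_weight_def using ul by (intro sum.cong) auto
    qed
    have N1: "1 \<le> Suc ?N" by simp
    let ?S = "weight_cut (Suc ?N) u"
    let ?A = "Fpart Fo (length p') (block_weight p' u)" and ?X = "Fpart Fo (Suc ?N) u"
    let ?f = "Fm (pull_obj p' ?S) (Suc ?N, ?S) p'"
    have p'pos: "0 < block_weight p' u i" if "i \<in> {1..length p'}" for i
      by (rule block_weight_pos[OF p'(1) _ that]) (rule upos)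
    have ppos: "0 < block_weight p l i" if "i \<in> {1..length p}" for i
      by (rule block_weight_pos[OF p(1) _ that]) (rule l_pos')
    have qpos: "0 < block_weight q l i" if "i \<in> {1..length q}" for i
      by (rule block_weight_pos[OF q(1) _ that]) (rule l_pos')
    have pA: "is_pspace ?A" by (rule is_pspace_Fpart[OF RF ord_parts_length[OF p'(1) N1] p'pos])
    have pX: "is_pspace ?X" by (rule is_pspace_Fpart[OF RF N1 upos])
    have pp: "is_pspace (Fpart Fo (length p) (block_weight p l))"
      by (rule is_pspace_Fpart[OF RF ord_parts_length[OF p(1) N_pos] ppos])
    have pq: "is_pspace (Fpart Fo (length q) (block_weight q l))"
      by (rule is_pspace_Fpart[OF RF ord_parts_length[OF q(1) N_pos] qpos])
    have inclA: "inclusion_map ?A ?X ?f" by (rule inclusion_axiom(1)[OF RF N1 upos p'(1)])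
    have quotA: "pquot ?X (?f ` topspace (fst ?A)) \<simeq>\<^sub>* FQ Fo Fm (Suc ?N) ?S (down (Suc ?N) (set p') ?S)"
      unfolding mor_image_eq[OF RF p'(1), symmetric] by (rule inclusion_axiom(2)[OF RF N1 upos p'(1)])
    \<comment> \<open>The value at the merged partition stays contractible after the dominating part
      is added, because this only smashes it with F(1).\<close>
    have "Fpart Fo (length q') (block_weight q' u) \<simeq>\<^sub>* Fpart Fo (length q) (block_weight q u) \<and>\<^sub>* ?F1"
      by (rule Fpart_dominated_block[OF RF N_pos upos big J(2) J'(1) q q'])
    moreover have "pointed_contractible (Fpart Fo (length q) (block_weight q u) \<and>\<^sub>* ?F1)"
      unfolding bw[OF q(1)] by (rule smash_contractible[OF contractible_merged[OF A top J q] pq pF1])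
    ultimately have cq': "pointed_contractible (Fpart Fo (length q') (block_weight q' u))"
      by (rule pointed_contractible_equiv)
    have ref: "\<exists>P\<in>set p'. B \<subseteq> P" if "B \<in> set q'" for B
      using block_partition_refines[OF A top _ J(2), of B "Suc ?N"] J(1) that unfolding p'(2) q'(2) by blast
    have null: "pointed_homotopic ?A ?X ?f (\<lambda>_. snd ?X)"
      by (rule null_homotopic_through_refinement[OF RF N1 upos p'(1) q'(1) ref cq'])
    \<comment> \<open>The splitting takes place in the dominated partition itself. The factor F(1)
      is made explicit only afterwards, inside each summand, where homotopy invariance of wedge and
      suspension suffices.\<close>
    have e1: "pquot ?X (?f ` topspace (fst ?A)) \<simeq>\<^sub>* ?X \<or>\<^sub>* psusp ?A"
      by (rule pquot_null_homotopic[OF pA pX inclA null])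
    have "FQ Fo Fm (Suc ?N) ?S (down (Suc ?N) (set p') ?S) \<simeq>\<^sub>* FQ Fo Fm ?N (weight_cut ?N u)
        (down ?N (block_partition ?N I) (weight_cut ?N u)) \<and>\<^sub>* ?F1"
      unfolding p'(2) by (rule FQ_dominated[OF RF N_pos upos big I_ne I_sub])
    then have e2: "FQ Fo Fm (Suc ?N) ?S (down (Suc ?N) (set p') ?S) \<simeq>\<^sub>* ?FQT \<and>\<^sub>* ?F1" unfolding uT .
    have e3: "Fpart Fo n l \<simeq>\<^sub>* ?X \<or>\<^sub>* psusp ?A"
      by (rule pointed_equiv_trans[OF part1 pointed_equiv_trans[OF pointed_equiv_sym[OF e2]
              pointed_equiv_trans[OF pointed_equiv_sym[OF quotA] e1]]])
    have FuN: "Fpart Fo ?N u = ?F'" by (rule Fpart_cong[OF RF uT])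
    have "?X \<simeq>\<^sub>* Fpart Fo ?N u \<and>\<^sub>* ?F1" by (rule Fpart_dominated[OF RF N_pos upos big])
    then have eX: "?X \<simeq>\<^sub>* ?F1 \<and>\<^sub>* ?F'"
      unfolding FuN by (rule pointed_equiv_trans[OF _ smash_commute[OF pF' pF1]])
    have "?A \<simeq>\<^sub>* Fpart Fo (length p) (block_weight p u) \<and>\<^sub>* ?F1"
      by (rule Fpart_dominated_block[OF RF N_pos upos big I_ne I_sub p p'])
    then have eA1: "?A \<simeq>\<^sub>* Fpart Fo (length p) (block_weight p l) \<and>\<^sub>* ?F1" unfolding bw[OF p(1)] .
    have "?F\<mu> \<simeq>\<^sub>* Fpart Fo (length p) (block_weight p l)"
    proof -
      obtain h' where "pointed_homeo ?F\<mu> (Fpart Fo (length p) (block_weight p l)) h'"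
        by (rule nu_inclusion[OF A top p])
      then show ?thesis by (rule pointed_homeo_imp_equiv[OF _ p\<mu> pp])
    qed
    then have "Fpart Fo (length p) (block_weight p l) \<and>\<^sub>* ?F1 \<simeq>\<^sub>* ?F\<mu> \<and>\<^sub>* ?F1"
      by (intro smash_equiv pointed_equiv_refl pp p\<mu> pF1) (rule pointed_equiv_sym)
    then have eA: "?A \<simeq>\<^sub>* ?F1 \<and>\<^sub>* ?F\<mu>"
      using pointed_equiv_trans[OF eA1 pointed_equiv_trans[OF _ smash_commute[OF p\<mu> pF1]]] by blast
    have p1: "is_pspace (?F1 \<and>\<^sub>* ?F')" by (rule is_pspace_smash[OF pF1 pF'])
    have p2: "is_pspace (?F1 \<and>\<^sub>* ?F\<mu>)" by (rule is_pspace_smash[OF pF1 p\<mu>])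
    have "?X \<or>\<^sub>* psusp ?A \<simeq>\<^sub>* (?F1 \<and>\<^sub>* ?F') \<or>\<^sub>* psusp (?F1 \<and>\<^sub>* ?F\<mu>)"
      by (rule pwedge_equiv[OF eX psusp_equiv[OF eA pA p2] pX p1 is_pspace_psusp[OF pA] is_pspace_psusp[OF p2]])
    then show "Fpart Fo n l \<simeq>\<^sub>* (?F1 \<and>\<^sub>* ?F') \<or>\<^sub>* psusp (?F1 \<and>\<^sub>* ?F\<mu>)"
      by (rule pointed_equiv_trans[OF e3])
  qed
  show "let F1 = Fpart Fo 1 (\<lambda>_. 1);
           N = n - mm n l;
           T = weight_cut N l;
           \<nu> = block_partition N I;
           F\<mu> = Fpart Fo (card ({1..n} - I)) (subpartition l ({1..n} - I));
           F' = Fpart Fo (n - 1) l;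
           FQT = FQ Fo Fm N T (down N \<nu> T)
       in Fpart Fo n l \<simeq>\<^sub>* FQT \<and>\<^sub>* F1 \<and>
          (\<forall>p\<in>ord_parts N. set p = \<nu> \<longrightarrow>
             (\<exists>h i. pointed_homeo F\<mu> (Fo (pull_obj p T)) h \<and>
                i = Fm (pull_obj p T) (N, T) p \<circ> h \<and>
                inclusion_triple F\<mu> F' FQT i \<and>
                (strongly_sequential n l \<longrightarrow> pointed_homotopic F\<mu> F' i (\<lambda>_. snd F')))) \<and>
          (strongly_sequential n l \<longrightarrow>
             FQT \<simeq>\<^sub>* F' \<or>\<^sub>* psusp F\<mu> \<and>
             Fpart Fo n l \<simeq>\<^sub>* (F1 \<and>\<^sub>* F') \<or>\<^sub>* psusp (F1 \<and>\<^sub>* F\<mu>))"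
    unfolding Let_def top using part1 triple split by blast
qed

end
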